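(* Let $(S_T^1,\dots,S_T^n)$ be an i.i.d. vector of Lévy's stochastic areas on $[0,T]$, let $|\cdot|_2$ denote the Euclidean norm on $\mathbb R^n$ and let $b\in(0,1)$. Then $$P\big(|(S_T^1,\dots,S_T^n)|_2-2E[|(S_T^1,\dots,S_T^n)|_2]\ge x\big)\le\exp\left(-\frac{(1-b)\pi}Tx+K_b\right),\qquad x>0,$$ and $$P\big(|(S_T^1,\dots,S_T^n)|_2-2E[|(S_T^1,\dots,S_T^n)|_2]\ge x\big)\le\exp\left(-\frac{(1-b)\pi}Tx\right),\qquad x\ge\frac{2T}{\pi b}K_{b/2},$$ where $$K_b=-32\log b-32(1-b)+\frac{16T^2}{\pi^2(E[|S_T^1|])^2}\,\frac{(1-b)^2}{b^2}.$$
   Context: Lévy's stochastic area on $[0,T]$ is $S_T=\frac12\int_0^T\big(B^1(t)\,dB^2(t)-B^2(t)\,dB^1(t)\big)$, where $(B^1(t),B^2(t))_{t\ge0}$ is a two-dimensional Brownian motion. *)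

theory Defs
  imports "HOL-Probability.Probability"
begin

definition brownian_motion :: "'a measure \<Rightarrow> (real \<Rightarrow> 'a \<Rightarrow> real) \<Rightarrow> bool" where
  "brownian_motion M W \<longleftrightarrow>
     prob_space M \<and>
     (\<forall>t\<ge>0. W t \<in> borel_measurable M) \<and>
     (AE \<omega> in M. W 0 \<omega> = 0) \<and>
     (\<forall>\<omega>\<in>space M. continuous_on {0..} (\<lambda>t. W t \<omega>)) \<and>
     (\<forall>s t. 0 \<le> s \<longrightarrow> s < t \<longrightarrow>
        distributed M lborel (\<lambda>\<omega>. W t \<omega> - W s \<omega>) (normal_density 0 (sqrt (t - s)))) \<and>
     (\<forall>n t. 0 \<le> t 0 \<longrightarrow> mono_on {..n} t \<longrightarrow>
        prob_space.indep_vars M (\<lambda>_. borel) (\<lambda>i \<omega>. W (t (Suc i)) \<omega> - W (t i) \<omega>) {..<n::nat})"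

definition brownian_motion_2d ::
  "'a measure \<Rightarrow> (real \<Rightarrow> 'a \<Rightarrow> real) \<Rightarrow> (real \<Rightarrow> 'a \<Rightarrow> real) \<Rightarrow> bool" where
  "brownian_motion_2d M W1 W2 \<longleftrightarrow>
     brownian_motion M W1 \<and> brownian_motion M W2 \<and>
     prob_space.indep_var M
       (PiM {0..} (\<lambda>_. borel)) (\<lambda>\<omega>. \<lambda>t\<in>{0..}. W1 t \<omega>)
       (PiM {0..} (\<lambda>_. borel)) (\<lambda>\<omega>. \<lambda>t\<in>{0..}. W2 t \<omega>)"

definition natural_filtration ::
  "'a measure \<Rightarrow> (real \<Rightarrow> 'a \<Rightarrow> 'b::topological_space) \<Rightarrow> real \<Rightarrow> 'a measure" where
  "natural_filtration M X t =
     sigma (space M) {X s -` A \<inter> space M | s A. s \<in> {0..t} \<and> A \<in> sets borel}"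

text \<open>
  A simple integrand on \<open>[0, T]\<close> is given by grid points
  \<open>0 \<le> t 0 \<le> \<dots> \<le> t n \<le> T\<close> and bounded coefficients \<open>\<xi> i\<close>, the coefficient of the interval
  \<open>(t i, t (i + 1)]\<close> being measurable with respect to the information at its left end point.
\<close>

definition simple_integrand ::
  "'a measure \<Rightarrow> (real \<Rightarrow> 'a measure) \<Rightarrow> real \<Rightarrow> nat \<Rightarrow> (nat \<Rightarrow> real) \<Rightarrow> (nat \<Rightarrow> 'a \<Rightarrow> real) \<Rightarrow> bool" where
  "simple_integrand M F T n t \<xi> \<longleftrightarrow>
     0 \<le> t 0 \<and> mono_on {..n} t \<and> t n \<le> T \<and>
     (\<forall>i<n. \<xi> i \<in> borel_measurable (F (t i)) \<and> (\<exists>C. \<forall>\<omega>\<in>space M. \<bar>\<xi> i \<omega>\<bar> \<le> C))"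

definition simple_process ::
  "nat \<Rightarrow> (nat \<Rightarrow> real) \<Rightarrow> (nat \<Rightarrow> 'a \<Rightarrow> real) \<Rightarrow> real \<Rightarrow> 'a \<Rightarrow> real" where
  "simple_process n t \<xi> s \<omega> = (\<Sum>i<n. \<xi> i \<omega> * indicator {t i<..t (Suc i)} s)"

definition simple_ito_integral ::
  "(real \<Rightarrow> 'a \<Rightarrow> real) \<Rightarrow> nat \<Rightarrow> (nat \<Rightarrow> real) \<Rightarrow> (nat \<Rightarrow> 'a \<Rightarrow> real) \<Rightarrow> 'a \<Rightarrow> real" where
  "simple_ito_integral W n t \<xi> \<omega> = (\<Sum>i<n. \<xi> i \<omega> * (W (t (Suc i)) \<omega> - W (t i) \<omega>))"

text \<open>
  \<open>I\<close> is a version of the Ito integral \<open>\<integral>\<^sub>0\<^sup>T H dW\<close> of the measurable \<open>F\<close>-adapted process \<open>H\<close>: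
  it is the \<open>L\<^sup>2(M)\<close>-limit of the integrals of simple integrands that approximate \<open>H\<close> in
  \<open>L\<^sup>2([0, T] \<times> M)\<close>.  This is a relation, not a function, because the Ito integral is only
  determined up to almost sure equality.  It is meant for a Brownian motion \<open>W\<close> with respect to
  the filtration \<open>F\<close>; the Ito isometry then yields uniqueness and independence of the
  approximating sequence.
\<close>

definition has_ito_integral ::
  "'a measure \<Rightarrow> (real \<Rightarrow> 'a measure) \<Rightarrow> real \<Rightarrow> (real \<Rightarrow> 'a \<Rightarrow> real) \<Rightarrow> (real \<Rightarrow> 'a \<Rightarrow> real)
    \<Rightarrow> ('a \<Rightarrow> real) \<Rightarrow> bool" where
  "has_ito_integral M F T W H I \<longleftrightarrow>
     (\<forall>s\<in>{0..T}. H s \<in> borel_measurable (F s)) \<and>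
     (\<lambda>(s, \<omega>). H s \<omega>) \<in> borel_measurable (restrict_space borel {0..T} \<Otimes>\<^sub>M M) \<and>
     I \<in> borel_measurable M \<and>
     (\<exists>n t \<xi>.
        (\<forall>k. simple_integrand M F T (n k) (t k) (\<xi> k)) \<and>
        (\<lambda>k. \<integral>\<^sup>+\<omega>. (\<integral>\<^sup>+s\<in>{0..T}. ennreal ((simple_process (n k) (t k) (\<xi> k) s \<omega> - H s \<omega>)\<^sup>2) \<partial>lborel) \<partial>M)
          \<longlonglongrightarrow> 0 \<and>
        (\<lambda>k. \<integral>\<^sup>+\<omega>. ennreal ((simple_ito_integral W (n k) (t k) (\<xi> k) \<omega> - I \<omega>)\<^sup>2) \<partial>M) \<longlonglongrightarrow> 0)"

definition levy_area ::
  "'a measure \<Rightarrow> real \<Rightarrow> (real \<Rightarrow> 'a \<Rightarrow> real) \<Rightarrow> (real \<Rightarrow> 'a \<Rightarrow> real) \<Rightarrow> ('a \<Rightarrow> real) \<Rightarrow> bool" where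
  "levy_area M T W1 W2 S \<longleftrightarrow>
     S \<in> borel_measurable M \<and>
     (let F = natural_filtration M (\<lambda>t \<omega>. (W1 t \<omega>, W2 t \<omega>)) in
      \<exists>I J. has_ito_integral M F T W2 W1 I \<and> has_ito_integral M F T W1 W2 J \<and>
        (AE \<omega> in M. S \<omega> = 1 / 2 * (I \<omega> - J \<omega>)))"

text \<open>The argument \<open>m\<close> stands for the expectation of \<open>\<bar>S\<^sub>T\<^sup>1\<bar>\<close>.\<close>

definition levy_area_K :: "real \<Rightarrow> real \<Rightarrow> real \<Rightarrow> real" where
  "levy_area_K T m b =
     - 32 * ln b - 32 * (1 - b) + 16 * T\<^sup>2 / (pi\<^sup>2 * m\<^sup>2) * ((1 - b)\<^sup>2 / b\<^sup>2)"

end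

theory Submission
  imports Defs "HOL-Real_Asymp.Real_Asymp"
begin

text \<open>
  On the uniform grid of mesh \<open>\<delta>\<close> the discretised area is a quadratic form in independent Gaussian
  increments, and integrating out one increment maps the weight \<open>exp (\<alpha> |Z|\<^sup>2 / 2)\<close> of the planar state
  \<open>Z\<close> to a weight of the same form.  Solving the recursion for \<open>\<alpha>\<close> gives a Laplace transform that is at
  most \<open>1 / cos (c T / 2)\<close>; by the Ito isometry the discretised areas converge to \<open>S\<^sub>T\<close> in \<open>L\<^sup>2\<close>, so the
  bound passes to \<open>S\<^sub>T\<close>, whose variance is \<open>T\<^sup>2 / 4\<close>.

  For the vector, scale to \<open>T = pi\<close> and bound the Euclidean norm \<open>R\<close> by \<open>c / 2\<close> plus a sum of Huber
  functions of the coordinates, quadratic below \<open>c\<close> and linear above, with \<open>c\<close> of order \<open>sqrt n\<close>.  The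
  first-order terms of \<open>ln (E (exp (a R)))\<close> amount to \<open>2 a c / 3\<close>, which is at most \<open>2 a E R\<close> because
  the fourth moments force \<open>E R \<ge> c / 3\<close> when \<open>n \<ge> 2\<close> (for \<open>n = 1\<close> one expands \<open>exp (a R)\<close>
  directly); the remainder is bounded by the Laplace transform,
  uniformly in \<open>n\<close>, and is dominated by \<open>K\<^sub>b\<close>.
\<close>

section \<open>Independence of past and increments\<close>

text \<open>The obstacle is the dimension \<open>n\<close>. Bounding the norm by the sum of the
  absolute values would produce an exponent of order \<open>n\<close>, while only order
  \<open>sqrt n\<close>, the size of \<open>E R\<close>, can be compensated. With V = (pi / 2)^2 the
  variance of a scaled coordinate, the Huber bound with threshold \<open>c\<close> has first-order
  terms a c / 2, from the additive constant, and a n V / (2 c), from the quadratic part. Choosing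
  c^2 = 3 n V turns their sum into 2 a c / 3, and c / 3 is exactly the lower bound for
  \<open>E R\<close> that E R^2 = c^2 / 3 and E R^4 \<le> c^4 / 3 yield. This is how the factor 2 in
  front of the expectation is spent. All other terms must be of order a^2 with a = 1 - b, and have
  to fit under (1 - b)^2 (16 + 25 / (4 b^2)), a lower bound of K_b: 16 is the quadratic term of the
  logarithm, and 25 / 4 comes from pi \<le> 16 / 5 and E |S^1| \<le> T / 2. The variance T^2 / 4 is
  needed exactly, because the fourth moment is read off from the bound on the Laplace transform
  after the quadratic terms have cancelled.\<close>

lemma (in prob_space) brownian_path_indep_increment:
  assumes W: "brownian_motion M W" and uv: "0 \<le> u" "u \<le> v"
    and J: "finite J" "J \<subseteq> {0..u}" and A: "\<And>s. A s \<in> sets borel" and C: "C \<in> sets borel"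
  shows "prob {\<omega>\<in>space M. (\<forall>s\<in>J. W s \<omega> \<in> A s) \<and> W v \<omega> - W u \<omega> \<in> C} =
    prob {\<omega>\<in>space M. \<forall>s\<in>J. W s \<omega> \<in> A s} * prob {\<omega>\<in>space M. W v \<omega> - W u \<omega> \<in> C}"
proof -
  have Wm: "W t \<in> borel_measurable M" if "t \<ge> 0" for t using W that by (auto simp: brownian_motion_def)
  have W0: "AE \<omega> in M. W 0 \<omega> = 0" using W by (auto simp: brownian_motion_def)
  \<comment> \<open>Independence is given only for increments along a monotone grid. The times in
    \<open>J\<close> are therefore sorted together with 0 and \<open>u\<close>, and followed by
    \<open>v\<close>: values at times in \<open>J\<close> become partial sums of the first
    \<open>k\<close> increments, and \<open>W v - W u\<close> is the increment with index
    \<open>k\<close>.\<close>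
  define I where "I = insert 0 (insert u J)"
  define xs where "xs = sorted_list_of_set I"
  have fin: "finite I" "I \<noteq> {}" and Isub: "I \<subseteq> {0..u}" using J uv by (auto simp: I_def)
  have xs: "set xs = I" "sorted xs" "xs \<noteq> []" using fin by (auto simp: xs_def)
  define k where "k = length xs - 1"
  have len: "length xs = Suc k" using xs by (simp add: k_def)
  \<comment> \<open>Position \<open>k\<close> is the largest sorted time, which is \<open>u\<close>,
    and index \<open>Suc k\<close> gives \<open>v\<close>. The case \<open>u = v\<close> is included
    because the grid need only be weakly increasing.\<close>
  define t where "t i = (if i \<le> k then xs ! i else v)" for i
  have tI: "t i \<in> I" if "i \<le> k" for i using that xs(1) len by (auto simp: t_def)
  have mono: "mono_on {..Suc k} t"
  proof (rule mono_onI)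
    fix r s assume "r \<in> {..Suc k}" "s \<in> {..Suc k}" "r \<le> s"
    then show "t r \<le> t s"
      using xs(2) len tI[of r] Isub uv by (cases "s \<le> k"; cases "r \<le> k") (auto simp: t_def sorted_iff_nth_mono)
  qed
  obtain i0 where i0: "i0 \<le> k" "t i0 = 0"
    using xs(1) len by (metis I_def in_set_conv_nth insertI1 less_Suc_eq_le t_def)
  have t0: "t 0 = 0" using monotone_onD[OF mono, of 0 i0] i0 tI[of 0] Isub by force
  obtain i1 where i1: "i1 \<le> k" "t i1 = u"
    using xs(1) len by (metis I_def in_set_conv_nth insertI1 insertI2 less_Suc_eq_le t_def)
  have tk: "t k = u" using monotone_onD[OF mono, of i1 k] i1 tI[of k] Isub by force
  have tSk: "t (Suc k) = v" by (simp add: t_def)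
  define D where "D i \<omega> = W (t (Suc i)) \<omega> - W (t i) \<omega>" for i \<omega>
  have ind: "indep_vars (\<lambda>_. borel) D {..<Suc k}"
  proof -
    have "\<forall>n t. 0 \<le> t 0 \<longrightarrow> mono_on {..n} t \<longrightarrow>
        indep_vars (\<lambda>_. borel) (\<lambda>i \<omega>. W (t (Suc i)) \<omega> - W (t i) \<omega>) {..<n::nat}"
      using W by (simp add: brownian_motion_def)
    from this[rule_format, of t "Suc k"] show ?thesis using mono t0 unfolding D_def by simp
  qed
  have iv: "indep_var (PiM {..<k} (\<lambda>_. borel)) (\<lambda>\<omega>. restrict (\<lambda>i. D i \<omega>) {..<k})
     (PiM {k} (\<lambda>_. borel)) (\<lambda>\<omega>. restrict (\<lambda>i. D i \<omega>) {k})"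
    by (rule indep_var_restrict[OF ind]) auto
  define idx where "idx s = (SOME i. i \<le> k \<and> t i = s)" for s
  have idx: "idx s \<le> k \<and> t (idx s) = s" if "s \<in> I" for s
    unfolding idx_def by (rule someI_ex) (metis that xs(1) len in_set_conv_nth less_Suc_eq_le t_def)
  define P where "P = {p\<in>space (PiM {..<k} (\<lambda>_. borel)). \<forall>s\<in>J. (\<Sum>j<idx s. p j) \<in> A s}"
  define Q where "Q = {p\<in>space (PiM {k} (\<lambda>_. borel)). p k \<in> C}"
  have P: "P \<in> sets (PiM {..<k} (\<lambda>_. borel))"
  proof -
    have "{p\<in>space (PiM {..<k} (\<lambda>_. borel :: real measure)). (\<Sum>j<idx s. p j) \<in> A s} \<in> sets (PiM {..<k} (\<lambda>_. borel))"
      if "s \<in> J" for s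
    proof -
      have "(\<lambda>p. \<Sum>j<idx s. p j) \<in> borel_measurable (PiM {..<k} (\<lambda>_. borel :: real measure))"
        using idx[of s] that by (intro borel_measurable_sum measurable_component_singleton) (auto simp: I_def)
      from measurable_sets_Collect[OF this, of "\<lambda>x. x \<in> A s"] show ?thesis
        using A[of s] by simp
    qed
    then show ?thesis unfolding P_def using J(1) by (intro sets.sets_Collect_finite_All) auto
  qed
  have Q: "Q \<in> sets (PiM {k} (\<lambda>_. borel))"
    unfolding Q_def using C by measurable
  have tele: "W (t i) \<omega> - W 0 \<omega> = (\<Sum>j<i. D j \<omega>)" for i \<omega>
    by (induction i) (auto simp: D_def t0)
  \<comment> \<open>The equivalence holds only almost surely: partial sums of increments give
    \<open>W s - W 0\<close>, and \<open>W 0\<close> vanishes almost surely.\<close>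
  have PP: "AE \<omega> in M. (\<forall>s\<in>J. W s \<omega> \<in> A s) \<longleftrightarrow> (\<lambda>i\<in>{..<k}. D i \<omega>) \<in> P"
    using W0
  proof eventually_elim
    case (elim \<omega>)
    have "(\<Sum>j<idx s. (\<lambda>i\<in>{..<k}. D i \<omega>) j) = W s \<omega>" if "s \<in> J" for s
      using tele[of "idx s" \<omega>] idx[of s] that elim by (auto simp: I_def intro!: sum.cong)
    then show ?case by (auto simp: P_def space_PiM)
  qed
  have QQ: "(\<lambda>i\<in>{k}. D i \<omega>) \<in> Q \<longleftrightarrow> W v \<omega> - W u \<omega> \<in> C" for \<omega>
    by (auto simp: Q_def space_PiM D_def tk tSk)
  have JW: "{\<omega>\<in>space M. \<forall>s\<in>J. W s \<omega> \<in> A s} \<in> events"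
  proof (rule sets.sets_Collect_finite_All[OF _ J(1)])
    fix s assume "s \<in> J"
    with J have "W s \<in> borel_measurable M" by (intro Wm) auto
    from measurable_sets_Collect[OF this, of "\<lambda>x. x \<in> A s"] show "{x\<in>space M. W s x \<in> A s} \<in> events"
      using A[of s] by simp
  qed
  have WC: "{\<omega>\<in>space M. W v \<omega> - W u \<omega> \<in> C} \<in> events"
  proof -
    have "(\<lambda>\<omega>. W v \<omega> - W u \<omega>) \<in> borel_measurable M" using Wm uv by (intro borel_measurable_diff) auto
    from measurable_sets_Collect[OF this, of "\<lambda>x. x \<in> C"] show ?thesis using C by simp
  qed
  have Pm: "{\<omega>\<in>space M. (\<lambda>i\<in>{..<k}. D i \<omega>) \<in> P} \<in> events"
    using measurable_sets_Collect[OF indep_var_rv1[OF iv], of "\<lambda>x. x \<in> P"] P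
    by (auto simp: sets.sets_into_space Int_absorb2 Collect_mem_eq Int_def[symmetric] conj_commute)
  have e1: "prob {\<omega>\<in>space M. (\<forall>s\<in>J. W s \<omega> \<in> A s) \<and> W v \<omega> - W u \<omega> \<in> C} =
     prob ((\<lambda>\<omega>. (\<lambda>i\<in>{..<k}. D i \<omega>, \<lambda>i\<in>{k}. D i \<omega>)) -` (P \<times> Q) \<inter> space M)"
    apply (rule finite_measure_eq_AE)
    subgoal using PP by eventually_elim (use QQ in auto)
    subgoal by (rule sets.sets_Collect_conj[OF WC JW])
    subgoal using sets.Int[OF Pm WC] QQ by (simp add: Int_def vimage_def conj_ac)
    done
  have e2: "prob {\<omega>\<in>space M. \<forall>s\<in>J. W s \<omega> \<in> A s} = prob ((\<lambda>\<omega>. \<lambda>i\<in>{..<k}. D i \<omega>) -` P \<inter> space M)"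
    apply (rule finite_measure_eq_AE)
    subgoal using PP by eventually_elim auto
    subgoal using JW .
    subgoal using Pm by (simp add: Int_def vimage_def conj_ac)
    done
  have e3: "{\<omega>\<in>space M. W v \<omega> - W u \<omega> \<in> C} = (\<lambda>\<omega>. \<lambda>i\<in>{k}. D i \<omega>) -` Q \<inter> space M"
    using QQ by auto
  show ?thesis unfolding e1 e2 e3 by (rule indep_varD[OF iv P Q])
qed

lemma (in prob_space) indep_set_prodI:
  assumes "A \<subseteq> events" "B \<subseteq> events" "\<And>a b. a \<in> A \<Longrightarrow> b \<in> B \<Longrightarrow> prob (a \<inter> b) = prob a * prob b"
  shows "indep_set A B"
  using assms unfolding indep_sets2_eq by auto

lemma (in prob_space) indep_set_mono:
  "indep_set A B \<Longrightarrow> A' \<subseteq> A \<Longrightarrow> B' \<subseteq> B \<Longrightarrow> indep_set A' B'"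
  unfolding indep_sets2_eq by blast

section \<open>Independence of the joint past and the planar increments\<close>

locale brownian_pair = prob_space M for M :: "'a measure" +
  fixes W1 W2 :: "real \<Rightarrow> 'a \<Rightarrow> real"
  assumes planar: "brownian_motion_2d M W1 W2"
begin

abbreviation F :: "real \<Rightarrow> 'a measure" where
  "F \<equiv> natural_filtration M (\<lambda>t \<omega>. (W1 t \<omega>, W2 t \<omega>))"

lemma brownian: "brownian_motion M W1" "brownian_motion M W2"
  using planar by (auto simp: brownian_motion_2d_def)

lemma W_measurable: "t \<ge> 0 \<Longrightarrow> W1 t \<in> borel_measurable M" "t \<ge> 0 \<Longrightarrow> W2 t \<in> borel_measurable M"
  using brownian by (auto simp: brownian_motion_def)

lemma cylinder_event:
  assumes "finite J" "J \<subseteq> {0..}" "\<And>s. A s \<in> sets borel" "\<And>s. B s \<in> sets borel"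
  shows "{\<omega>\<in>space M. \<forall>s\<in>J. W1 s \<omega> \<in> A s \<and> W2 s \<omega> \<in> B s} \<in> events"
proof (rule sets.sets_Collect_finite_All[OF _ assms(1)])
  fix s assume "s \<in> J"
  with assms(2) have s: "s \<ge> 0" by auto
  have [measurable]: "W1 s \<in> borel_measurable M" "W2 s \<in> borel_measurable M" "A s \<in> sets borel" "B s \<in> sets borel"
    using assms W_measurable[OF s] by auto
  show "{\<omega>\<in>space M. W1 s \<omega> \<in> A s \<and> W2 s \<omega> \<in> B s} \<in> events" by measurable
qed

lemma increment_event:
  assumes "0 \<le> u" "u \<le> v" "C \<in> sets borel" "D \<in> sets borel"
  shows "{\<omega>\<in>space M. W1 v \<omega> - W1 u \<omega> \<in> C \<and> W2 v \<omega> - W2 u \<omega> \<in> D} \<in> events"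
proof -
  have [measurable]: "W1 u \<in> borel_measurable M" "W2 u \<in> borel_measurable M"
     "W1 v \<in> borel_measurable M" "W2 v \<in> borel_measurable M"  "C \<in> sets borel" "D \<in> sets borel"
    using assms W_measurable[of u] W_measurable[of v] by auto
  show ?thesis by measurable
qed

lemma path_cylinder_sets:
  assumes "finite J" "J \<subseteq> {0..}" "\<And>s. A s \<in> sets borel" "C \<in> sets borel" "0 \<le> u" "0 \<le> v"
  shows "{p\<in>space (PiM {0..} (\<lambda>_. borel :: real measure)). (\<forall>s\<in>J. p s \<in> A s) \<and> p v - p u \<in> C}
    \<in> sets (PiM {0::real..} (\<lambda>_. borel))"
proof (rule sets.sets_Collect_conj)
  have [measurable]: "C \<in> sets borel" "v \<in> {0..}" "u \<in> {0..}" using assms by auto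
  show "{p\<in>space (PiM {0..} (\<lambda>_. borel :: real measure)). p v - p u \<in> C} \<in> sets (PiM {0::real..} (\<lambda>_. borel))"
    by measurable
  show "{p\<in>space (PiM {0..} (\<lambda>_. borel :: real measure)). \<forall>s\<in>J. p s \<in> A s} \<in> sets (PiM {0::real..} (\<lambda>_. borel))"
  proof (rule sets.sets_Collect_finite_All[OF _ assms(1)])
    fix s assume "s \<in> J"
    with assms have [measurable]: "s \<in> {0..}" "A s \<in> sets borel" by auto
    show "{p\<in>space (PiM {0..} (\<lambda>_. borel :: real measure)). p s \<in> A s} \<in> sets (PiM {0::real..} (\<lambda>_. borel))"
      by measurable
  qed
qed

text \<open>The event is the preimage of a rectangle under the pair of whole paths, so independence
  of the two paths factorises it. Taking \<open>J\<close> empty, or \<open>C\<close> and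
  \<open>D\<close> equal to \<open>UNIV\<close>, specialises it to increments alone or to cylinders
  alone.\<close>

lemma prob_paths:
  assumes "finite J" "J \<subseteq> {0..}" "\<And>s. A s \<in> sets borel" "\<And>s. B s \<in> sets borel"
    "C \<in> sets borel" "D \<in> sets borel" "0 \<le> u" "0 \<le> v"
  shows "prob {\<omega>\<in>space M. (\<forall>s\<in>J. W1 s \<omega> \<in> A s \<and> W2 s \<omega> \<in> B s) \<and> W1 v \<omega> - W1 u \<omega> \<in> C \<and> W2 v \<omega> - W2 u \<omega> \<in> D} =
    prob {\<omega>\<in>space M. (\<forall>s\<in>J. W1 s \<omega> \<in> A s) \<and> W1 v \<omega> - W1 u \<omega> \<in> C} *
    prob {\<omega>\<in>space M. (\<forall>s\<in>J. W2 s \<omega> \<in> B s) \<and> W2 v \<omega> - W2 u \<omega> \<in> D}"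
proof -
  let ?P = "{p\<in>space (PiM {0..} (\<lambda>_. borel :: real measure)). (\<forall>s\<in>J. p s \<in> A s) \<and> p v - p u \<in> C}"
  let ?Q = "{p\<in>space (PiM {0..} (\<lambda>_. borel :: real measure)). (\<forall>s\<in>J. p s \<in> B s) \<and> p v - p u \<in> D}"
  have iv: "indep_var (PiM {0..} (\<lambda>_. borel)) (\<lambda>\<omega>. \<lambda>t\<in>{0..}. W1 t \<omega>)
       (PiM {0..} (\<lambda>_. borel)) (\<lambda>\<omega>. \<lambda>t\<in>{0..}. W2 t \<omega>)"
    using planar by (simp add: brownian_motion_2d_def)
  have P: "(\<lambda>\<omega>. \<lambda>t\<in>{0..}. W1 t \<omega>) -` ?P \<inter> space M = {\<omega>\<in>space M. (\<forall>s\<in>J. W1 s \<omega> \<in> A s) \<and> W1 v \<omega> - W1 u \<omega> \<in> C}"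
    using assms by (force simp: space_PiM)
  have Q: "(\<lambda>\<omega>. \<lambda>t\<in>{0..}. W2 t \<omega>) -` ?Q \<inter> space M = {\<omega>\<in>space M. (\<forall>s\<in>J. W2 s \<omega> \<in> B s) \<and> W2 v \<omega> - W2 u \<omega> \<in> D}"
    using assms by (force simp: space_PiM)
  have PQ: "(\<lambda>\<omega>. (\<lambda>t\<in>{0..}. W1 t \<omega>, \<lambda>t\<in>{0..}. W2 t \<omega>)) -` (?P \<times> ?Q) \<inter> space M =
     {\<omega>\<in>space M. (\<forall>s\<in>J. W1 s \<omega> \<in> A s \<and> W2 s \<omega> \<in> B s) \<and> W1 v \<omega> - W1 u \<omega> \<in> C \<and> W2 v \<omega> - W2 u \<omega> \<in> D}"
  proof -
    have gen: "(\<lambda>\<omega>. (f \<omega>, g \<omega>)) -` (S \<times> S') \<inter> space M = (f -` S \<inter> space M) \<inter> (g -` S' \<inter> space M)"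
      for f g :: "'a \<Rightarrow> real \<Rightarrow> real" and S S' by auto
    show ?thesis unfolding gen P Q by blast
  qed
  have S: "?P \<in> sets (PiM {0..} (\<lambda>_. borel))" "?Q \<in> sets (PiM {0..} (\<lambda>_. borel))"
    by (rule path_cylinder_sets; fact)+
  show ?thesis using indep_varD[OF iv S] unfolding P Q PQ .
qed

text \<open>Factor over the two motions, then separate past and increment within each motion.
  Regrouping the four factors by time instead of by component gives the product.\<close>

lemma indep_cylinder_increment:
  assumes uv: "0 \<le> u" "u \<le> v" and J: "finite J" "J \<subseteq> {0..u}"
    and AB: "\<And>s. A s \<in> sets borel" "\<And>s. B s \<in> sets borel" and CD: "C \<in> sets borel" "D \<in> sets borel"
  shows "prob ({\<omega>\<in>space M. \<forall>s\<in>J. W1 s \<omega> \<in> A s \<and> W2 s \<omega> \<in> B s} \<inter>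
      {\<omega>\<in>space M. W1 v \<omega> - W1 u \<omega> \<in> C \<and> W2 v \<omega> - W2 u \<omega> \<in> D}) =
    prob {\<omega>\<in>space M. \<forall>s\<in>J. W1 s \<omega> \<in> A s \<and> W2 s \<omega> \<in> B s} *
    prob {\<omega>\<in>space M. W1 v \<omega> - W1 u \<omega> \<in> C \<and> W2 v \<omega> - W2 u \<omega> \<in> D}"
proof -
  have J0: "J \<subseteq> {0..}" and v: "0 \<le> v" using J uv by auto
  note pp = prob_paths[OF J(1) J0 AB, OF _ _ uv(1) v]
  have inc: "prob {\<omega>\<in>space M. W1 v \<omega> - W1 u \<omega> \<in> C \<and> W2 v \<omega> - W2 u \<omega> \<in> D} =
     prob {\<omega>\<in>space M. W1 v \<omega> - W1 u \<omega> \<in> C} * prob {\<omega>\<in>space M. W2 v \<omega> - W2 u \<omega> \<in> D}"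
    using prob_paths[of "{}" A B C D u v] AB CD uv v by simp
  have cyl: "prob {\<omega>\<in>space M. \<forall>s\<in>J. W1 s \<omega> \<in> A s \<and> W2 s \<omega> \<in> B s} =
     prob {\<omega>\<in>space M. \<forall>s\<in>J. W1 s \<omega> \<in> A s} * prob {\<omega>\<in>space M. \<forall>s\<in>J. W2 s \<omega> \<in> B s}"
    using pp[of UNIV UNIV] by simp
  have "prob ({\<omega>\<in>space M. \<forall>s\<in>J. W1 s \<omega> \<in> A s \<and> W2 s \<omega> \<in> B s} \<inter>
      {\<omega>\<in>space M. W1 v \<omega> - W1 u \<omega> \<in> C \<and> W2 v \<omega> - W2 u \<omega> \<in> D}) =
      prob {\<omega>\<in>space M. (\<forall>s\<in>J. W1 s \<omega> \<in> A s \<and> W2 s \<omega> \<in> B s) \<and> W1 v \<omega> - W1 u \<omega> \<in> C \<and> W2 v \<omega> - W2 u \<omega> \<in> D}"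
    by (rule arg_cong[where f=prob]) auto
  then show ?thesis
    using pp[OF CD] brownian_path_indep_increment[OF brownian(1) uv J AB(1) CD(1)]
      brownian_path_indep_increment[OF brownian(2) uv J AB(2) CD(2)] inc cyl by simp
qed

lemma space_F [simp]: "space (F u) = space M"
  by (simp add: natural_filtration_def space_measure_of_conv)

lemma sets_F: "sets (F u) = sigma_sets (space M)
    {(\<lambda>\<omega>. (W1 s \<omega>, W2 s \<omega>)) -` A \<inter> space M | s A. s \<in> {0..u} \<and> A \<in> sets borel}"
  unfolding natural_filtration_def by (rule sets_measure_of) auto

lemma W_adapted:
  assumes "s \<in> {0..u}"
  shows "W1 s \<in> borel_measurable (F u)" "W2 s \<in> borel_measurable (F u)"
proof -
  have "(\<lambda>\<omega>. (W1 s \<omega>, W2 s \<omega>)) \<in> measurable (F u) borel"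
    by (rule measurableI) (use assms in \<open>auto simp: sets_F intro!: sigma_sets.Basic\<close>)
  then have *: "(\<lambda>\<omega>. (W1 s \<omega>, W2 s \<omega>)) \<in> measurable (F u) (borel \<Otimes>\<^sub>M borel)" by (simp add: borel_prod)
  show "W1 s \<in> borel_measurable (F u)" "W2 s \<in> borel_measurable (F u)"
    using measurable_compose[OF * measurable_fst] measurable_compose[OF * measurable_snd] by simp_all
qed

lemma F_mono: "u \<le> v \<Longrightarrow> sets (F u) \<subseteq> sets (F v)"
  unfolding sets_F by (intro sigma_sets_mono') force

lemma sets_F_le: "sets (F u) \<subseteq> events"
proof -
  have "(\<lambda>\<omega>. (W1 s \<omega>, W2 s \<omega>)) \<in> measurable M (borel \<Otimes>\<^sub>M borel)" if "s \<in> {0..u}" for s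
    using W_measurable[of s] that by (intro measurable_Pair) auto
  then show ?thesis unfolding sets_F borel_prod
    by (intro sets.sigma_sets_subset) (auto intro: measurable_sets)
qed

lemma increment_pair_measurable:
  assumes "0 \<le> u" "u \<le> v"
  shows "(\<lambda>\<omega>. (W1 v \<omega> - W1 u \<omega>, W2 v \<omega> - W2 u \<omega>)) \<in> measurable M (borel \<Otimes>\<^sub>M borel)"
  using assms W_measurable[of u] W_measurable[of v] by (intro measurable_Pair borel_measurable_diff) auto

lemma measurable_F_M: "U \<in> measurable (F u) N \<Longrightarrow> U \<in> measurable M N"
  using measurable_mono[of N N "F u" M] sets_F_le[of u] by auto

text \<open>Cylinders over finitely many times generate the past, rectangles generate the
  \<sigma>-algebra of the increment, and both families are closed under intersection. Independence
  on these generators therefore extends.\<close>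

lemma indep_set_past_increment:
  assumes uv: "0 \<le> u" "u \<le> v"
  shows "indep_set (sets (F u)) (sigma_sets (space M)
    {(\<lambda>\<omega>. (W1 v \<omega> - W1 u \<omega>, W2 v \<omega> - W2 u \<omega>)) -` A \<inter> space M | A. A \<in> sets (borel \<Otimes>\<^sub>M borel)})"
proof -
  let ?V = "\<lambda>\<omega>. (W1 v \<omega> - W1 u \<omega>, W2 v \<omega> - W2 u \<omega>)"
  define G where "G = {{\<omega>\<in>space M. \<forall>s\<in>J. W1 s \<omega> \<in> A s \<and> W2 s \<omega> \<in> B s} | J A B.
    finite J \<and> J \<subseteq> {0..u} \<and> (\<forall>s. A s \<in> sets borel) \<and> (\<forall>s. B s \<in> sets borel)}"
  define H where "H = {{\<omega>\<in>space M. W1 v \<omega> - W1 u \<omega> \<in> C \<and> W2 v \<omega> - W2 u \<omega> \<in> D} | C D.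
    C \<in> sets borel \<and> D \<in> sets borel}"
  have ind: "indep_set (sigma_sets (space M) G) (sigma_sets (space M) H)"
  proof (rule indep_set_sigma_sets)
    show "indep_set G H"
    proof (rule indep_set_prodI)
      show "G \<subseteq> events" unfolding G_def using cylinder_event by (auto simp: subset_eq)
      show "H \<subseteq> events" unfolding H_def using increment_event uv by auto
      show "prob (a \<inter> b) = prob a * prob b" if "a \<in> G" "b \<in> H" for a b
        using that indep_cylinder_increment[OF uv] unfolding G_def H_def by blast
    qed
    show "Int_stable G"
    proof (rule Int_stableI)
      fix a b assume "a \<in> G" "b \<in> G"
      then obtain J A B J' A' B' where *:
        "a = {\<omega>\<in>space M. \<forall>s\<in>J. W1 s \<omega> \<in> A s \<and> W2 s \<omega> \<in> B s}"
        "finite J" "J \<subseteq> {0..u}" "\<And>s. A s \<in> sets borel" "\<And>s. B s \<in> sets borel"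
        "b = {\<omega>\<in>space M. \<forall>s\<in>J'. W1 s \<omega> \<in> A' s \<and> W2 s \<omega> \<in> B' s}"
        "finite J'" "J' \<subseteq> {0..u}" "\<And>s. A' s \<in> sets borel" "\<And>s. B' s \<in> sets borel"
        unfolding G_def by blast
      \<comment> \<open>Each cylinder constrains only the times in its own index set, so its sets
        are replaced by \<open>UNIV\<close> elsewhere before intersecting over the union of the
        index sets.\<close>
      let ?A = "\<lambda>s. (if s \<in> J then A s else UNIV) \<inter> (if s \<in> J' then A' s else UNIV)"
      let ?B = "\<lambda>s. (if s \<in> J then B s else UNIV) \<inter> (if s \<in> J' then B' s else UNIV)"
      have "a \<inter> b = {\<omega>\<in>space M. \<forall>s\<in>J \<union> J'. W1 s \<omega> \<in> ?A s \<and> W2 s \<omega> \<in> ?B s}"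
        unfolding * by auto
      moreover have "finite (J \<union> J')" "J \<union> J' \<subseteq> {0..u}" "\<forall>s. ?A s \<in> sets borel" "\<forall>s. ?B s \<in> sets borel"
        using * by auto
      ultimately show "a \<inter> b \<in> G" unfolding G_def
        by (intro CollectI exI[of _ "J \<union> J'"] exI[of _ ?A] exI[of _ ?B] conjI)
    qed
    show "Int_stable H"
    proof (rule Int_stableI)
      fix a b assume "a \<in> H" "b \<in> H"
      then obtain C D C' D' where *:
        "a = {\<omega>\<in>space M. W1 v \<omega> - W1 u \<omega> \<in> C \<and> W2 v \<omega> - W2 u \<omega> \<in> D}" "C \<in> sets borel" "D \<in> sets borel"
        "b = {\<omega>\<in>space M. W1 v \<omega> - W1 u \<omega> \<in> C' \<and> W2 v \<omega> - W2 u \<omega> \<in> D'}" "C' \<in> sets borel" "D' \<in> sets borel"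
        unfolding H_def by blast
      have "a \<inter> b = {\<omega>\<in>space M. W1 v \<omega> - W1 u \<omega> \<in> C \<inter> C' \<and> W2 v \<omega> - W2 u \<omega> \<in> D \<inter> D'}"
        unfolding * by auto
      moreover have "C \<inter> C' \<in> sets borel" "D \<inter> D' \<in> sets borel" using * by auto
      ultimately show "a \<inter> b \<in> H" unfolding H_def
        by (intro CollectI exI[of _ "C \<inter> C'"] exI[of _ "D \<inter> D'"] conjI)
    qed
  qed
  have Gsub: "G \<subseteq> Pow (space M)" and Hsub: "H \<subseteq> Pow (space M)" by (auto simp: G_def H_def)
  have FG: "sets (F u) \<subseteq> sigma_sets (space M) G"
  proof -
    have "(\<lambda>\<omega>. (W1 s \<omega>, W2 s \<omega>)) \<in> measurable (sigma (space M) G) borel" if s: "s \<in> {0..u}" for s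
    proof -
      have "W1 s \<in> borel_measurable (sigma (space M) G)"
      proof (rule measurableI)
        fix A :: "real set" assume A: "A \<in> sets borel"
        have "W1 s -` A \<inter> space M = {\<omega>\<in>space M. \<forall>s\<in>{s}. W1 s \<omega> \<in> (\<lambda>_. A) s \<and> W2 s \<omega> \<in> (\<lambda>_. UNIV) s}" by auto
        also have "\<dots> \<in> G" unfolding G_def using s A
          by (intro CollectI exI[of _ "{s}"] exI[of _ "\<lambda>_. A"] exI[of _ "\<lambda>_. UNIV"]) simp
        finally show "W1 s -` A \<inter> space (sigma (space M) G) \<in> sets (sigma (space M) G)"
          using Gsub by (auto simp: space_measure_of_conv)
      qed simp
      moreover have "W2 s \<in> borel_measurable (sigma (space M) G)"
      proof (rule measurableI)
        fix A :: "real set" assume A: "A \<in> sets borel"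
        have "W2 s -` A \<inter> space M = {\<omega>\<in>space M. \<forall>s\<in>{s}. W1 s \<omega> \<in> (\<lambda>_. UNIV) s \<and> W2 s \<omega> \<in> (\<lambda>_. A) s}" by auto
        also have "\<dots> \<in> G" unfolding G_def using s A
          by (intro CollectI exI[of _ "{s}"] exI[of _ "\<lambda>_. A"] exI[of _ "\<lambda>_. UNIV"]) simp
        finally show "W2 s -` A \<inter> space (sigma (space M) G) \<in> sets (sigma (space M) G)"
          using Gsub by (auto simp: space_measure_of_conv)
      qed simp
      ultimately show ?thesis unfolding borel_prod[symmetric] by (rule measurable_Pair)
    qed
    from measurable_sets[OF this] show ?thesis unfolding sets_F
      using Gsub by (intro sigma_algebra.sigma_sets_subset[OF sigma_algebra_sigma_sets]) (auto simp: space_measure_of_conv)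
  qed
  have VH: "?V \<in> measurable (sigma (space M) H) (borel \<Otimes>\<^sub>M borel)"
  proof (rule measurable_Pair)
    show "(\<lambda>\<omega>. W1 v \<omega> - W1 u \<omega>) \<in> borel_measurable (sigma (space M) H)"
    proof (rule measurableI)
      fix A :: "real set" assume A: "A \<in> sets borel"
      have "(\<lambda>\<omega>. W1 v \<omega> - W1 u \<omega>) -` A \<inter> space M = {\<omega>\<in>space M. W1 v \<omega> - W1 u \<omega> \<in> A \<and> W2 v \<omega> - W2 u \<omega> \<in> UNIV}" by auto
      also have "\<dots> \<in> H" unfolding H_def using A by (intro CollectI exI[of _ A] exI[of _ UNIV]) simp
      finally show "(\<lambda>\<omega>. W1 v \<omega> - W1 u \<omega>) -` A \<inter> space (sigma (space M) H) \<in> sets (sigma (space M) H)"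
        using Hsub by (auto simp: space_measure_of_conv)
    qed simp
    show "(\<lambda>\<omega>. W2 v \<omega> - W2 u \<omega>) \<in> borel_measurable (sigma (space M) H)"
    proof (rule measurableI)
      fix A :: "real set" assume A: "A \<in> sets borel"
      have "(\<lambda>\<omega>. W2 v \<omega> - W2 u \<omega>) -` A \<inter> space M = {\<omega>\<in>space M. W1 v \<omega> - W1 u \<omega> \<in> UNIV \<and> W2 v \<omega> - W2 u \<omega> \<in> A}" by auto
      also have "\<dots> \<in> H" unfolding H_def using A by (intro CollectI exI[of _ UNIV] exI[of _ A]) simp
      finally show "(\<lambda>\<omega>. W2 v \<omega> - W2 u \<omega>) -` A \<inter> space (sigma (space M) H) \<in> sets (sigma (space M) H)"
        using Hsub by (auto simp: space_measure_of_conv)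
    qed simp
  qed
  have "sigma_sets (space M) {?V -` A \<inter> space M | A. A \<in> sets (borel \<Otimes>\<^sub>M borel)} \<subseteq> sigma_sets (space M) H"
    using measurable_sets[OF VH] Hsub by (intro sigma_algebra.sigma_sets_subset[OF sigma_algebra_sigma_sets]) (auto simp: space_measure_of_conv)
  then show ?thesis using ind FG unfolding indep_sets2_eq by blast
qed

text \<open>The map \<open>h\<close> makes one statement serve for either component of the increment
  and for the product of both components; the product is what the variance computation
  needs.\<close>

lemma indep_past_increment:
  fixes U :: "'a \<Rightarrow> 'b" and h :: "real \<times> real \<Rightarrow> 'b"
  assumes uv: "0 \<le> u" "u \<le> v" and U: "U \<in> measurable (F u) N" and h: "h \<in> measurable (borel \<Otimes>\<^sub>M borel) N'"
  shows "indep_var N U N' (\<lambda>\<omega>. h (W1 v \<omega> - W1 u \<omega>, W2 v \<omega> - W2 u \<omega>))"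
proof -
  let ?V = "\<lambda>\<omega>. (W1 v \<omega> - W1 u \<omega>, W2 v \<omega> - W2 u \<omega>)"
  have 1: "sigma_sets (space M) {U -` A \<inter> space M | A. A \<in> sets N} \<subseteq> sets (F u)"
  proof -
    have "U -` A \<inter> space M \<in> sets (F u)" if "A \<in> sets N" for A using measurable_sets[OF U that] by simp
    then have "{U -` A \<inter> space M | A. A \<in> sets N} \<subseteq> sets (F u)" by (intro subsetI) (elim CollectE exE conjE, simp)
    from sets.sigma_sets_subset[OF this] show ?thesis by simp
  qed
  have 2: "sigma_sets (space M) {(\<lambda>\<omega>. h (?V \<omega>)) -` A \<inter> space M | A. A \<in> sets N'} \<subseteq>
    sigma_sets (space M) {?V -` A \<inter> space M | A. A \<in> sets (borel \<Otimes>\<^sub>M borel)}"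
  proof (rule sigma_sets_mono, safe)
    fix A assume A: "A \<in> sets N'"
    have "(\<lambda>\<omega>. h (?V \<omega>)) -` A \<inter> space M = ?V -` (h -` A \<inter> space (borel \<Otimes>\<^sub>M borel)) \<inter> space M"
      by (rule set_eqI) (simp add: space_pair_measure)
    then show "(\<lambda>\<omega>. h (?V \<omega>)) -` A \<inter> space M \<in> sigma_sets (space M) {?V -` A \<inter> space M | A. A \<in> sets (borel \<Otimes>\<^sub>M borel)}"
      using measurable_sets[OF h A]
      by (intro sigma_sets.Basic CollectI exI[of _ "h -` A \<inter> space (borel \<Otimes>\<^sub>M borel)"] conjI)
  qed
  show ?thesis
    unfolding indep_var_eq
  proof (intro conjI)
    show "U \<in> measurable M N" using U by (rule measurable_F_M)
    show "(\<lambda>\<omega>. h (?V \<omega>)) \<in> measurable M N'" by (rule measurable_compose[OF increment_pair_measurable[OF uv] h])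
    show "indep_set (sigma_sets (space M) {U -` A \<inter> space M | A. A \<in> sets N})
      (sigma_sets (space M) {(\<lambda>\<omega>. h (?V \<omega>)) -` A \<inter> space M | A. A \<in> sets N'})"
      by (rule indep_set_mono[OF indep_set_past_increment[OF uv] 1 2])
  qed
qed

text \<open>\<open>indep_var\<close> compares variables with one common value type, whereas here the
  state \<open>U\<close> may be a triple and the increment is a pair. The product form of the joint
  law is therefore checked on measurable rectangles, from the independence of the
  \<sigma>-algebras.\<close>

lemma distr_past_increment:
  assumes uv: "0 \<le> u" "u \<le> v" and U: "U \<in> measurable (F u) N"
  shows "distr M (N \<Otimes>\<^sub>M (borel \<Otimes>\<^sub>M borel)) (\<lambda>\<omega>. (U \<omega>, (W1 v \<omega> - W1 u \<omega>, W2 v \<omega> - W2 u \<omega>))) =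
    distr M N U \<Otimes>\<^sub>M distr M (borel \<Otimes>\<^sub>M borel) (\<lambda>\<omega>. (W1 v \<omega> - W1 u \<omega>, W2 v \<omega> - W2 u \<omega>))"
proof (rule pair_measure_eqI[symmetric])
  let ?V = "\<lambda>\<omega>. (W1 v \<omega> - W1 u \<omega>, W2 v \<omega> - W2 u \<omega>)"
  note Um = measurable_F_M[OF U] and Vm = increment_pair_measurable[OF uv]
  show "sigma_finite_measure (distr M N U)" "sigma_finite_measure (distr M (borel \<Otimes>\<^sub>M borel) ?V)"
    using prob_space_distr[OF Um] prob_space_distr[OF Vm] by (auto intro: prob_space_imp_sigma_finite)
  fix A B assume A: "A \<in> sets (distr M N U)" and B: "B \<in> sets (distr M (borel \<Otimes>\<^sub>M borel) ?V)"
  have A': "A \<in> sets N" and B': "B \<in> sets (borel \<Otimes>\<^sub>M borel)" using A B by auto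
  have AF: "U -` A \<inter> space M \<in> sets (F u)" using measurable_sets[OF U A'] by simp
  have BV: "?V -` B \<inter> space M \<in> sigma_sets (space M) {?V -` A \<inter> space M | A. A \<in> sets (borel \<Otimes>\<^sub>M borel)}"
    using B' by (intro sigma_sets.Basic CollectI exI[of _ B] conjI refl)
  have "emeasure (distr M (N \<Otimes>\<^sub>M (borel \<Otimes>\<^sub>M borel)) (\<lambda>\<omega>. (U \<omega>, ?V \<omega>))) (A \<times> B) =
    emeasure M ((U -` A \<inter> space M) \<inter> (?V -` B \<inter> space M))"
  proof (subst emeasure_distr)
    show "(\<lambda>\<omega>. (U \<omega>, ?V \<omega>)) \<in> M \<rightarrow>\<^sub>M N \<Otimes>\<^sub>M borel \<Otimes>\<^sub>M borel" using Um Vm by (rule measurable_Pair)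
    show "A \<times> B \<in> sets (N \<Otimes>\<^sub>M borel \<Otimes>\<^sub>M borel)" using A' B' by (rule pair_measureI)
    show "emeasure M ((\<lambda>\<omega>. (U \<omega>, ?V \<omega>)) -` (A \<times> B) \<inter> space M) = emeasure M ((U -` A \<inter> space M) \<inter> (?V -` B \<inter> space M))"
      by (rule arg_cong[where f="emeasure M"]) auto
  qed
  also have "\<dots> = ennreal (prob (U -` A \<inter> space M) * prob (?V -` B \<inter> space M))"
    unfolding emeasure_eq_measure using indep_set_past_increment[OF uv] AF BV unfolding indep_sets2_eq by simp
  also have "\<dots> = emeasure (distr M N U) A * emeasure (distr M (borel \<Otimes>\<^sub>M borel) ?V) B"
    using Um Vm A' B' by (simp add: emeasure_distr emeasure_eq_measure ennreal_mult measure_nonneg)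
  finally show "emeasure (distr M N U) A * emeasure (distr M (borel \<Otimes>\<^sub>M borel) ?V) B =
    emeasure (distr M (N \<Otimes>\<^sub>M (borel \<Otimes>\<^sub>M borel)) (\<lambda>\<omega>. (U \<omega>, ?V \<omega>))) (A \<times> B)" by simp
qed simp

lemma indep_increments_cross:
  assumes uv: "0 \<le> u" "u \<le> v"
  shows "indep_var borel (\<lambda>\<omega>. W1 v \<omega> - W1 u \<omega>) borel (\<lambda>\<omega>. W2 v \<omega> - W2 u \<omega>)"
proof -
  have iv: "indep_var (PiM {0..} (\<lambda>_. borel)) (\<lambda>\<omega>. \<lambda>t\<in>{0..}. W1 t \<omega>)
       (PiM {0..} (\<lambda>_. borel)) (\<lambda>\<omega>. \<lambda>t\<in>{0..}. W2 t \<omega>)"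
    using planar by (simp add: brownian_motion_2d_def)
  have [measurable]: "(\<lambda>p. p v - p u) \<in> borel_measurable (PiM {0..} (\<lambda>_. borel :: real measure))"
    using uv by (intro borel_measurable_diff measurable_component_singleton) auto
  from indep_var_compose[OF iv this this] show ?thesis using uv by (simp add: o_def)
qed

end

section \<open>The Ito isometry\<close>

definition square_integrable :: "'a measure \<Rightarrow> 'a measure \<Rightarrow> ('a \<Rightarrow> real) \<Rightarrow> bool" where
  "square_integrable M G f \<longleftrightarrow> f \<in> borel_measurable G \<and> integrable M (\<lambda>\<omega>. (f \<omega>)\<^sup>2)"

lemma integrable_mult_of_squares:
  fixes f g :: "'a \<Rightarrow> real"
  assumes "f \<in> borel_measurable M" "g \<in> borel_measurable M"
    "integrable M (\<lambda>\<omega>. (f \<omega>)\<^sup>2)" "integrable M (\<lambda>\<omega>. (g \<omega>)\<^sup>2)"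
  shows "integrable M (\<lambda>\<omega>. f \<omega> * g \<omega>)"
proof (rule Bochner_Integration.integrable_bound)
  show "integrable M (\<lambda>\<omega>. (f \<omega>)\<^sup>2 + (g \<omega>)\<^sup>2)" using assms by auto
  have "\<bar>a * b\<bar> \<le> a\<^sup>2 + b\<^sup>2" for a b :: real
    using sum_squares_bound[of "\<bar>a\<bar>" "\<bar>b\<bar>"] mult_nonneg_nonneg[of "\<bar>a\<bar>" "\<bar>b\<bar>"]
    unfolding abs_mult by (simp only: power2_abs) linarith
  then show "AE \<omega> in M. norm (f \<omega> * g \<omega>) \<le> norm ((f \<omega>)\<^sup>2 + (g \<omega>)\<^sup>2)" by auto
qed (use assms in auto)

text \<open>A crude replacement for the triangle inequality in mean square. Working in
  \<open>ennreal\<close> it asks for no integrability, and the factor 2 is harmless wherever the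
  errors tend to zero.\<close>

lemma nn_integral_square_add_le:
  fixes f g :: "'a \<Rightarrow> real"
  assumes [measurable]: "f \<in> borel_measurable M" "g \<in> borel_measurable M"
  shows "(\<integral>\<^sup>+x. ennreal ((f x + g x)\<^sup>2) \<partial>M)
    \<le> 2 * (\<integral>\<^sup>+x. ennreal ((f x)\<^sup>2) \<partial>M) + 2 * (\<integral>\<^sup>+x. ennreal ((g x)\<^sup>2) \<partial>M)"
proof -
  have "(\<integral>\<^sup>+x. ennreal ((f x + g x)\<^sup>2) \<partial>M) \<le> (\<integral>\<^sup>+x. 2 * ennreal ((f x)\<^sup>2) + 2 * ennreal ((g x)\<^sup>2) \<partial>M)"
  proof (rule nn_integral_mono)
    fix x
    have "(f x + g x)\<^sup>2 \<le> 2 * (f x)\<^sup>2 + 2 * (g x)\<^sup>2"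
      using sum_squares_bound[of "f x" "g x"] by (simp add: power2_sum)
    then have "ennreal ((f x + g x)\<^sup>2) \<le> ennreal (2 * (f x)\<^sup>2 + 2 * (g x)\<^sup>2)" by (rule ennreal_leI)
    then show "ennreal ((f x + g x)\<^sup>2) \<le> 2 * ennreal ((f x)\<^sup>2) + 2 * ennreal ((g x)\<^sup>2)"
      by (simp add: ennreal_mult)
  qed
  also have "\<dots> = 2 * (\<integral>\<^sup>+x. ennreal ((f x)\<^sup>2) \<partial>M) + 2 * (\<integral>\<^sup>+x. ennreal ((g x)\<^sup>2) \<partial>M)"
    by (simp add: nn_integral_add nn_integral_cmult)
  finally show ?thesis .
qed

text \<open>The properties of a Brownian motion relative to a filtration on which the isometry
  rests. The filtration is a parameter because the integrand for one motion is the other motion, so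
  both have to be treated relative to their joint filtration.\<close>

locale filtered_brownian = prob_space M for M :: "'a measure" +
  fixes G :: "real \<Rightarrow> 'a measure" and W :: "real \<Rightarrow> 'a \<Rightarrow> real"
  assumes G_space: "space (G u) = space M"
    and G_sets_le: "sets (G u) \<subseteq> events"
    and G_sets_mono: "u \<le> v \<Longrightarrow> sets (G u) \<subseteq> sets (G v)"
    and adapted: "0 \<le> u \<Longrightarrow> W u \<in> borel_measurable (G u)"
    and indep_increment: "0 \<le> u \<Longrightarrow> u \<le> v \<Longrightarrow> U \<in> borel_measurable (G u) \<Longrightarrow>
      indep_var borel U borel (\<lambda>\<omega>. W v \<omega> - W u \<omega>)"
    and integrable_increment: "0 \<le> u \<Longrightarrow> u \<le> v \<Longrightarrow> integrable M (\<lambda>\<omega>. W v \<omega> - W u \<omega>)"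
    and integrable_increment_square: "0 \<le> u \<Longrightarrow> u \<le> v \<Longrightarrow> integrable M (\<lambda>\<omega>. (W v \<omega> - W u \<omega>)\<^sup>2)"
    and increment_mean: "0 \<le> u \<Longrightarrow> u \<le> v \<Longrightarrow> expectation (\<lambda>\<omega>. W v \<omega> - W u \<omega>) = 0"
    and increment_variance: "0 \<le> u \<Longrightarrow> u \<le> v \<Longrightarrow> expectation (\<lambda>\<omega>. (W v \<omega> - W u \<omega>)\<^sup>2) = v - u"
begin

abbreviation L2 :: "real \<Rightarrow> ('a \<Rightarrow> real) \<Rightarrow> bool" where
  "L2 u \<equiv> square_integrable M (G u)"

lemma measurable_G_mono: "u \<le> v \<Longrightarrow> f \<in> borel_measurable (G u) \<Longrightarrow> f \<in> borel_measurable (G v)"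
  using measurable_mono[of borel borel "G u" "G v"] G_sets_mono[of u v] by (auto simp: G_space)

lemma measurable_G_M: "f \<in> borel_measurable (G u) \<Longrightarrow> f \<in> borel_measurable M"
  using measurable_mono[of borel borel "G u" M] G_sets_le[of u] by (auto simp: G_space)

lemma increment_measurable: "0 \<le> u \<Longrightarrow> u \<le> v \<Longrightarrow> (\<lambda>\<omega>. W v \<omega> - W u \<omega>) \<in> borel_measurable (G v)"
  using adapted[of v] measurable_G_mono[OF _ adapted, of u v] by (intro borel_measurable_diff) auto

lemma L2_M: "L2 u f \<Longrightarrow> f \<in> borel_measurable M" "L2 u f \<Longrightarrow> integrable M (\<lambda>\<omega>. (f \<omega>)\<^sup>2)"
  by (auto simp: square_integrable_def measurable_G_M)

lemma L2_mono: "u \<le> v \<Longrightarrow> L2 u f \<Longrightarrow> L2 v f"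
  using measurable_G_mono by (auto simp: square_integrable_def)

lemma L2_integrable_mult: "L2 u f \<Longrightarrow> L2 v g \<Longrightarrow> integrable M (\<lambda>\<omega>. f \<omega> * g \<omega>)"
  by (intro integrable_mult_of_squares L2_M)

lemma integrable_times_increment:
  assumes "0 \<le> u" "u \<le> v" "\<xi> \<in> borel_measurable (G u)" "integrable M \<xi>"
  shows "integrable M (\<lambda>\<omega>. \<xi> \<omega> * (W v \<omega> - W u \<omega>))"
    and "expectation (\<lambda>\<omega>. \<xi> \<omega> * (W v \<omega> - W u \<omega>)) = 0"
  using indep_var_integrable[OF indep_increment[OF assms(1-3)] assms(4) integrable_increment[OF assms(1,2)]]
    indep_var_lebesgue_integral[OF indep_increment[OF assms(1-3)] assms(4) integrable_increment[OF assms(1,2)]]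
    increment_mean[OF assms(1,2)] by auto

lemma integrable_times_increment_square:
  assumes "0 \<le> u" "u \<le> v" "\<xi> \<in> borel_measurable (G u)" "integrable M \<xi>"
  shows "integrable M (\<lambda>\<omega>. \<xi> \<omega> * (W v \<omega> - W u \<omega>)\<^sup>2)"
    and "expectation (\<lambda>\<omega>. \<xi> \<omega> * (W v \<omega> - W u \<omega>)\<^sup>2) = expectation \<xi> * (v - u)"
proof -
  have "indep_var borel ((\<lambda>x. x) \<circ> \<xi>) borel ((\<lambda>x. x\<^sup>2) \<circ> (\<lambda>\<omega>. W v \<omega> - W u \<omega>))"
    by (rule indep_var_compose[OF indep_increment[OF assms(1-3)]]) auto
  then have iv: "indep_var borel \<xi> borel (\<lambda>\<omega>. (W v \<omega> - W u \<omega>)\<^sup>2)" by (simp add: o_def)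
  show "integrable M (\<lambda>\<omega>. \<xi> \<omega> * (W v \<omega> - W u \<omega>)\<^sup>2)"
    and "expectation (\<lambda>\<omega>. \<xi> \<omega> * (W v \<omega> - W u \<omega>)\<^sup>2) = expectation \<xi> * (v - u)"
    using indep_var_integrable[OF iv assms(4) integrable_increment_square[OF assms(1,2)]]
    indep_var_lebesgue_integral[OF iv assms(4) integrable_increment_square[OF assms(1,2)]]
    increment_variance[OF assms(1,2)] by auto
qed

lemma L2_times_increment:
  assumes "0 \<le> u" "u \<le> v" "L2 u \<xi>"
  shows "L2 v (\<lambda>\<omega>. \<xi> \<omega> * (W v \<omega> - W u \<omega>))"
proof -
  have sq: "(\<lambda>\<omega>. (\<xi> \<omega>)\<^sup>2) \<in> borel_measurable (G u)" "integrable M (\<lambda>\<omega>. (\<xi> \<omega>)\<^sup>2)"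
    and \<xi>: "\<xi> \<in> borel_measurable (G v)"
    using assms(3) measurable_G_mono[OF assms(2)] by (auto simp: square_integrable_def)
  have "(\<lambda>\<omega>. \<xi> \<omega> * (W v \<omega> - W u \<omega>)) \<in> borel_measurable (G v)"
    by (rule borel_measurable_times[OF \<xi> increment_measurable[OF assms(1,2)]])
  then show ?thesis using integrable_times_increment_square(1)[OF assms(1,2) sq]
    by (simp add: square_integrable_def power_mult_distrib)
qed

text \<open>The length of the intersection of the intervals from \<open>s\<close> to
  \<open>t\<close> and from \<open>u\<close> to \<open>v\<close>; the maximum with 0 covers disjoint
  intervals.\<close>

definition overlap :: "real \<Rightarrow> real \<Rightarrow> real \<Rightarrow> real \<Rightarrow> real" where
  "overlap s t u v = max 0 (min t v - max s u)"

text \<open>The increment over the first interval is cut at \<open>u\<close>. What precedes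
  \<open>u\<close> is known when the second increment starts and contributes nothing; what follows
  contributes the square of the increment over the common part. Treating an arbitrary pair of
  intervals avoids common refinements of grids later.\<close>

lemma elementary_isometry_ordered:
  assumes s: "0 \<le> s" "s \<le> t" and u: "s \<le> u" "u \<le> v" and \<xi>: "L2 s \<xi>" and \<eta>: "L2 u \<eta>"
  shows "expectation (\<lambda>\<omega>. (\<xi> \<omega> * (W t \<omega> - W s \<omega>)) * (\<eta> \<omega> * (W v \<omega> - W u \<omega>))) =
    expectation (\<lambda>\<omega>. \<xi> \<omega> * \<eta> \<omega>) * overlap s t u v"
proof -
  have u0: "0 \<le> u" using s u by auto
  \<comment> \<open>Used with \<open>r = t\<close> when the first interval ends before the second
    begins, and with \<open>r = u\<close> for the piece cut off otherwise.\<close>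
  have past: "integrable M (\<lambda>\<omega>. (\<xi> \<omega> * (W r \<omega> - W s \<omega>)) * \<eta> \<omega> * (W v \<omega> - W u \<omega>))"
     "expectation (\<lambda>\<omega>. (\<xi> \<omega> * (W r \<omega> - W s \<omega>)) * \<eta> \<omega> * (W v \<omega> - W u \<omega>)) = 0"
    if r: "s \<le> r" "r \<le> u" for r
  proof -
    have "L2 r (\<lambda>\<omega>. \<xi> \<omega> * (W r \<omega> - W s \<omega>))" using s r \<xi> by (intro L2_times_increment) auto
    then have L: "L2 u (\<lambda>\<omega>. \<xi> \<omega> * (W r \<omega> - W s \<omega>))" by (rule L2_mono[OF r(2)])
    have "(\<lambda>\<omega>. (\<xi> \<omega> * (W r \<omega> - W s \<omega>)) * \<eta> \<omega>) \<in> borel_measurable (G u)"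
      using borel_measurable_times[of "\<lambda>\<omega>. \<xi> \<omega> * (W r \<omega> - W s \<omega>)" "G u" \<eta>] L \<eta>
      unfolding square_integrable_def by blast
    from integrable_times_increment[OF u0 u(2) this L2_integrable_mult[OF L \<eta>]]
    show "integrable M (\<lambda>\<omega>. (\<xi> \<omega> * (W r \<omega> - W s \<omega>)) * \<eta> \<omega> * (W v \<omega> - W u \<omega>))"
      "expectation (\<lambda>\<omega>. (\<xi> \<omega> * (W r \<omega> - W s \<omega>)) * \<eta> \<omega> * (W v \<omega> - W u \<omega>)) = 0" .
  qed
  show ?thesis
  proof (cases "t \<le> u")
    case True
    then show ?thesis using past(2)[of t] s by (simp add: overlap_def mult.assoc)
  next
    case False
    define w where "w = min t v"
    define z where "z = max t v"
    have w: "u \<le> w" "w \<le> z" using False u by (auto simp: w_def z_def)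
    \<comment> \<open>Beyond \<open>u\<close> both increments share the interval up to
      \<open>w\<close>, and one of them continues to \<open>z\<close>. The identity is symmetric in
      the two, so it does not matter which one ends first; the continuation is a centred increment
      independent of everything up to \<open>w\<close>.\<close>
    have z: "(W t \<omega> - W u \<omega>) * (W v \<omega> - W u \<omega>) = (W w \<omega> - W u \<omega>)\<^sup>2 + (W w \<omega> - W u \<omega>) * (W z \<omega> - W w \<omega>)" for \<omega>
      by (cases "t \<le> v") (auto simp: w_def z_def min_def max_def power2_eq_square algebra_simps)
    have \<xi>u: "L2 u \<xi>" using \<xi> u by (intro L2_mono[of s u]) auto
    have \<zeta>: "(\<lambda>\<omega>. \<xi> \<omega> * \<eta> \<omega>) \<in> borel_measurable (G u)" "integrable M (\<lambda>\<omega>. \<xi> \<omega> * \<eta> \<omega>)"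
      using \<xi>u \<eta> L2_integrable_mult[OF \<xi>u \<eta>] by (auto simp: square_integrable_def)
    note p1 = integrable_times_increment_square[OF u0 w(1) \<zeta>]
    have \<zeta>': "(\<lambda>\<omega>. \<xi> \<omega> * \<eta> \<omega> * (W w \<omega> - W u \<omega>)) \<in> borel_measurable (G w)"
      using measurable_G_mono[OF w(1) \<zeta>(1)] increment_measurable[OF u0 w(1)] by auto
    note p2 = integrable_times_increment[OF _ w(2) \<zeta>' integrable_times_increment(1)[OF u0 w(1) \<zeta>]]
    have w0: "0 \<le> w" using w u0 by auto
    have "(\<lambda>\<omega>. (\<xi> \<omega> * (W t \<omega> - W s \<omega>)) * (\<eta> \<omega> * (W v \<omega> - W u \<omega>))) =
      (\<lambda>\<omega>. (\<xi> \<omega> * (W u \<omega> - W s \<omega>)) * \<eta> \<omega> * (W v \<omega> - W u \<omega>) +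
        (\<xi> \<omega> * \<eta> \<omega> * (W w \<omega> - W u \<omega>)\<^sup>2 + \<xi> \<omega> * \<eta> \<omega> * (W w \<omega> - W u \<omega>) * (W z \<omega> - W w \<omega>)))"
    proof
      fix \<omega>
      have "(\<xi> \<omega> * (W t \<omega> - W s \<omega>)) * (\<eta> \<omega> * (W v \<omega> - W u \<omega>)) =
         (\<xi> \<omega> * (W u \<omega> - W s \<omega>)) * \<eta> \<omega> * (W v \<omega> - W u \<omega>) + \<xi> \<omega> * \<eta> \<omega> * ((W t \<omega> - W u \<omega>) * (W v \<omega> - W u \<omega>))"
        by (simp add: algebra_simps)
      then show "(\<xi> \<omega> * (W t \<omega> - W s \<omega>)) * (\<eta> \<omega> * (W v \<omega> - W u \<omega>)) =
        (\<xi> \<omega> * (W u \<omega> - W s \<omega>)) * \<eta> \<omega> * (W v \<omega> - W u \<omega>) +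
        (\<xi> \<omega> * \<eta> \<omega> * (W w \<omega> - W u \<omega>)\<^sup>2 + \<xi> \<omega> * \<eta> \<omega> * (W w \<omega> - W u \<omega>) * (W z \<omega> - W w \<omega>))"
        unfolding z by (simp add: algebra_simps)
    qed
    then have "expectation (\<lambda>\<omega>. (\<xi> \<omega> * (W t \<omega> - W s \<omega>)) * (\<eta> \<omega> * (W v \<omega> - W u \<omega>))) =
      0 + (expectation (\<lambda>\<omega>. \<xi> \<omega> * \<eta> \<omega>) * (w - u) + 0)"
      using p1 p2[OF w0] past[OF u(1) order_refl] by simp
    then show ?thesis using u False by (simp add: overlap_def w_def max_def)
  qed
qed

lemma elementary_isometry:
  assumes "0 \<le> s" "s \<le> t" "0 \<le> u" "u \<le> v" "L2 s \<xi>" "L2 u \<eta>"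
  shows "expectation (\<lambda>\<omega>. (\<xi> \<omega> * (W t \<omega> - W s \<omega>)) * (\<eta> \<omega> * (W v \<omega> - W u \<omega>))) =
    expectation (\<lambda>\<omega>. \<xi> \<omega> * \<eta> \<omega>) * overlap s t u v"
proof (cases "s \<le> u")
  case True
  show ?thesis by (rule elementary_isometry_ordered; fact)
next
  case False
  then have us: "u \<le> s" by simp
  have "expectation (\<lambda>\<omega>. (\<eta> \<omega> * (W v \<omega> - W u \<omega>)) * (\<xi> \<omega> * (W t \<omega> - W s \<omega>))) =
    expectation (\<lambda>\<omega>. \<eta> \<omega> * \<xi> \<omega>) * overlap u v s t"
    by (rule elementary_isometry_ordered; fact)
  then show ?thesis by (simp add: mult.commute overlap_def max.commute min.commute)
qed

lemma ito_isometry: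
  assumes A: "finite A" and st: "\<And>i. i \<in> A \<Longrightarrow> 0 \<le> s i" "\<And>i. i \<in> A \<Longrightarrow> s i \<le> t i" "\<And>i. i \<in> A \<Longrightarrow> t i \<le> T"
    and \<xi>: "\<And>i. i \<in> A \<Longrightarrow> L2 (s i) (\<xi> i)"
  shows "(\<integral>\<^sup>+\<omega>. ennreal ((\<Sum>i\<in>A. \<xi> i \<omega> * (W (t i) \<omega> - W (s i) \<omega>))\<^sup>2) \<partial>M) =
    (\<integral>\<^sup>+\<omega>. (\<integral>\<^sup>+x\<in>{0..T}. ennreal ((\<Sum>i\<in>A. \<xi> i \<omega> * indicator {s i<..t i} x)\<^sup>2) \<partial>lborel) \<partial>M)"
proof -
  define len where "len i j = overlap (s i) (t i) (s j) (t j)" for i j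
  have LI: "L2 (t i) (\<lambda>\<omega>. \<xi> i \<omega> * (W (t i) \<omega> - W (s i) \<omega>))" if "i \<in> A" for i
    by (rule L2_times_increment[OF st(1,2) \<xi>]; fact)
  have sq_integral: "has_bochner_integral lborel (\<lambda>x. (\<Sum>i\<in>A. \<xi> i \<omega> * indicator {s i<..t i} x)\<^sup>2)
      (\<Sum>i\<in>A. \<Sum>j\<in>A. \<xi> i \<omega> * \<xi> j \<omega> * len i j)" for \<omega>
  proof -
    have ind: "indicator {s i<..t i} x * indicator {s j<..t j} x = (indicator {max (s i) (s j)<..min (t i) (t j)} x :: real)" for i j x
      by (auto simp: indicator_def)
    have sq: "(\<Sum>i\<in>A. \<xi> i \<omega> * indicator {s i<..t i} x)\<^sup>2 =
      (\<Sum>i\<in>A. \<Sum>j\<in>A. \<xi> i \<omega> * \<xi> j \<omega> * indicator {max (s i) (s j)<..min (t i) (t j)} x)" for x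
      unfolding power2_eq_square sum_product by (intro sum.cong refl) (simp add: ind[symmetric] algebra_simps)
    have hb: "has_bochner_integral lborel (indicator {a<..b} :: real \<Rightarrow> real) (max 0 (b - a))" for a b
    proof (cases "a \<le> b")
      case True
      then show ?thesis using has_bochner_integral_real_indicator[of "{a<..b}" lborel] by (simp add: max_def)
    next
      case False
      then have "indicator {a<..b} = (\<lambda>x. 0 :: real)" by (auto simp: indicator_def fun_eq_iff)
      with False show ?thesis by (simp add: max_def has_bochner_integral_zero)
    qed
    show ?thesis
      unfolding sq len_def overlap_def by (intro has_bochner_integral_sum has_bochner_integral_mult_right hb)
  qed
  have nonneg: "0 \<le> (\<Sum>i\<in>A. \<Sum>j\<in>A. \<xi> i \<omega> * \<xi> j \<omega> * len i j)" for \<omega>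
    using has_bochner_integral_integral_eq[OF sq_integral[of \<omega>], symmetric] by simp
  have inner: "(\<integral>\<^sup>+x\<in>{0..T}. ennreal ((\<Sum>i\<in>A. \<xi> i \<omega> * indicator {s i<..t i} x)\<^sup>2) \<partial>lborel) =
    ennreal (\<Sum>i\<in>A. \<Sum>j\<in>A. \<xi> i \<omega> * \<xi> j \<omega> * len i j)" for \<omega>
  proof -
    have "(\<integral>\<^sup>+x\<in>{0..T}. ennreal ((\<Sum>i\<in>A. \<xi> i \<omega> * indicator {s i<..t i} x)\<^sup>2) \<partial>lborel) =
      (\<integral>\<^sup>+x. ennreal ((\<Sum>i\<in>A. \<xi> i \<omega> * indicator {s i<..t i} x)\<^sup>2) \<partial>lborel)"
    proof (rule nn_integral_cong)
      fix x
      show "ennreal ((\<Sum>i\<in>A. \<xi> i \<omega> * indicator {s i<..t i} x)\<^sup>2) * indicator {0..T} x =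
        ennreal ((\<Sum>i\<in>A. \<xi> i \<omega> * indicator {s i<..t i} x)\<^sup>2)"
      proof (cases "x \<in> {0..T}")
        case False
        then have "(\<Sum>i\<in>A. \<xi> i \<omega> * indicator {s i<..t i} x) = 0"
          using st by (intro sum.neutral) (force simp: indicator_def)
        then show ?thesis by simp
      qed simp
    qed
    also have "\<dots> = ennreal (\<Sum>i\<in>A. \<Sum>j\<in>A. \<xi> i \<omega> * \<xi> j \<omega> * len i j)"
      using sq_integral[of \<omega>] by (subst nn_integral_eq_integral) (auto simp: has_bochner_integral_iff)
    finally show ?thesis .
  qed
  have outer: "has_bochner_integral M (\<lambda>\<omega>. \<Sum>i\<in>A. \<Sum>j\<in>A. \<xi> i \<omega> * \<xi> j \<omega> * len i j)
     (\<Sum>i\<in>A. \<Sum>j\<in>A. expectation (\<lambda>\<omega>. \<xi> i \<omega> * \<xi> j \<omega>) * len i j)"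
    using L2_integrable_mult[OF \<xi> \<xi>]
    by (intro has_bochner_integral_sum has_bochner_integral_mult_left) (auto simp: has_bochner_integral_iff)
  have sq: "(\<Sum>i\<in>A. \<xi> i \<omega> * (W (t i) \<omega> - W (s i) \<omega>))\<^sup>2 =
    (\<Sum>i\<in>A. \<Sum>j\<in>A. (\<xi> i \<omega> * (W (t i) \<omega> - W (s i) \<omega>)) * (\<xi> j \<omega> * (W (t j) \<omega> - W (s j) \<omega>)))" for \<omega>
    unfolding power2_eq_square sum_product ..
  have left: "has_bochner_integral M (\<lambda>\<omega>. (\<Sum>i\<in>A. \<xi> i \<omega> * (W (t i) \<omega> - W (s i) \<omega>))\<^sup>2)
     (\<Sum>i\<in>A. \<Sum>j\<in>A. expectation (\<lambda>\<omega>. \<xi> i \<omega> * \<xi> j \<omega>) * len i j)"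
    unfolding sq len_def using L2_integrable_mult[OF LI LI] st \<xi>
    by (intro has_bochner_integral_sum) (simp add: has_bochner_integral_iff elementary_isometry)
  have "(\<integral>\<^sup>+\<omega>. ennreal ((\<Sum>i\<in>A. \<xi> i \<omega> * (W (t i) \<omega> - W (s i) \<omega>))\<^sup>2) \<partial>M) =
     ennreal (\<Sum>i\<in>A. \<Sum>j\<in>A. expectation (\<lambda>\<omega>. \<xi> i \<omega> * \<xi> j \<omega>) * len i j)"
    using left by (subst nn_integral_eq_integral) (auto simp: has_bochner_integral_iff)
  also have "\<dots> = (\<integral>\<^sup>+\<omega>. ennreal (\<Sum>i\<in>A. \<Sum>j\<in>A. \<xi> i \<omega> * \<xi> j \<omega> * len i j) \<partial>M)"
    using outer nonneg by (subst nn_integral_eq_integral) (auto simp: has_bochner_integral_iff)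
  finally show ?thesis unfolding inner .
qed

text \<open>The definition of the integral supplies some approximating sequence. The Riemann sum is
  compared with it through the isometry, and the index of the sequence is sent to infinity. What
  remains is the distance of \<open>H\<close> to its left-point step process over time and
  \<open>M\<close>: it is at most \<open>T * (T / Suc N)\<close>, since \<open>H\<close> moves in
  mean square by at most the elapsed time. The factor 4 comes from splitting a square of a sum
  twice.\<close>

lemma ito_integral_Riemann_sums:
  fixes H :: "real \<Rightarrow> 'a \<Rightarrow> real"
  assumes T: "0 < T" and I: "has_ito_integral M G T W H I"
    and H: "\<And>u. 0 \<le> u \<Longrightarrow> u \<le> T \<Longrightarrow> L2 u (H u)"
    and Hinc: "\<And>u v. 0 \<le> u \<Longrightarrow> u \<le> v \<Longrightarrow> v \<le> T \<Longrightarrow> (\<integral>\<^sup>+\<omega>. ennreal ((H v \<omega> - H u \<omega>)\<^sup>2) \<partial>M) \<le> ennreal (v - u)"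
  shows "(\<integral>\<^sup>+\<omega>. ennreal (((\<Sum>i<Suc N. H (T * real i / Suc N) \<omega> *
      (W (T * real (Suc i) / Suc N) \<omega> - W (T * real i / Suc N) \<omega>)) - I \<omega>)\<^sup>2) \<partial>M) \<le> 4 * ennreal (T\<^sup>2 / Suc N)"
proof -
  define g where "g i = T * real i / Suc N" for i
  define R where "R = restrict_space lborel {0..T}"
  define P where "P s \<omega> = (\<Sum>i<Suc N. H (g i) \<omega> * indicator {g i<..g (Suc i)} s)" for s \<omega>
  define L where "L \<omega> = (\<Sum>i<Suc N. H (g i) \<omega> * (W (g (Suc i)) \<omega> - W (g i) \<omega>))" for \<omega>
  have Hm: "(\<lambda>(s, \<omega>). H s \<omega>) \<in> borel_measurable (restrict_space borel {0..T} \<Otimes>\<^sub>M M)"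
    and Im: "I \<in> borel_measurable M"
    using I by (auto simp: has_ito_integral_def)
  from I obtain n t \<xi> where
    simp: "\<And>k. simple_integrand M G T (n k) (t k) (\<xi> k)"
    and A: "(\<lambda>k. \<integral>\<^sup>+\<omega>. (\<integral>\<^sup>+s\<in>{0..T}. ennreal ((simple_process (n k) (t k) (\<xi> k) s \<omega> - H s \<omega>)\<^sup>2) \<partial>lborel) \<partial>M) \<longlonglongrightarrow> 0"
    and B: "(\<lambda>k. \<integral>\<^sup>+\<omega>. ennreal ((simple_ito_integral W (n k) (t k) (\<xi> k) \<omega> - I \<omega>)\<^sup>2) \<partial>M) \<longlonglongrightarrow> 0"
    unfolding has_ito_integral_def by blast
  let ?A = "\<lambda>k. \<integral>\<^sup>+\<omega>. (\<integral>\<^sup>+s\<in>{0..T}. ennreal ((simple_process (n k) (t k) (\<xi> k) s \<omega> - H s \<omega>)\<^sup>2) \<partial>lborel) \<partial>M"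
  let ?B = "\<lambda>k. \<integral>\<^sup>+\<omega>. ennreal ((simple_ito_integral W (n k) (t k) (\<xi> k) \<omega> - I \<omega>)\<^sup>2) \<partial>M"
  have g: "0 \<le> g i" "g i \<le> g (Suc i)" for i using T by (auto simp: g_def divide_right_mono)
  have gT: "g i \<le> T" if "i \<le> Suc N" for i
    using T that mult_left_mono[of "real i" "real (Suc N)" T] by (simp add: g_def field_simps)
  have gSuc: "g (Suc i) - g i = T / Suc N" for i by (simp add: g_def diff_divide_distrib[symmetric] algebra_simps)
  interpret R: finite_measure R
    unfolding R_def using T by (intro finite_measureI) (simp add: emeasure_restrict_space space_restrict_space)
  interpret RM: pair_sigma_finite R M ..
  have [measurable_cong]: "sets R = sets (restrict_space borel {0..T})"
    by (simp add: R_def sets_restrict_space)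
  have setsRM: "sets (R \<Otimes>\<^sub>M M) = sets (restrict_space borel {0..T} \<Otimes>\<^sub>M M)"
    by (rule sets_pair_measure_cong) (simp_all add: R_def sets_restrict_space)
  have HR [measurable]: "(\<lambda>(s, \<omega>). H s \<omega>) \<in> borel_measurable (R \<Otimes>\<^sub>M M)"
    using Hm measurable_cong_sets[OF setsRM refl] by blast
  have [measurable]: "(\<lambda>p. indicator {a<..b} (fst p) :: real) \<in> borel_measurable (R \<Otimes>\<^sub>M M)" for a b
  proof -
    have "(\<lambda>x. x) \<in> borel_measurable R" unfolding R_def by (intro measurable_restrict_space1) simp
    from measurable_compose[OF measurable_fst this]
    have "fst \<in> measurable (R \<Otimes>\<^sub>M M) borel" .
    then show ?thesis by measurable
  qed
  have Hgm: "H (g i) \<in> borel_measurable M" if "i < Suc N" for i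
    using H[of "g i"] g gT[of i] that by (auto intro: L2_M)
  have \<xi>m: "L2 (t k i) (\<xi> k i)" if "i < n k" for k i
  proof -
    have *: "\<xi> k i \<in> borel_measurable (G (t k i))" and "\<exists>C. \<forall>\<omega>\<in>space M. \<bar>\<xi> k i \<omega>\<bar> \<le> C"
      using simp[of k] that by (auto simp: simple_integrand_def)
    then obtain C where C: "\<And>\<omega>. \<omega> \<in> space M \<Longrightarrow> \<bar>\<xi> k i \<omega>\<bar> \<le> C" by auto
    have "integrable M (\<lambda>\<omega>. (\<xi> k i \<omega>)\<^sup>2)"
    proof (rule integrable_const_bound[where B="C\<^sup>2"])
      show "AE \<omega> in M. norm ((\<xi> k i \<omega>)\<^sup>2) \<le> C\<^sup>2"
        using C by (intro AE_I2) (simp add: abs_le_square_iff[symmetric] order.trans[OF C abs_ge_self])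
      show "(\<lambda>\<omega>. (\<xi> k i \<omega>)\<^sup>2) \<in> borel_measurable M" using measurable_G_M[OF *] by simp
    qed
    with * show ?thesis by (simp add: square_integrable_def)
  qed
  have t: "0 \<le> t k i" "t k i \<le> t k (Suc i)" "t k (Suc i) \<le> T" if "i < n k" for k i
  proof -
    have m: "mono_on {..n k} (t k)" and e: "0 \<le> t k 0" "t k (n k) \<le> T"
      using simp[of k] by (auto simp: simple_integrand_def)
    show "0 \<le> t k i" "t k i \<le> t k (Suc i)" "t k (Suc i) \<le> T"
      using monotone_onD[OF m, of 0 i] monotone_onD[OF m, of i "Suc i"] monotone_onD[OF m, of "Suc i" "n k"] e that by auto
  qed
  have Pm [measurable]: "(\<lambda>p. P (fst p) (snd p)) \<in> borel_measurable (R \<Otimes>\<^sub>M M)"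
    unfolding P_def
  proof (intro borel_measurable_sum borel_measurable_times)
    fix i assume "i \<in> {..<Suc N}"
    then show "(\<lambda>p. H (g i) (snd p)) \<in> borel_measurable (R \<Otimes>\<^sub>M M)"
      using measurable_compose[OF measurable_snd Hgm[of i]] by auto
  qed measurable
  have Sm [measurable]: "(\<lambda>p. simple_process (n k) (t k) (\<xi> k) (fst p) (snd p)) \<in> borel_measurable (R \<Otimes>\<^sub>M M)" for k
    unfolding simple_process_def
  proof (intro borel_measurable_sum borel_measurable_times)
    fix i assume "i \<in> {..<n k}"
    then show "(\<lambda>p. \<xi> k i (snd p)) \<in> borel_measurable (R \<Otimes>\<^sub>M M)"
      using measurable_compose[OF measurable_snd L2_M(1)[OF \<xi>m[of i k]]] by auto
  qed measurable
  have HRp [measurable]: "(\<lambda>p. H (fst p) (snd p)) \<in> borel_measurable (R \<Otimes>\<^sub>M M)"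
    using HR by (simp add: case_prod_beta')
  \<comment> \<open>The definition integrates over time first and over \<open>M\<close> last, while
    the mesh estimate needs the opposite order; both are routed through the product measure.\<close>
  have dbl: "(\<integral>\<^sup>+\<omega>. (\<integral>\<^sup>+s\<in>{0..T}. f (s, \<omega>) \<partial>lborel) \<partial>M) = (\<integral>\<^sup>+p. f p \<partial>(R \<Otimes>\<^sub>M M))"
    if "f \<in> borel_measurable (R \<Otimes>\<^sub>M M)" for f :: "real \<times> 'a \<Rightarrow> ennreal"
  proof -
    have "(\<integral>\<^sup>+\<omega>. (\<integral>\<^sup>+s\<in>{0..T}. f (s, \<omega>) \<partial>lborel) \<partial>M) = (\<integral>\<^sup>+\<omega>. (\<integral>\<^sup>+s. f (s, \<omega>) \<partial>R) \<partial>M)"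
      unfolding R_def by (simp add: nn_integral_restrict_space)
    also have "\<dots> = (\<integral>\<^sup>+p. f p \<partial>(R \<Otimes>\<^sub>M M))" using RM.nn_integral_snd[OF that] by simp
    finally show ?thesis .
  qed
  have mesh: "(\<integral>\<^sup>+p. ennreal ((H (fst p) (snd p) - P (fst p) (snd p))\<^sup>2) \<partial>(R \<Otimes>\<^sub>M M)) \<le> ennreal (T\<^sup>2 / Suc N)"
  proof -
    have ptw: "(\<integral>\<^sup>+\<omega>. ennreal ((H s \<omega> - P s \<omega>)\<^sup>2) \<partial>M) \<le> ennreal (T / Suc N)" if s: "0 < s" "s \<le> T" for s
    proof -
      \<comment> \<open>\<open>y\<close> is \<open>s\<close> in units of the mesh. The intervals of
        the step process are open on the left and closed on the right, so the index of the one
        containing \<open>s\<close> is the ceiling of \<open>y\<close> minus one.\<close>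
      define y where "y = s * Suc N / T"
      define j where "j = nat (\<lceil>y\<rceil> - 1)"
      have y: "0 < y" "y \<le> Suc N" using s T mult_right_mono[of s T "real (Suc N)"]
        unfolding y_def by (simp_all only: divide_le_eq zero_less_divide_iff zero_less_mult_iff of_nat_0_less_iff) (auto simp: mult.commute)
      have c: "\<lceil>y\<rceil> \<ge> 1" "\<lceil>y\<rceil> \<le> int (Suc N)" using y by (auto simp: le_ceiling_iff ceiling_le_iff)
      have jN: "j < Suc N" using c by (simp add: j_def)
      have "real j = of_int \<lceil>y\<rceil> - 1" using c by (simp add: j_def)
      moreover have "of_int \<lceil>y\<rceil> - 1 < y" "y \<le> of_int \<lceil>y\<rceil>" using ceiling_correct[of y] by auto
      ultimately have jy: "real j < y" "y \<le> real (Suc j)" by auto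
      have sj: "g j < s" "s \<le> g (Suc j)" using jy T by (auto simp: g_def y_def field_simps)
      have uniq: "indicator {g i<..g (Suc i)} s = (if i = j then 1 else 0 :: real)" for i
      proof (cases "i = j")
        case False
        have "g (Suc i) \<le> g j \<or> g (Suc j) \<le> g i"
          using False T by (cases "i < j") (auto simp: g_def intro!: divide_right_mono mult_left_mono)
        with sj False show ?thesis by (auto simp: indicator_def)
      qed (use sj in simp)
      have "P s \<omega> = H (g j) \<omega>" for \<omega> unfolding P_def uniq using jN
        by (simp add: if_distrib[of "(*) _"] sum.delta del: sum.lessThan_Suc cong: if_cong)
      then have "(\<integral>\<^sup>+\<omega>. ennreal ((H s \<omega> - P s \<omega>)\<^sup>2) \<partial>M) \<le> ennreal (s - g j)"
        using Hinc[of "g j" s] sj s g by simp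
      also have "\<dots> \<le> ennreal (T / Suc N)" using sj gSuc[of j] by (intro ennreal_leI) linarith
      finally show ?thesis .
    qed
    have "(\<integral>\<^sup>+p. ennreal ((H (fst p) (snd p) - P (fst p) (snd p))\<^sup>2) \<partial>(R \<Otimes>\<^sub>M M)) =
      (\<integral>\<^sup>+s. (\<integral>\<^sup>+\<omega>. ennreal ((H s \<omega> - P s \<omega>)\<^sup>2) \<partial>M) \<partial>R)"
      by (subst nn_integral_fst[symmetric]) auto
    also have "\<dots> \<le> (\<integral>\<^sup>+s. ennreal (T / Suc N) \<partial>R)"
    proof (rule nn_integral_mono_AE)
      \<comment> \<open>Time 0 lies in none of the left-open intervals and is discarded as a null
        set.\<close>
      have "AE s in lborel. s \<in> {0..T} \<longrightarrow> s \<noteq> (0::real)"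
        using AE_lborel_singleton[of "0::real"] by eventually_elim simp
      then have "AE s in R. s \<noteq> 0" unfolding R_def by (subst AE_restrict_space_iff) auto
      moreover have "AE s in R. s \<in> {0..T}" by (rule AE_I2) (simp add: R_def space_restrict_space)
      ultimately show "AE s in R. (\<integral>\<^sup>+\<omega>. ennreal ((H s \<omega> - P s \<omega>)\<^sup>2) \<partial>M) \<le> ennreal (T / Suc N)"
        by eventually_elim (use ptw in auto)
    qed
    also have "\<dots> = ennreal (T / Suc N) * ennreal T"
      using T by (simp add: R_def space_restrict_space emeasure_restrict_space)
    also have "\<dots> = ennreal (T\<^sup>2 / Suc N)"
      using T by (simp add: ennreal_mult[symmetric] power2_eq_square)
    finally show ?thesis .
  qed
  have diff: "(\<integral>\<^sup>+\<omega>. ennreal ((simple_ito_integral W (n k) (t k) (\<xi> k) \<omega> - L \<omega>)\<^sup>2) \<partial>M)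
     = (\<integral>\<^sup>+p. ennreal ((simple_process (n k) (t k) (\<xi> k) (fst p) (snd p) - P (fst p) (snd p))\<^sup>2) \<partial>(R \<Otimes>\<^sub>M M))" for k
  proof -
    \<comment> \<open>The disjoint sum of the two index sets turns the difference of two sums into a
      single one, with negated coefficients on the second half.\<close>
    let ?J = "{..<n k} <+> {..<Suc N}"
    let ?\<xi> = "case_sum (\<xi> k) (\<lambda>i \<omega>. - H (g i) \<omega>)"
    let ?s = "case_sum (t k) g" and ?t = "case_sum (\<lambda>i. t k (Suc i)) (\<lambda>i. g (Suc i))"
    have L2g: "L2 (g i) (\<lambda>\<omega>. - H (g i) \<omega>)" if "i < Suc N" for i
      using H[of "g i"] g gT[of i] that by (auto simp: square_integrable_def)
    have "(\<integral>\<^sup>+\<omega>. ennreal ((\<Sum>i\<in>?J. ?\<xi> i \<omega> * (W (?t i) \<omega> - W (?s i) \<omega>))\<^sup>2) \<partial>M) =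
      (\<integral>\<^sup>+\<omega>. (\<integral>\<^sup>+x\<in>{0..T}. ennreal ((\<Sum>i\<in>?J. ?\<xi> i \<omega> * indicator {?s i<..?t i} x)\<^sup>2) \<partial>lborel) \<partial>M)"
      by (rule ito_isometry) (use t g gT \<xi>m L2g in auto)
    moreover have "(\<Sum>i\<in>?J. ?\<xi> i \<omega> * (W (?t i) \<omega> - W (?s i) \<omega>)) = simple_ito_integral W (n k) (t k) (\<xi> k) \<omega> - L \<omega>" for \<omega>
      by (simp add: sum.Plus simple_ito_integral_def L_def o_def sum_negf del: sum.lessThan_Suc)
    moreover have "(\<Sum>i\<in>?J. ?\<xi> i \<omega> * indicator {?s i<..?t i} x) = simple_process (n k) (t k) (\<xi> k) x \<omega> - P x \<omega>" for \<omega> x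
      unfolding simple_process_def P_def
      by (subst sum.Plus) (simp_all add: o_def sum_negf del: sum.lessThan_Suc)
    ultimately show ?thesis
      using dbl[of "\<lambda>p. ennreal ((simple_process (n k) (t k) (\<xi> k) (fst p) (snd p) - P (fst p) (snd p))\<^sup>2)"] by simp
  qed
  have Lm [measurable]: "L \<in> borel_measurable M"
    unfolding L_def
  proof (intro borel_measurable_sum borel_measurable_times)
    fix i assume "i \<in> {..<Suc N}"
    then show "H (g i) \<in> borel_measurable M" by (intro Hgm) simp
    show "(\<lambda>\<omega>. W (g (Suc i)) \<omega> - W (g i) \<omega>) \<in> borel_measurable M"
      using increment_measurable[OF g] by (rule measurable_G_M)
  qed
  have SIm [measurable]: "simple_ito_integral W (n k) (t k) (\<xi> k) \<in> borel_measurable M" for k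
    unfolding simple_ito_integral_def
  proof (intro borel_measurable_sum borel_measurable_times)
    fix i assume "i \<in> {..<n k}"
    then have i: "i < n k" by simp
    show "\<xi> k i \<in> borel_measurable M" using \<xi>m[OF i] by (rule L2_M)
    show "(\<lambda>\<omega>. W (t k (Suc i)) \<omega> - W (t k i) \<omega>) \<in> borel_measurable M"
      using increment_measurable[OF t(1,2)[OF i]] by (rule measurable_G_M)
  qed
  note [measurable] = Im
  have bound: "(\<integral>\<^sup>+\<omega>. ennreal ((L \<omega> - I \<omega>)\<^sup>2) \<partial>M) \<le> 2 * (2 * ?A k + 2 * ennreal (T\<^sup>2 / Suc N)) + 2 * ?B k" for k
  proof -
    let ?S = "simple_ito_integral W (n k) (t k) (\<xi> k)"
    let ?p = "\<lambda>p. simple_process (n k) (t k) (\<xi> k) (fst p) (snd p)"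
    have "(\<integral>\<^sup>+\<omega>. ennreal ((L \<omega> - I \<omega>)\<^sup>2) \<partial>M) = (\<integral>\<^sup>+\<omega>. ennreal (((L \<omega> - ?S \<omega>) + (?S \<omega> - I \<omega>))\<^sup>2) \<partial>M)" by simp
    also have "\<dots> \<le> 2 * (\<integral>\<^sup>+\<omega>. ennreal ((L \<omega> - ?S \<omega>)\<^sup>2) \<partial>M) + 2 * ?B k"
      by (rule nn_integral_square_add_le) auto
    also have "(\<integral>\<^sup>+\<omega>. ennreal ((L \<omega> - ?S \<omega>)\<^sup>2) \<partial>M) = (\<integral>\<^sup>+\<omega>. ennreal ((?S \<omega> - L \<omega>)\<^sup>2) \<partial>M)"
      by (simp add: power2_commute)
    also have "\<dots> = (\<integral>\<^sup>+p. ennreal ((?p p - P (fst p) (snd p))\<^sup>2) \<partial>(R \<Otimes>\<^sub>M M))" by (rule diff)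
    also have "\<dots> = (\<integral>\<^sup>+p. ennreal (((?p p - H (fst p) (snd p)) + (H (fst p) (snd p) - P (fst p) (snd p)))\<^sup>2) \<partial>(R \<Otimes>\<^sub>M M))"
      by simp
    also have "\<dots> \<le> 2 * (\<integral>\<^sup>+p. ennreal ((?p p - H (fst p) (snd p))\<^sup>2) \<partial>(R \<Otimes>\<^sub>M M)) +
        2 * (\<integral>\<^sup>+p. ennreal ((H (fst p) (snd p) - P (fst p) (snd p))\<^sup>2) \<partial>(R \<Otimes>\<^sub>M M))"
      by (rule nn_integral_square_add_le) measurable
    also have "(\<integral>\<^sup>+p. ennreal ((?p p - H (fst p) (snd p))\<^sup>2) \<partial>(R \<Otimes>\<^sub>M M)) = ?A k"
      using dbl[of "\<lambda>p. ennreal ((?p p - H (fst p) (snd p))\<^sup>2)"] by simp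
    finally show ?thesis using mesh
      by (meson add_left_mono add_right_mono mult_left_mono order_trans zero_le)
  qed
  have "(\<lambda>k. 2 * (2 * ?A k + 2 * ennreal (T\<^sup>2 / Suc N)) + 2 * ?B k)
    \<longlonglongrightarrow> 2 * (2 * 0 + 2 * ennreal (T\<^sup>2 / Suc N)) + 2 * 0"
    by (intro tendsto_add ennreal_tendsto_cmult A B tendsto_const) auto
  from LIMSEQ_le_const[OF this] bound
  have "(\<integral>\<^sup>+\<omega>. ennreal ((L \<omega> - I \<omega>)\<^sup>2) \<partial>M) \<le> 2 * (2 * 0 + 2 * ennreal (T\<^sup>2 / Suc N)) + 2 * 0" by blast
  also have "\<dots> = 4 * ennreal (T\<^sup>2 / Suc N)" by (simp add: mult.assoc[symmetric])
  finally show ?thesis by (simp only: L_def g_def)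
qed

end

section \<open>The Laplace transform and the moments of the area\<close>

text \<open>Completing the square: the integrand is a constant times the normal density with
  variance \<open>\<delta> / (1 - \<alpha> * \<delta>)\<close> and mean \<open>p\<close> times that
  variance. The condition on \<open>\<alpha> * \<delta>\<close> keeps this variance
  positive.\<close>

lemma nn_integral_exp_quadratic_normal:
  fixes p \<alpha> \<delta> :: real
  assumes \<delta>: "0 < \<delta>" and \<alpha>: "\<alpha> * \<delta> < 1"
  shows "(\<integral>\<^sup>+x. ennreal (normal_density 0 (sqrt \<delta>) x) * ennreal (exp (p * x + \<alpha> / 2 * x\<^sup>2)) \<partial>lborel) =
    ennreal (1 / sqrt (1 - \<alpha> * \<delta>) * exp (\<delta> * p\<^sup>2 / (2 * (1 - \<alpha> * \<delta>))))"
proof -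
  define q where "q = 1 - \<alpha> * \<delta>"
  have q: "0 < q" using \<alpha> by (simp add: q_def)
  have \<alpha>q: "\<alpha> = (1 - q) / \<delta>" using \<delta> by (simp add: q_def)
  define \<tau> where "\<tau> = sqrt (\<delta> / q)"
  have \<tau>: "0 < \<tau>" "\<tau>\<^sup>2 = \<delta> / q" using \<delta> q by (auto simp: \<tau>_def)
  define C where "C = 1 / sqrt q * exp (\<delta> * p\<^sup>2 / (2 * q))"
  have "normal_density 0 (sqrt \<delta>) x * exp (p * x + \<alpha> / 2 * x\<^sup>2) = C * normal_density (p * \<tau>\<^sup>2) \<tau> x" for x
  proof -
    have e: "- (x - 0)\<^sup>2 / (2 * (sqrt \<delta>)\<^sup>2) + (p * x + \<alpha> / 2 * x\<^sup>2) =
      \<delta> * p\<^sup>2 / (2 * q) + - (x - p * \<tau>\<^sup>2)\<^sup>2 / (2 * \<tau>\<^sup>2)"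
      unfolding \<tau>(2) \<alpha>q using \<delta> q by (simp add: field_simps power2_eq_square)
    have c: "1 / sqrt (2 * pi * (sqrt \<delta>)\<^sup>2) = 1 / sqrt q * (1 / sqrt (2 * pi * \<tau>\<^sup>2))"
      unfolding \<tau>(2) using \<delta> q by (simp add: real_sqrt_mult real_sqrt_divide)
    have "normal_density 0 (sqrt \<delta>) x * exp (p * x + \<alpha> / 2 * x\<^sup>2) =
      1 / sqrt (2 * pi * (sqrt \<delta>)\<^sup>2) * exp (- (x - 0)\<^sup>2 / (2 * (sqrt \<delta>)\<^sup>2) + (p * x + \<alpha> / 2 * x\<^sup>2))"
      unfolding normal_density_def exp_add by simp
    also have "\<dots> = C * normal_density (p * \<tau>\<^sup>2) \<tau> x"
      unfolding e c C_def normal_density_def exp_add by simp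
    finally show ?thesis .
  qed
  then have "(\<integral>\<^sup>+x. ennreal (normal_density 0 (sqrt \<delta>) x) * ennreal (exp (p * x + \<alpha> / 2 * x\<^sup>2)) \<partial>lborel) =
    (\<integral>\<^sup>+x. ennreal (C * normal_density (p * \<tau>\<^sup>2) \<tau> x) \<partial>lborel)"
    by (simp add: ennreal_mult'[symmetric])
  also have "\<dots> = ennreal (\<integral>x. C * normal_density (p * \<tau>\<^sup>2) \<tau> x \<partial>lborel)"
    using \<tau> q by (intro nn_integral_eq_integral) (auto simp: C_def)
  also have "\<dots> = ennreal C" using \<tau> by simp
  finally show ?thesis by (simp add: C_def q_def)
qed

section \<open>Integrating out one planar increment\<close>

context brownian_pair
begin

lemma increment_distributed:
  assumes "0 \<le> u" "u < v"
  shows "distributed M lborel (\<lambda>\<omega>. W1 v \<omega> - W1 u \<omega>) (normal_density 0 (sqrt (v - u)))"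
    and "distributed M lborel (\<lambda>\<omega>. W2 v \<omega> - W2 u \<omega>) (normal_density 0 (sqrt (v - u)))"
  using brownian assms by (auto simp: brownian_motion_def)

lemma W_zero: "AE \<omega> in M. W1 0 \<omega> = 0" "AE \<omega> in M. W2 0 \<omega> = 0"
  using brownian by (auto simp: brownian_motion_def)

lemma normal_increment_moments:
  assumes "brownian_motion M W" "0 \<le> u" "u \<le> v"
  shows "integrable M (\<lambda>\<omega>. W v \<omega> - W u \<omega>)" "integrable M (\<lambda>\<omega>. (W v \<omega> - W u \<omega>)\<^sup>2)"
    "expectation (\<lambda>\<omega>. W v \<omega> - W u \<omega>) = 0" "expectation (\<lambda>\<omega>. (W v \<omega> - W u \<omega>)\<^sup>2) = v - u"
proof -
  have "integrable M (\<lambda>\<omega>. W v \<omega> - W u \<omega>) \<and> integrable M (\<lambda>\<omega>. (W v \<omega> - W u \<omega>)\<^sup>2) \<and>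
    expectation (\<lambda>\<omega>. W v \<omega> - W u \<omega>) = 0 \<and> expectation (\<lambda>\<omega>. (W v \<omega> - W u \<omega>)\<^sup>2) = v - u"
  proof (cases "u = v")
    case False
    then have uv: "u < v" using assms by simp
    have D: "distributed M lborel (\<lambda>\<omega>. W v \<omega> - W u \<omega>) (normal_density 0 (sqrt (v - u)))"
      using assms uv by (auto simp: brownian_motion_def)
    have s: "0 < sqrt (v - u)" using uv by simp
    have 1: "integrable M (\<lambda>\<omega>. W v \<omega> - W u \<omega>)"
      using distributed_integrable[OF D, of "\<lambda>x. x"] integrable_normal_moment_nz_1[OF s, of 0] by simp
    have 2: "integrable M (\<lambda>\<omega>. (W v \<omega> - W u \<omega>)\<^sup>2)"
      using distributed_integrable[OF D, of "\<lambda>x. x\<^sup>2"] integrable_normal_moment[OF s, of 0 2] by simp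
    have 3: "expectation (\<lambda>\<omega>. W v \<omega> - W u \<omega>) = 0" using normal_distributed_expectation[OF s D] .
    have 4: "expectation (\<lambda>\<omega>. (W v \<omega> - W u \<omega>)\<^sup>2) = v - u"
      using normal_distributed_variance[OF s D] uv unfolding 3 by simp
    show ?thesis using 1 2 3 4 by blast
  qed simp
  then show "integrable M (\<lambda>\<omega>. W v \<omega> - W u \<omega>)" "integrable M (\<lambda>\<omega>. (W v \<omega> - W u \<omega>)\<^sup>2)"
    "expectation (\<lambda>\<omega>. W v \<omega> - W u \<omega>) = 0" "expectation (\<lambda>\<omega>. (W v \<omega> - W u \<omega>)\<^sup>2) = v - u" by auto
qed

lemma increment_indep_of_past:
  assumes "0 \<le> u" "u \<le> v" "U \<in> borel_measurable (F u)"
  shows "indep_var borel U borel (\<lambda>\<omega>. W1 v \<omega> - W1 u \<omega>)"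
    and "indep_var borel U borel (\<lambda>\<omega>. W2 v \<omega> - W2 u \<omega>)"
    and "indep_var borel U borel (\<lambda>\<omega>. (W1 v \<omega> - W1 u \<omega>) * (W2 v \<omega> - W2 u \<omega>))"
proof -
  have m: "fst \<in> borel_measurable (borel \<Otimes>\<^sub>M (borel :: real measure))"
    "snd \<in> borel_measurable ((borel :: real measure) \<Otimes>\<^sub>M borel)"
    "(\<lambda>p. fst p * snd p) \<in> borel_measurable ((borel :: real measure) \<Otimes>\<^sub>M borel)" by measurable
  show "indep_var borel U borel (\<lambda>\<omega>. W1 v \<omega> - W1 u \<omega>)"
    "indep_var borel U borel (\<lambda>\<omega>. W2 v \<omega> - W2 u \<omega>)"
    "indep_var borel U borel (\<lambda>\<omega>. (W1 v \<omega> - W1 u \<omega>) * (W2 v \<omega> - W2 u \<omega>))"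
    using indep_past_increment[OF assms m(1)] indep_past_increment[OF assms m(2)] indep_past_increment[OF assms m(3)]
    by simp_all
qed

lemma filtered_brownian_W1: "filtered_brownian M F W1"
  by unfold_locales (use space_F sets_F_le F_mono W_adapted(1) increment_indep_of_past(1)
    normal_increment_moments[OF brownian(1)] in \<open>auto\<close>)

lemma filtered_brownian_W2: "filtered_brownian M F W2"
  by unfold_locales (use space_F sets_F_le F_mono W_adapted(2) increment_indep_of_past(2)
    normal_increment_moments[OF brownian(2)] in \<open>auto\<close>)

text \<open>The joint law of the past and the two increments is a product, so the increments can be
  integrated against their densities with the past frozen. Strictness of \<open>u < v\<close>
  ensures that the densities exist.\<close>

lemma nn_integral_past_increment:
  assumes uv: "0 \<le> u" "u < v" and U: "U \<in> measurable (F u) N"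
    and f: "f \<in> borel_measurable (N \<Otimes>\<^sub>M (borel \<Otimes>\<^sub>M borel))"
  defines "n \<equiv> \<lambda>x. ennreal (normal_density 0 (sqrt (v - u)) x)"
  shows "(\<integral>\<^sup>+\<omega>. f (U \<omega>, (W1 v \<omega> - W1 u \<omega>, W2 v \<omega> - W2 u \<omega>)) \<partial>M) =
    (\<integral>\<^sup>+\<omega>. (\<integral>\<^sup>+x. n x * (\<integral>\<^sup>+y. n y * f (U \<omega>, (x, y)) \<partial>lborel) \<partial>lborel) \<partial>M)"
proof -
  let ?D1 = "\<lambda>\<omega>. W1 v \<omega> - W1 u \<omega>" and ?D2 = "\<lambda>\<omega>. W2 v \<omega> - W2 u \<omega>"
  have uv': "u \<le> v" using uv by simp
  note iv2 = indep_increments_cross[OF uv(1) uv']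
  note Um = measurable_F_M[OF U] and Vm = increment_pair_measurable[OF uv(1) uv']
  have D1m: "?D1 \<in> borel_measurable M" and D2m: "?D2 \<in> borel_measurable M"
    using indep_var_rv1[OF iv2] indep_var_rv2[OF iv2] by auto
  define \<nu> where "\<nu> = density lborel n"
  have nb: "n \<in> borel_measurable borel" unfolding n_def by measurable
  have law: "distr M borel ?D1 = \<nu>" "distr M borel ?D2 = \<nu>"
    using increment_distributed[OF uv] distr_cong[of M M borel lborel]
    by (simp_all add: distributed_def \<nu>_def n_def cong: distr_cong)
  have ps: "prob_space \<nu>" using prob_space_distr[OF D1m] law by simp
  interpret \<nu>: prob_space \<nu> by (rule ps)
  interpret \<nu>\<nu>: pair_prob_space \<nu> \<nu> ..
  have [simp]: "sets \<nu> = sets borel" "space \<nu> = UNIV" by (simp_all add: \<nu>_def)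
  have s2: "sets (\<nu> \<Otimes>\<^sub>M \<nu>) = sets (borel \<Otimes>\<^sub>M borel)" by (rule sets_pair_measure_cong) auto
  have joint: "distr M (N \<Otimes>\<^sub>M (borel \<Otimes>\<^sub>M borel)) (\<lambda>\<omega>. (U \<omega>, (?D1 \<omega>, ?D2 \<omega>))) = distr M N U \<Otimes>\<^sub>M (\<nu> \<Otimes>\<^sub>M \<nu>)"
    using distr_past_increment[OF uv(1) uv' U] iv2 law unfolding indep_var_distribution_eq by simp
  have sj: "sets (distr M N U \<Otimes>\<^sub>M (\<nu> \<Otimes>\<^sub>M \<nu>)) = sets (N \<Otimes>\<^sub>M (borel \<Otimes>\<^sub>M borel))"
    using s2 by (intro sets_pair_measure_cong) auto
  have fj: "f \<in> borel_measurable (distr M N U \<Otimes>\<^sub>M (\<nu> \<Otimes>\<^sub>M \<nu>))"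
    using f measurable_cong_sets[OF sj refl] by blast
  have fx: "(\<lambda>q. f (x, q)) \<in> borel_measurable (\<nu> \<Otimes>\<^sub>M \<nu>)" if "x \<in> space N" for x
    using measurable_compose[OF measurable_Pair1'[OF that] f] measurable_cong_sets[OF s2 refl] by blast
  have inner: "(\<integral>\<^sup>+q. f (x, q) \<partial>(\<nu> \<Otimes>\<^sub>M \<nu>)) = (\<integral>\<^sup>+a. n a * (\<integral>\<^sup>+b. n b * f (x, (a, b)) \<partial>lborel) \<partial>lborel)"
    if x: "x \<in> space N" for x
  proof -
    have fxb: "(\<lambda>q. f (x, q)) \<in> borel_measurable (borel \<Otimes>\<^sub>M borel)"
      using measurable_compose[OF measurable_Pair1'[OF x] f] .
    have fa: "(\<lambda>b. f (x, (a, b))) \<in> borel_measurable lborel" for a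
      using measurable_compose[OF measurable_Pair1'[of a borel borel] fxb] by simp
    have "(\<integral>\<^sup>+q. f (x, q) \<partial>(\<nu> \<Otimes>\<^sub>M \<nu>)) = (\<integral>\<^sup>+a. (\<integral>\<^sup>+b. f (x, (a, b)) \<partial>\<nu>) \<partial>\<nu>)"
      by (rule \<nu>.nn_integral_fst[OF fx[OF x], symmetric])
    also have "\<dots> = (\<integral>\<^sup>+a. (\<integral>\<^sup>+b. n b * f (x, (a, b)) \<partial>lborel) \<partial>\<nu>)"
      unfolding \<nu>_def using nb fa by (intro nn_integral_cong nn_integral_density) auto
    also have "\<dots> = (\<integral>\<^sup>+a. n a * (\<integral>\<^sup>+b. n b * f (x, (a, b)) \<partial>lborel) \<partial>lborel)"
      unfolding \<nu>_def
    proof (rule nn_integral_density)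
      have [measurable]: "(\<lambda>q. f (x, q)) \<in> borel_measurable (lborel \<Otimes>\<^sub>M lborel)"
        using fxb by simp
      have [measurable]: "n \<in> borel_measurable lborel" using nb by simp
      show "(\<lambda>a. \<integral>\<^sup>+b. n b * f (x, (a, b)) \<partial>lborel) \<in> borel_measurable lborel" by measurable
    qed (use nb in simp)
    finally show ?thesis .
  qed
  have "(\<integral>\<^sup>+\<omega>. f (U \<omega>, (?D1 \<omega>, ?D2 \<omega>)) \<partial>M) = (\<integral>\<^sup>+z. f z \<partial>distr M (N \<Otimes>\<^sub>M (borel \<Otimes>\<^sub>M borel)) (\<lambda>\<omega>. (U \<omega>, (?D1 \<omega>, ?D2 \<omega>))))"
    by (rule nn_integral_distr[symmetric]) (use Um Vm f in auto)
  also have "\<dots> = (\<integral>\<^sup>+x. (\<integral>\<^sup>+q. f (x, q) \<partial>(\<nu> \<Otimes>\<^sub>M \<nu>)) \<partial>distr M N U)"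
    unfolding joint by (rule \<nu>\<nu>.nn_integral_fst[OF fj, symmetric])
  also have "\<dots> = (\<integral>\<^sup>+\<omega>. (\<integral>\<^sup>+q. f (U \<omega>, q) \<partial>(\<nu> \<Otimes>\<^sub>M \<nu>)) \<partial>M)"
    by (rule nn_integral_distr) (use Um \<nu>\<nu>.borel_measurable_nn_integral_fst[OF fj] in auto)
  also have "\<dots> = (\<integral>\<^sup>+\<omega>. (\<integral>\<^sup>+x. n x * (\<integral>\<^sup>+y. n y * f (U \<omega>, (x, y)) \<partial>lborel) \<partial>lborel) \<partial>M)"
    using measurable_space[OF Um] by (intro nn_integral_cong inner)
  finally show ?thesis .
qed

text \<open>With the state at \<open>u\<close> frozen, the exponent is linear plus quadratic in the
  two increments, so two one-dimensional Gaussian integrals apply. Each contributes one factor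
  \<open>1 / sqrt (1 - \<alpha> * \<delta>)\<close>.\<close>

lemma exp_quadratic_step:
  fixes S X Y :: "'a \<Rightarrow> real" and \<alpha> c :: real
  assumes uv: "0 \<le> u" "u < v" and meas: "S \<in> borel_measurable (F u)" "X \<in> borel_measurable (F u)" "Y \<in> borel_measurable (F u)"
    and \<alpha>: "\<alpha> * (v - u) < 1"
  defines "\<delta> \<equiv> v - u"
  shows "(\<integral>\<^sup>+\<omega>. ennreal (exp (c * (S \<omega> + 1/2 * (X \<omega> * (W2 v \<omega> - W2 u \<omega>) - Y \<omega> * (W1 v \<omega> - W1 u \<omega>)))
      + \<alpha> / 2 * ((X \<omega> + (W1 v \<omega> - W1 u \<omega>))\<^sup>2 + (Y \<omega> + (W2 v \<omega> - W2 u \<omega>))\<^sup>2))) \<partial>M) =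
    ennreal (1 / (1 - \<alpha> * \<delta>)) * (\<integral>\<^sup>+\<omega>. ennreal (exp (c * S \<omega> +
      (\<alpha> + \<delta> * (\<alpha>\<^sup>2 + c\<^sup>2 / 4) / (1 - \<alpha> * \<delta>)) / 2 * ((X \<omega>)\<^sup>2 + (Y \<omega>)\<^sup>2))) \<partial>M)"
proof -
  have \<delta>: "0 < \<delta>" "\<alpha> * \<delta> < 1" using uv \<alpha> by (auto simp: \<delta>_def)
  define q where "q = 1 - \<alpha> * \<delta>"
  have q: "0 < q" using \<delta> by (simp add: q_def)
  define f :: "(real \<times> real \<times> real) \<times> real \<times> real \<Rightarrow> ennreal" where
    "f = (\<lambda>z. ennreal (exp (c * (fst (fst z) + 1/2 * (fst (snd (fst z)) * snd (snd z) - snd (snd (fst z)) * fst (snd z)))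
      + \<alpha> / 2 * ((fst (snd (fst z)) + fst (snd z))\<^sup>2 + (snd (snd (fst z)) + snd (snd z))\<^sup>2))))"
  let ?U = "\<lambda>\<omega>. (S \<omega>, X \<omega>, Y \<omega>)"
  have U: "?U \<in> measurable (F u) (borel \<Otimes>\<^sub>M (borel \<Otimes>\<^sub>M borel))" using meas by measurable
  have f: "f \<in> borel_measurable ((borel \<Otimes>\<^sub>M (borel \<Otimes>\<^sub>M borel)) \<Otimes>\<^sub>M (borel \<Otimes>\<^sub>M borel))"
    unfolding f_def by measurable
  define n where "n x = ennreal (normal_density 0 (sqrt \<delta>) x)" for x
  have [measurable]: "n \<in> borel_measurable borel" unfolding n_def by measurable
  have key: "(\<integral>\<^sup>+x. n x * (\<integral>\<^sup>+y. n y * f ((s, a, b), (x, y)) \<partial>lborel) \<partial>lborel) =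
     ennreal (1 / q) * ennreal (exp (c * s + (\<alpha> + \<delta> * (\<alpha>\<^sup>2 + c\<^sup>2 / 4) / q) / 2 * (a\<^sup>2 + b\<^sup>2)))" for s a b
  proof -
    \<comment> \<open>\<open>p1\<close> and \<open>p2\<close> are the linear coefficients of the two
      increments. The sum of their squares is (\<alpha>^2 + c^2 / 4) (a^2 + b^2): the mixed terms
      produced by the area cancel, and this is why the new weight depends only on the distance from
      the origin.\<close>
    define p1 p2 E where "p1 = \<alpha> * a - c * b / 2" and "p2 = \<alpha> * b + c * a / 2"
      and "E = exp (c * s + \<alpha> / 2 * (a\<^sup>2 + b\<^sup>2))"
    have fexp: "f ((s, a, b), (x, y)) = ennreal E * (ennreal (exp (p1 * x + \<alpha> / 2 * x\<^sup>2)) * ennreal (exp (p2 * y + \<alpha> / 2 * y\<^sup>2)))" for x y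
      unfolding f_def E_def p1_def p2_def ennreal_mult[symmetric, OF exp_ge_zero exp_ge_zero] exp_add[symmetric] 
        ennreal_mult[symmetric, OF exp_ge_zero mult_nonneg_nonneg, OF exp_ge_zero exp_ge_zero]
      by (intro arg_cong[where f="\<lambda>x. ennreal (exp x)"]) (simp add: power2_eq_square field_simps)
    have [measurable]: "(\<lambda>y. ennreal (exp (p * y + \<alpha> / 2 * y\<^sup>2))) \<in> borel_measurable borel" for p by measurable
    have g: "(\<integral>\<^sup>+y. n y * ennreal (exp (p * y + \<alpha> / 2 * y\<^sup>2)) \<partial>lborel) = ennreal (1 / sqrt q * exp (\<delta> * p\<^sup>2 / (2 * q)))" for p
      unfolding n_def q_def by (rule nn_integral_exp_quadratic_normal[OF \<delta>])
    have "(\<integral>\<^sup>+x. n x * (\<integral>\<^sup>+y. n y * f ((s, a, b), (x, y)) \<partial>lborel) \<partial>lborel) =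
      (\<integral>\<^sup>+x. ennreal E * ((n x * ennreal (exp (p1 * x + \<alpha> / 2 * x\<^sup>2))) *
        (\<integral>\<^sup>+y. n y * ennreal (exp (p2 * y + \<alpha> / 2 * y\<^sup>2)) \<partial>lborel)) \<partial>lborel)"
      unfolding fexp by (simp add: nn_integral_cmult[symmetric] ac_simps)
    also have "\<dots> = ennreal E * (ennreal (1 / sqrt q * exp (\<delta> * p1\<^sup>2 / (2 * q))) * ennreal (1 / sqrt q * exp (\<delta> * p2\<^sup>2 / (2 * q))))"
      unfolding g by (simp add: nn_integral_cmult nn_integral_multc g del: times_divide_eq_right times_divide_eq_left)
    also have "\<dots> = ennreal (E * ((1 / sqrt q * exp (\<delta> * p1\<^sup>2 / (2 * q))) * (1 / sqrt q * exp (\<delta> * p2\<^sup>2 / (2 * q)))))"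
      using q by (subst (1 2) ennreal_mult) (auto simp: E_def)
    also have "E * ((1 / sqrt q * exp (\<delta> * p1\<^sup>2 / (2 * q))) * (1 / sqrt q * exp (\<delta> * p2\<^sup>2 / (2 * q)))) =
      1 / q * exp ((c * s + \<alpha> / 2 * (a\<^sup>2 + b\<^sup>2)) + (\<delta> * p1\<^sup>2 / (2 * q) + \<delta> * p2\<^sup>2 / (2 * q)))"
      using q by (simp add: E_def exp_add)
    also have "(c * s + \<alpha> / 2 * (a\<^sup>2 + b\<^sup>2)) + (\<delta> * p1\<^sup>2 / (2 * q) + \<delta> * p2\<^sup>2 / (2 * q)) =
      c * s + (\<alpha> + \<delta> * (\<alpha>\<^sup>2 + c\<^sup>2 / 4) / q) / 2 * (a\<^sup>2 + b\<^sup>2)"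
      using q by (simp add: p1_def p2_def field_simps power2_eq_square)
    finally show ?thesis using q by (subst ennreal_mult[symmetric]) simp_all
  qed
  have "(\<integral>\<^sup>+\<omega>. f (?U \<omega>, (W1 v \<omega> - W1 u \<omega>, W2 v \<omega> - W2 u \<omega>)) \<partial>M) =
    (\<integral>\<^sup>+\<omega>. (\<integral>\<^sup>+x. n x * (\<integral>\<^sup>+y. n y * f (?U \<omega>, (x, y)) \<partial>lborel) \<partial>lborel) \<partial>M)"
    unfolding n_def \<delta>_def by (rule nn_integral_past_increment[OF uv U f])
  also have "\<dots> = (\<integral>\<^sup>+\<omega>. ennreal (1 / q) * ennreal (exp (c * S \<omega> + (\<alpha> + \<delta> * (\<alpha>\<^sup>2 + c\<^sup>2 / 4) / q) / 2 * ((X \<omega>)\<^sup>2 + (Y \<omega>)\<^sup>2))) \<partial>M)"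
    unfolding key ..
  also have "\<dots> = ennreal (1 / q) * (\<integral>\<^sup>+\<omega>. ennreal (exp (c * S \<omega> + (\<alpha> + \<delta> * (\<alpha>\<^sup>2 + c\<^sup>2 / 4) / q) / 2 * ((X \<omega>)\<^sup>2 + (Y \<omega>)\<^sup>2))) \<partial>M)"
  proof (rule nn_integral_cmult)
    have [measurable]: "S \<in> borel_measurable M" "X \<in> borel_measurable M" "Y \<in> borel_measurable M"
      using meas measurable_mono[of borel borel "F u" M] sets_F_le[of u] by auto
    show "(\<lambda>\<omega>. ennreal (exp (c * S \<omega> + (\<alpha> + \<delta> * (\<alpha>\<^sup>2 + c\<^sup>2 / 4) / q) / 2 * ((X \<omega>)\<^sup>2 + (Y \<omega>)\<^sup>2)))) \<in> borel_measurable M"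
      by measurable
  qed
  finally show ?thesis by (simp add: f_def q_def)
qed

end

text \<open>All angles involved stay strictly between -pi / 2 and pi / 2, so the cosines are
  positive. The first identity gives the normalising factor of one integration step, the second
  advances the angle by \<epsilon>.\<close>

lemma tan_multiple_addition:
  fixes \<epsilon> :: real
  assumes "\<bar>real (Suc j) * \<epsilon>\<bar> < pi / 2"
  shows "0 < cos (real j * \<epsilon>)" "0 < cos (real (Suc j) * \<epsilon>)" "0 < cos \<epsilon>"
    "1 - tan (real j * \<epsilon>) * tan \<epsilon> = cos (real (Suc j) * \<epsilon>) / (cos (real j * \<epsilon>) * cos \<epsilon>)"
    "(tan (real j * \<epsilon>) + tan \<epsilon>) / (1 - tan (real j * \<epsilon>) * tan \<epsilon>) = tan (real (Suc j) * \<epsilon>)"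
proof -
  have pos: "0 < cos (real i * \<epsilon>)" if "i \<le> Suc j" for i
  proof (rule cos_gt_zero_pi)
    have "\<bar>real i * \<epsilon>\<bar> \<le> \<bar>real (Suc j) * \<epsilon>\<bar>" unfolding abs_mult using that by (intro mult_right_mono) auto
    then show "- (pi / 2) < real i * \<epsilon>" "real i * \<epsilon> < pi / 2" using assms by linarith+
  qed
  show p: "0 < cos (real j * \<epsilon>)" "0 < cos (real (Suc j) * \<epsilon>)" "0 < cos \<epsilon>"
    using pos[of j] pos[of "Suc j"] pos[of 1] by simp_all
  have s: "real (Suc j) * \<epsilon> = real j * \<epsilon> + \<epsilon>" by (simp add: algebra_simps)
  show c: "1 - tan (real j * \<epsilon>) * tan \<epsilon> = cos (real (Suc j) * \<epsilon>) / (cos (real j * \<epsilon>) * cos \<epsilon>)"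
    unfolding s cos_add tan_def using p by (simp add: field_simps)
  show "(tan (real j * \<epsilon>) + tan \<epsilon>) / (1 - tan (real j * \<epsilon>) * tan \<epsilon>) = tan (real (Suc j) * \<epsilon>)"
    unfolding s using p(1,3) p(2)[unfolded s] by (intro tan_add[symmetric]) auto
qed

section \<open>Laplace transform and variance of the discretised area\<close>

context brownian_pair
begin

definition grid :: "real \<Rightarrow> nat \<Rightarrow> nat \<Rightarrow> real" where
  "grid T N i = T * real i / Suc N"

text \<open>\<open>k\<close> counts the steps taken on a grid of \<open>Suc N\<close> steps, so
  \<open>k = Suc N\<close> covers the whole interval. Partial areas are kept because both the
  backward recursion and the variance computation run through them.\<close>

definition discrete_area :: "real \<Rightarrow> nat \<Rightarrow> nat \<Rightarrow> 'a \<Rightarrow> real" where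
  "discrete_area T N k \<omega> = (\<Sum>i<k. 1/2 *
    (W1 (grid T N i) \<omega> * (W2 (grid T N (Suc i)) \<omega> - W2 (grid T N i) \<omega>) -
     W2 (grid T N i) \<omega> * (W1 (grid T N (Suc i)) \<omega> - W1 (grid T N i) \<omega>)))"

lemma grid:
  assumes "0 < T"
  shows "0 \<le> grid T N i" "grid T N i < grid T N (Suc i)" "grid T N (Suc i) - grid T N i = T / Suc N"
    "i \<le> j \<Longrightarrow> grid T N i \<le> grid T N j" "grid T N 0 = 0"
  using assms by (auto simp: grid_def divide_strict_right_mono divide_right_mono diff_divide_distrib[symmetric] algebra_simps)

lemma discrete_area_adapted:
  assumes T: "0 < T"
  shows "discrete_area T N k \<in> borel_measurable (F (grid T N k))"
  unfolding discrete_area_def using grid(1,4)[OF T]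
  by (intro borel_measurable_sum borel_measurable_times borel_measurable_diff borel_measurable_const W_adapted) auto

lemma grid_state_adapted:
  assumes T: "0 < T"
  shows "W1 (grid T N k) \<in> borel_measurable (F (grid T N k))" "W2 (grid T N k) \<in> borel_measurable (F (grid T N k))"
  using grid[OF T] by (auto intro!: W_adapted)

text \<open>
  The coefficient \<open>\<alpha>\<close> of the quadratic weight evolves by
  \<open>\<alpha> \<mapsto> (\<alpha> + \<delta> c\<^sup>2 / 4) / (1 - \<alpha> \<delta>)\<close>, which the substitution
  \<open>\<alpha> = c / 2 * tan \<phi>\<close>, \<open>c \<delta> / 2 = tan \<epsilon>\<close> turns into \<open>\<phi> \<mapsto> \<phi> + \<epsilon>\<close>.
\<close>

lemma discrete_area_exp_recursion:
  fixes c T :: real and N k j :: nat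
  assumes T: "0 < T"
  defines "\<epsilon> \<equiv> arctan (c * T / (2 * real (Suc N)))"
  defines "\<Phi> \<equiv> \<lambda>k j. \<integral>\<^sup>+\<omega>. ennreal (exp (c * discrete_area T N k \<omega> +
    (c / 2 * tan (real j * \<epsilon>)) / 2 * ((W1 (grid T N k) \<omega>)\<^sup>2 + (W2 (grid T N k) \<omega>)\<^sup>2))) \<partial>M"
  assumes j: "\<bar>real (Suc j) * \<epsilon>\<bar> < pi / 2"
  shows "\<Phi> (Suc k) j = ennreal (cos (real j * \<epsilon>) * cos \<epsilon> / cos (real (Suc j) * \<epsilon>)) * \<Phi> k (Suc j)"
proof -
  define \<delta> where "\<delta> = T / Suc N"
  define \<alpha> where "\<alpha> = c / 2 * tan (real j * \<epsilon>)"
  note ca = tan_multiple_addition[OF j]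
  have te: "tan \<epsilon> = \<delta> * c / 2" by (simp add: \<epsilon>_def \<delta>_def tan_arctan mult.commute)
  have \<alpha>\<delta>: "\<alpha> * \<delta> = tan (real j * \<epsilon>) * tan \<epsilon>" by (simp add: \<alpha>_def te)
  have q: "1 - \<alpha> * \<delta> = cos (real (Suc j) * \<epsilon>) / (cos (real j * \<epsilon>) * cos \<epsilon>)" unfolding \<alpha>\<delta> by (rule ca)
  have q0: "0 < 1 - \<alpha> * \<delta>" unfolding q using ca by simp
  have \<delta>g: "grid T N (Suc k) - grid T N k = \<delta>" using grid[OF T] by (simp add: \<delta>_def)
  \<comment> \<open>The terms in \<alpha>^2 cancel over the common denominator, which leaves the
    quotient of the tangent addition formula.\<close>
  have "\<alpha> + \<delta> * (\<alpha>\<^sup>2 + c\<^sup>2 / 4) / (1 - \<alpha> * \<delta>) = (\<alpha> + \<delta> * c\<^sup>2 / 4) / (1 - \<alpha> * \<delta>)"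
    using q0 by (simp add: field_simps power2_eq_square)
  also have "\<alpha> + \<delta> * c\<^sup>2 / 4 = c / 2 * (tan (real j * \<epsilon>) + tan \<epsilon>)"
    unfolding te \<alpha>_def by (simp add: algebra_simps power2_eq_square)
  also have "c / 2 * (tan (real j * \<epsilon>) + tan \<epsilon>) / (1 - \<alpha> * \<delta>) = c / 2 * tan (real (Suc j) * \<epsilon>)"
    unfolding \<alpha>\<delta> ca(5)[symmetric] by simp
  finally have \<alpha>': "\<alpha> + \<delta> * (\<alpha>\<^sup>2 + c\<^sup>2 / 4) / (1 - \<alpha> * \<delta>) = c / 2 * tan (real (Suc j) * \<epsilon>)" .
  have "\<Phi> (Suc k) j = (\<integral>\<^sup>+\<omega>. ennreal (exp (c * (discrete_area T N k \<omega> + 1/2 *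
      (W1 (grid T N k) \<omega> * (W2 (grid T N (Suc k)) \<omega> - W2 (grid T N k) \<omega>) -
       W2 (grid T N k) \<omega> * (W1 (grid T N (Suc k)) \<omega> - W1 (grid T N k) \<omega>))) +
      \<alpha> / 2 * ((W1 (grid T N k) \<omega> + (W1 (grid T N (Suc k)) \<omega> - W1 (grid T N k) \<omega>))\<^sup>2 +
       (W2 (grid T N k) \<omega> + (W2 (grid T N (Suc k)) \<omega> - W2 (grid T N k) \<omega>))\<^sup>2))) \<partial>M)"
    by (simp add: \<Phi>_def \<alpha>_def discrete_area_def)
  also have "\<dots> = ennreal (1 / (1 - \<alpha> * \<delta>)) * (\<integral>\<^sup>+\<omega>. ennreal (exp (c * discrete_area T N k \<omega> +
      (\<alpha> + \<delta> * (\<alpha>\<^sup>2 + c\<^sup>2 / 4) / (1 - \<alpha> * \<delta>)) / 2 * ((W1 (grid T N k) \<omega>)\<^sup>2 + (W2 (grid T N k) \<omega>)\<^sup>2))) \<partial>M)"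
    using exp_quadratic_step[OF grid(1)[OF T, of N k] grid(2)[OF T] discrete_area_adapted[OF T] grid_state_adapted[OF T], of \<alpha> c] q0
    unfolding \<delta>g by simp
  also have "\<dots> = ennreal (1 / (1 - \<alpha> * \<delta>)) * \<Phi> k (Suc j)" unfolding \<alpha>' \<Phi>_def ..
  also have "1 / (1 - \<alpha> * \<delta>) = cos (real j * \<epsilon>) * cos \<epsilon> / cos (real (Suc j) * \<epsilon>)" unfolding q by simp
  finally show ?thesis .
qed

lemma abs_arctan_le: "\<bar>arctan x\<bar> \<le> \<bar>x\<bar>"
  using arctan_le_self[of x] arctan_le_self[of "-x"] by (cases "0 \<le> x") (auto simp: arctan_minus)

text \<open>The recursion starts at the final time with zero weight, that is angle 0, and removes
  the increments backwards. Each step adds \<epsilon> to the angle, and the normalising factors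
  telescope. In the result the numerator \<open>cos \<epsilon> ^ Suc N\<close> is at most 1, and the
  final angle is at most |c| T / 2 in modulus because |arctan x| \<le> |x|; hence the bound is
  uniform in \<open>N\<close>.\<close>

lemma discrete_area_mgf:
  assumes T: "0 < T" and c: "\<bar>c\<bar> * T < pi"
  shows "(\<integral>\<^sup>+\<omega>. ennreal (exp (c * discrete_area T N (Suc N) \<omega>)) \<partial>M) \<le> ennreal (1 / cos (c * T / 2))"
proof -
  define \<epsilon> where "\<epsilon> = arctan (c * T / (2 * real (Suc N)))"
  define \<Phi> where "\<Phi> = (\<lambda>k j. \<integral>\<^sup>+\<omega>. ennreal (exp (c * discrete_area T N k \<omega> +
    (c / 2 * tan (real j * \<epsilon>)) / 2 * ((W1 (grid T N k) \<omega>)\<^sup>2 + (W2 (grid T N k) \<omega>)\<^sup>2))) \<partial>M)"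
  have "\<bar>\<epsilon>\<bar> \<le> \<bar>c * T / (2 * real (Suc N))\<bar>" unfolding \<epsilon>_def by (rule abs_arctan_le)
  then have "real (Suc N) * \<bar>\<epsilon>\<bar> \<le> real (Suc N) * \<bar>c * T / (2 * real (Suc N))\<bar>" by (intro mult_left_mono) auto
  also have "\<dots> = \<bar>c * T / 2\<bar>" by (simp add: abs_mult field_simps del: of_nat_Suc)
  finally have N\<epsilon>: "\<bar>real (Suc N) * \<epsilon>\<bar> \<le> \<bar>c * T / 2\<bar>" by (simp add: abs_mult del: of_nat_Suc)
  have cT: "\<bar>c * T / 2\<bar> < pi / 2" using c T by (simp add: abs_mult)
  have jle: "\<bar>real j * \<epsilon>\<bar> < pi / 2" if "j \<le> Suc N" for j
  proof -
    have "\<bar>real j * \<epsilon>\<bar> \<le> \<bar>real (Suc N) * \<epsilon>\<bar>" unfolding abs_mult using that by (intro mult_right_mono) auto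
    then show ?thesis using N\<epsilon> cT by linarith
  qed
  have rec: "\<Phi> (Suc N) 0 = ennreal (cos \<epsilon> ^ j / cos (real j * \<epsilon>)) * \<Phi> (Suc N - j) j" if "j \<le> Suc N" for j
    using that
  proof (induction j)
    case (Suc j)
    have jS: "\<bar>real (Suc j) * \<epsilon>\<bar> < pi / 2" using jle[OF Suc.prems] .
    note ca = tan_multiple_addition[OF jS]
    have "\<Phi> (Suc (N - j)) j = ennreal (cos (real j * \<epsilon>) * cos \<epsilon> / cos (real (Suc j) * \<epsilon>)) * \<Phi> (N - j) (Suc j)"
      unfolding \<Phi>_def \<epsilon>_def by (rule discrete_area_exp_recursion[OF T]) (use jS in \<open>simp add: \<epsilon>_def\<close>)
    moreover have "Suc N - j = Suc (N - j)" using Suc.prems by simp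
    ultimately have "\<Phi> (Suc N) 0 = ennreal (cos \<epsilon> ^ j / cos (real j * \<epsilon>)) *
       (ennreal (cos (real j * \<epsilon>) * cos \<epsilon> / cos (real (Suc j) * \<epsilon>)) * \<Phi> (N - j) (Suc j))"
      using Suc by simp
    also have "\<dots> = ennreal ((cos \<epsilon> ^ j / cos (real j * \<epsilon>)) * (cos (real j * \<epsilon>) * cos \<epsilon> / cos (real (Suc j) * \<epsilon>))) * \<Phi> (N - j) (Suc j)"
      using ca by (subst ennreal_mult) (auto simp: mult.assoc)
    also have "(cos \<epsilon> ^ j / cos (real j * \<epsilon>)) * (cos (real j * \<epsilon>) * cos \<epsilon> / cos (real (Suc j) * \<epsilon>)) = cos \<epsilon> ^ Suc j / cos (real (Suc j) * \<epsilon>)"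
      using ca(1,2) by simp
    finally show ?case by simp
  qed simp
  have "(\<integral>\<^sup>+\<omega>. ennreal (exp (c * discrete_area T N (Suc N) \<omega>)) \<partial>M) = \<Phi> (Suc N) 0" by (simp add: \<Phi>_def)
  also have "\<dots> = ennreal (cos \<epsilon> ^ Suc N / cos (real (Suc N) * \<epsilon>)) * \<Phi> 0 (Suc N)" using rec[of "Suc N"] by simp
  \<comment> \<open>Both motions start at the origin almost surely, so whatever weight has
    accumulated disappears.\<close>
  also have "\<Phi> 0 (Suc N) = (\<integral>\<^sup>+\<omega>. 1 \<partial>M)"
    unfolding \<Phi>_def
  proof (rule nn_integral_cong_AE)
    show "AE \<omega> in M. ennreal (exp (c * discrete_area T N 0 \<omega> +
      (c / 2 * tan (real (Suc N) * \<epsilon>)) / 2 * ((W1 (grid T N 0) \<omega>)\<^sup>2 + (W2 (grid T N 0) \<omega>)\<^sup>2))) = 1"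
      using W_zero by eventually_elim (simp add: discrete_area_def grid_def)
  qed
  also have "\<dots> = 1" by (simp add: emeasure_space_1)
  also have "ennreal (cos \<epsilon> ^ Suc N / cos (real (Suc N) * \<epsilon>)) * 1 \<le> ennreal (1 / cos (c * T / 2))"
  proof -
    have c0: "0 < cos (c * T / 2)" using cT by (intro cos_gt_zero_pi) linarith+
    have "cos \<bar>c * T / 2\<bar> \<le> cos \<bar>real (Suc N) * \<epsilon>\<bar>"
      by (rule cos_monotone_0_pi_le) (use N\<epsilon> cT in auto)
    then have le: "cos (c * T / 2) \<le> cos (real (Suc N) * \<epsilon>)" by (simp only: cos_abs_real)
    have ce: "0 \<le> cos \<epsilon>" using jle[of 1] by (intro cos_ge_zero) auto
    have "cos \<epsilon> ^ Suc N \<le> 1" by (rule power_le_one[OF ce]) simp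
    then have "cos \<epsilon> ^ Suc N / cos (real (Suc N) * \<epsilon>) \<le> 1 / cos (c * T / 2)"
      using le c0 ce by (intro frac_le) auto
    then show ?thesis by (simp add: ennreal_leI del: power_Suc of_nat_Suc)
  qed
  finally show ?thesis .
qed

lemma W_L2:
  assumes "0 \<le> t"
  shows "square_integrable M (F t) (W1 t)" "square_integrable M (F t) (W2 t)"
    "expectation (\<lambda>\<omega>. (W1 t \<omega>)\<^sup>2) = t" "expectation (\<lambda>\<omega>. (W2 t \<omega>)\<^sup>2) = t"
proof -
  note m = W_measurable[OF assms] W_measurable[of 0]
  have e: "AE \<omega> in M. (W1 t \<omega> - W1 0 \<omega>)\<^sup>2 = (W1 t \<omega>)\<^sup>2" "AE \<omega> in M. (W2 t \<omega> - W2 0 \<omega>)\<^sup>2 = (W2 t \<omega>)\<^sup>2"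
    using W_zero by (eventually_elim, simp)+
  have i: "integrable M (\<lambda>\<omega>. (W1 t \<omega>)\<^sup>2)" "integrable M (\<lambda>\<omega>. (W2 t \<omega>)\<^sup>2)"
    using normal_increment_moments(2)[OF brownian(1), of 0 t] normal_increment_moments(2)[OF brownian(2), of 0 t]
      integrable_cong_AE[OF _ _ e(1)] integrable_cong_AE[OF _ _ e(2)] assms m by auto
  show "square_integrable M (F t) (W1 t)" "square_integrable M (F t) (W2 t)"
    using i W_adapted[of t t] assms by (auto simp: square_integrable_def)
  show "expectation (\<lambda>\<omega>. (W1 t \<omega>)\<^sup>2) = t" "expectation (\<lambda>\<omega>. (W2 t \<omega>)\<^sup>2) = t"
    using normal_increment_moments(4)[OF brownian(1), of 0 t] normal_increment_moments(4)[OF brownian(2), of 0 t]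
      integral_cong_AE[OF _ _ e(1)] integral_cong_AE[OF _ _ e(2)] assms m by auto
qed

text \<open>All mixed terms vanish: those of \<open>S\<close> with a new term carry a centred
  increment independent of the past, and the product of the two new terms carries the product of two
  independent centred increments. The two squares contribute \<open>u * (v - u)\<close> each, with
  weight 1/4.\<close>

lemma expectation_area_step:
  assumes uv: "0 \<le> u" "u \<le> v" and S: "square_integrable M (F u) S"
  defines "D \<equiv> \<lambda>\<omega>. 1/2 * (W1 u \<omega> * (W2 v \<omega> - W2 u \<omega>) - W2 u \<omega> * (W1 v \<omega> - W1 u \<omega>))"
  shows "square_integrable M (F v) (\<lambda>\<omega>. S \<omega> + D \<omega>)"
    "expectation (\<lambda>\<omega>. (S \<omega> + D \<omega>)\<^sup>2) = expectation (\<lambda>\<omega>. (S \<omega>)\<^sup>2) + u * (v - u) / 2"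
proof -
  interpret B1: filtered_brownian M F W1 by (rule filtered_brownian_W1)
  interpret B2: filtered_brownian M F W2 by (rule filtered_brownian_W2)
  let ?P = "\<lambda>\<omega>. W1 u \<omega> * (W2 v \<omega> - W2 u \<omega>)" and ?Q = "\<lambda>\<omega>. W2 u \<omega> * (W1 v \<omega> - W1 u \<omega>)"
  note W = W_L2[OF uv(1)]
  have P: "square_integrable M (F v) ?P" and Q: "square_integrable M (F v) ?Q"
    using B2.L2_times_increment[OF uv W(1)] B1.L2_times_increment[OF uv W(2)] by auto
  have Sv: "square_integrable M (F v) S" using B1.L2_mono[OF uv(2) S] .
  note L2 = B1.L2_integrable_mult
  note ints = L2[OF Sv P] L2[OF Sv Q] L2[OF P Q] L2[OF P P] L2[OF Q Q] L2[OF Sv Sv]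
  have exp: "(\<lambda>\<omega>. (S \<omega> + D \<omega>)\<^sup>2) = (\<lambda>\<omega>. S \<omega> * S \<omega> + S \<omega> * ?P \<omega> - S \<omega> * ?Q \<omega> + 1/4 * (?P \<omega> * ?P \<omega>) + 1/4 * (?Q \<omega> * ?Q \<omega>) - 1/2 * (?P \<omega> * ?Q \<omega>))"
    by (rule ext) (simp add: D_def power2_eq_square field_simps)
  have int: "integrable M (\<lambda>\<omega>. (S \<omega> + D \<omega>)\<^sup>2)"
    unfolding exp by (intro Bochner_Integration.integrable_add Bochner_Integration.integrable_diff integrable_mult_right ints)
  show "square_integrable M (F v) (\<lambda>\<omega>. S \<omega> + D \<omega>)"
    using int Sv P Q unfolding square_integrable_def D_def
    by (auto intro!: borel_measurable_add borel_measurable_diff borel_measurable_times[OF borel_measurable_const])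
  have m: "S \<in> borel_measurable (F u)" "W1 u \<in> borel_measurable (F u)" "W2 u \<in> borel_measurable (F u)"
    using S W by (auto simp: square_integrable_def)
  have SP: "expectation (\<lambda>\<omega>. S \<omega> * ?P \<omega>) = 0"
    using B2.integrable_times_increment(2)[OF uv borel_measurable_times[OF m(1,2)] L2[OF S W(1)]] by (simp add: mult.assoc)
  have SQ: "expectation (\<lambda>\<omega>. S \<omega> * ?Q \<omega>) = 0"
    using B1.integrable_times_increment(2)[OF uv borel_measurable_times[OF m(1,3)] L2[OF S W(2)]] by (simp add: mult.assoc)
  have PP: "expectation (\<lambda>\<omega>. ?P \<omega> * ?P \<omega>) = u * (v - u)"
    using B2.integrable_times_increment_square(2)[OF uv borel_measurable_power[OF m(2), of 2]] W
    by (simp add: square_integrable_def power2_eq_square ac_simps)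
  have QQ: "expectation (\<lambda>\<omega>. ?Q \<omega> * ?Q \<omega>) = u * (v - u)"
    using B1.integrable_times_increment_square(2)[OF uv borel_measurable_power[OF m(3), of 2]] W
    by (simp add: square_integrable_def power2_eq_square ac_simps)
  have PQ: "expectation (\<lambda>\<omega>. ?P \<omega> * ?Q \<omega>) = 0"
  proof -
    let ?V = "\<lambda>\<omega>. (W1 v \<omega> - W1 u \<omega>) * (W2 v \<omega> - W2 u \<omega>)"
    note iv = increment_indep_of_past(3)[OF uv borel_measurable_times[OF m(2,3)]]
    have V: "integrable M ?V" "expectation ?V = 0"
      using indep_var_integrable[OF indep_increments_cross[OF uv]] indep_var_lebesgue_integral[OF indep_increments_cross[OF uv]]
        B1.integrable_increment[OF uv] B2.integrable_increment[OF uv] B1.increment_mean[OF uv] by auto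
    have "expectation (\<lambda>\<omega>. (W1 u \<omega> * W2 u \<omega>) * ?V \<omega>) = 0"
      using indep_var_lebesgue_integral[OF iv L2[OF W(1,2)] V(1)] V(2) by simp
    moreover have "(\<lambda>\<omega>. (W1 u \<omega> * W2 u \<omega>) * ?V \<omega>) = (\<lambda>\<omega>. ?P \<omega> * ?Q \<omega>)" by (auto simp: ac_simps)
    ultimately show ?thesis by simp
  qed
  show "expectation (\<lambda>\<omega>. (S \<omega> + D \<omega>)\<^sup>2) = expectation (\<lambda>\<omega>. (S \<omega>)\<^sup>2) + u * (v - u) / 2"
    unfolding exp using ints SP SQ PP QQ PQ by (simp add: power2_eq_square)
qed

text \<open>The step contributions \<open>u * (v - u) / 2\<close> at the grid points form an
  arithmetic series.\<close>

lemma discrete_area_L2: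
  assumes T: "0 < T"
  shows "square_integrable M (F (grid T N k)) (discrete_area T N k) \<and>
    expectation (\<lambda>\<omega>. (discrete_area T N k \<omega>)\<^sup>2) = T\<^sup>2 * (real k * (real k - 1)) / (4 * (real (Suc N))\<^sup>2)"
proof (induction k)
  case 0
  show ?case by (simp add: discrete_area_def square_integrable_def)
next
  case (Suc k)
  have D: "discrete_area T N (Suc k) = (\<lambda>\<omega>. discrete_area T N k \<omega> + 1/2 *
    (W1 (grid T N k) \<omega> * (W2 (grid T N (Suc k)) \<omega> - W2 (grid T N k) \<omega>) -
     W2 (grid T N k) \<omega> * (W1 (grid T N (Suc k)) \<omega> - W1 (grid T N k) \<omega>)))"
    by (simp add: discrete_area_def fun_eq_iff)
  note st = expectation_area_step[OF grid(1)[OF T] less_imp_le[OF grid(2)[OF T]] conjunct1[OF Suc.IH]]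
  have "T\<^sup>2 * (real k * (real k - 1)) / (4 * (real (Suc N))\<^sup>2) + grid T N k * (grid T N (Suc k) - grid T N k) / 2 =
    T\<^sup>2 * (real (Suc k) * (real (Suc k) - 1)) / (4 * (real (Suc N))\<^sup>2)"
  proof -
    have "T\<^sup>2 * (real k * (real k - 1)) / (4 * n\<^sup>2) + (T * real k / n) * (T / n) / 2 =
      T\<^sup>2 * ((real k + 1) * real k) / (4 * n\<^sup>2)" if "0 < n" for n :: real
      using that by (simp add: field_simps power2_eq_square)
    from this[of "real (Suc N)"] show ?thesis unfolding grid(3)[OF T] by (simp add: grid_def add.commute)
  qed
  then show ?case using st conjunct2[OF Suc.IH] unfolding D by simp
qed

text \<open>The factor 1/2 of the area squares to 1/4, which offsets the factor 2 of splitting the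
  square and the presence of two integrals. The error bound for a single integral survives
  unchanged.\<close>

lemma discrete_area_L2_dist:
  assumes T: "0 < T" and S: "levy_area M T W1 W2 S"
  shows "(\<integral>\<^sup>+\<omega>. ennreal ((discrete_area T N (Suc N) \<omega> - S \<omega>)\<^sup>2) \<partial>M) \<le> 4 * ennreal (T\<^sup>2 / Suc N)"
proof -
  interpret B1: filtered_brownian M F W1 by (rule filtered_brownian_W1)
  interpret B2: filtered_brownian M F W2 by (rule filtered_brownian_W2)
  from S obtain I J where I: "has_ito_integral M F T W2 W1 I" and J: "has_ito_integral M F T W1 W2 J"
    and SIJ: "AE \<omega> in M. S \<omega> = 1 / 2 * (I \<omega> - J \<omega>)"
    by (auto simp: levy_area_def Let_def)
  have [measurable]: "I \<in> borel_measurable M" "J \<in> borel_measurable M"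
    using I J by (auto simp: has_ito_integral_def)
  let ?g = "grid T N"
  define P where "P \<omega> = (\<Sum>i<Suc N. W1 (?g i) \<omega> * (W2 (?g (Suc i)) \<omega> - W2 (?g i) \<omega>))" for \<omega>
  define Q where "Q \<omega> = (\<Sum>i<Suc N. W2 (?g i) \<omega> * (W1 (?g (Suc i)) \<omega> - W1 (?g i) \<omega>))" for \<omega>
  have DPQ: "discrete_area T N (Suc N) \<omega> = 1/2 * P \<omega> - 1/2 * Q \<omega>" for \<omega>
    by (simp add: discrete_area_def P_def Q_def sum_distrib_left sum_subtractf[symmetric] algebra_simps del: sum.lessThan_Suc)
  have incr: "(\<integral>\<^sup>+\<omega>. ennreal ((W v \<omega> - W u \<omega>)\<^sup>2) \<partial>M) \<le> ennreal (v - u)"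
    if "brownian_motion M W" "0 \<le> u" "u \<le> v" for W u v
    using normal_increment_moments(2,4)[OF that] by (subst nn_integral_eq_integral) auto
  have dP: "(\<integral>\<^sup>+\<omega>. ennreal ((P \<omega> - I \<omega>)\<^sup>2) \<partial>M) \<le> 4 * ennreal (T\<^sup>2 / Suc N)"
    unfolding P_def grid_def by (rule B2.ito_integral_Riemann_sums[OF T I]) (use W_L2 incr[OF brownian(1)] in auto)
  have dQ: "(\<integral>\<^sup>+\<omega>. ennreal ((Q \<omega> - J \<omega>)\<^sup>2) \<partial>M) \<le> 4 * ennreal (T\<^sup>2 / Suc N)"
    unfolding Q_def grid_def by (rule B1.ito_integral_Riemann_sums[OF T J]) (use W_L2 incr[OF brownian(2)] in auto)
  have [measurable]: "P \<in> borel_measurable M" "Q \<in> borel_measurable M"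
    unfolding P_def[abs_def] Q_def[abs_def] using grid(1)[OF T, of N] W_measurable
    by (auto intro!: borel_measurable_sum borel_measurable_times borel_measurable_diff simp del: sum.lessThan_Suc)
  have half: "(\<integral>\<^sup>+\<omega>. ennreal ((1/2 * (f \<omega>))\<^sup>2) \<partial>M) = ennreal (1/4) * (\<integral>\<^sup>+\<omega>. ennreal ((f \<omega>)\<^sup>2) \<partial>M)"
    if "f \<in> borel_measurable M" for f :: "'a \<Rightarrow> real"
    using that by (subst nn_integral_cmult[symmetric]) (auto simp: ennreal_mult'[symmetric] power_divide)
  have "(\<integral>\<^sup>+\<omega>. ennreal ((discrete_area T N (Suc N) \<omega> - S \<omega>)\<^sup>2) \<partial>M) =
    (\<integral>\<^sup>+\<omega>. ennreal ((1/2 * (P \<omega> - I \<omega>) + 1/2 * (J \<omega> - Q \<omega>))\<^sup>2) \<partial>M)"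
  proof (rule nn_integral_cong_AE, use SIJ in eventually_elim)
    fix \<omega> assume "S \<omega> = 1/2 * (I \<omega> - J \<omega>)"
    then show "ennreal ((discrete_area T N (Suc N) \<omega> - S \<omega>)\<^sup>2) =
      ennreal ((1/2 * (P \<omega> - I \<omega>) + 1/2 * (J \<omega> - Q \<omega>))\<^sup>2)"
      by (intro arg_cong[where f="\<lambda>x. ennreal (x\<^sup>2)"]) (simp add: DPQ field_simps)
  qed
  also have "\<dots> \<le> 2 * (\<integral>\<^sup>+\<omega>. ennreal ((1/2 * (P \<omega> - I \<omega>))\<^sup>2) \<partial>M) + 2 * (\<integral>\<^sup>+\<omega>. ennreal ((1/2 * (J \<omega> - Q \<omega>))\<^sup>2) \<partial>M)"
    by (rule nn_integral_square_add_le) auto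
  also have "\<dots> = 2 * (ennreal (1/4) * (\<integral>\<^sup>+\<omega>. ennreal ((P \<omega> - I \<omega>)\<^sup>2) \<partial>M)) + 2 * (ennreal (1/4) * (\<integral>\<^sup>+\<omega>. ennreal ((Q \<omega> - J \<omega>)\<^sup>2) \<partial>M))"
    by (subst (1 2) half) (auto simp: power2_commute)
  also have "\<dots> \<le> 2 * (ennreal (1/4) * (4 * ennreal (T\<^sup>2 / Suc N))) + 2 * (ennreal (1/4) * (4 * ennreal (T\<^sup>2 / Suc N)))"
    by (intro add_mono mult_left_mono dP dQ) auto
  also have "\<dots> = 4 * ennreal (T\<^sup>2 / Suc N)"
  proof -
    have "ennreal (1/4) * (4 * ennreal (T\<^sup>2 / Suc N)) = ennreal (T\<^sup>2 / Suc N)"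
      by (simp add: ennreal_mult[symmetric] ennreal_numeral[symmetric] del: ennreal_numeral)
    then show ?thesis by (simp add: distrib_right[symmetric])
  qed
  finally show ?thesis .
qed

end

lemma square_add_weighted_le:
  fixes a b \<eta> :: real
  assumes "0 < \<eta>"
  shows "(a + b)\<^sup>2 \<le> (1 + \<eta>) * a\<^sup>2 + (1 + 1 / \<eta>) * b\<^sup>2"
proof -
  have "0 \<le> (\<eta> * a - b)\<^sup>2 / \<eta>" using assms by simp
  also have "\<dots> = \<eta> * a\<^sup>2 - 2 * a * b + b\<^sup>2 / \<eta>" using assms by (simp add: field_simps power2_eq_square)
  finally show ?thesis by (simp add: power2_eq_square algebra_simps)
qed

text \<open>Splitting squares with the factor 2 would determine the limit only up to a constant. The
  weighted form puts \<open>1 + \<eta>\<close> on the main term; the large factor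
  \<open>1 + 1 / \<eta>\<close> multiplies an error that vanishes as \<open>k\<close> grows, and
  only then does \<eta> tend to 0.\<close>

lemma second_moment_of_L2_limit:
  fixes f :: "nat \<Rightarrow> 'a \<Rightarrow> real" and g :: "'a \<Rightarrow> real"
  assumes meas [measurable]: "\<And>k. f k \<in> borel_measurable M" "g \<in> borel_measurable M"
    and int: "\<And>k. integrable M (\<lambda>x. (f k x)\<^sup>2)"
    and dist: "(\<lambda>k. \<integral>\<^sup>+x. ennreal ((f k x - g x)\<^sup>2) \<partial>M) \<longlonglongrightarrow> 0"
    and lim: "(\<lambda>k. \<integral>x. (f k x)\<^sup>2 \<partial>M) \<longlonglongrightarrow> m"
  shows "integrable M (\<lambda>x. (g x)\<^sup>2)" "(\<integral>x. (g x)\<^sup>2 \<partial>M) = m"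
proof -
  have ifg: "(\<integral>\<^sup>+x. ennreal ((f k x)\<^sup>2) \<partial>M) < \<infinity>" for k
    using int[of k] by (simp add: integrable_iff_bounded)
  have "eventually (\<lambda>k. (\<integral>\<^sup>+x. ennreal ((f k x - g x)\<^sup>2) \<partial>M) < 1) sequentially"
    using order_tendstoD(2)[OF dist, of 1] by simp
  then obtain k where k: "(\<integral>\<^sup>+x. ennreal ((f k x - g x)\<^sup>2) \<partial>M) < 1" by (auto simp: eventually_sequentially)
  have "(\<integral>\<^sup>+x. ennreal ((g x)\<^sup>2) \<partial>M) = (\<integral>\<^sup>+x. ennreal ((f k x + (- (f k x - g x)))\<^sup>2) \<partial>M)" by simp
  also have "\<dots> \<le> 2 * (\<integral>\<^sup>+x. ennreal ((f k x)\<^sup>2) \<partial>M) + 2 * (\<integral>\<^sup>+x. ennreal ((- (f k x - g x))\<^sup>2) \<partial>M)"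
    by (rule nn_integral_square_add_le) auto
  also have "\<dots> < \<infinity>"
    using ifg[of k] order.strict_trans[OF k] by (simp add: ennreal_mult_less_top power2_commute)
  finally show ig: "integrable M (\<lambda>x. (g x)\<^sup>2)" by (simp add: integrable_iff_bounded)
  have id: "integrable M (\<lambda>x. (f k x - g x)\<^sup>2)" for k
  proof (rule Bochner_Integration.integrable_bound)
    show "integrable M (\<lambda>x. 2 * (f k x)\<^sup>2 + 2 * (g x)\<^sup>2)" using int ig by auto
    have "(a - b)\<^sup>2 \<le> 2 * a\<^sup>2 + 2 * b\<^sup>2" for a b :: real
      using square_add_weighted_le[of 1 a "-b"] by simp
    then show "AE x in M. norm ((f k x - g x)\<^sup>2) \<le> norm (2 * (f k x)\<^sup>2 + 2 * (g x)\<^sup>2)" by auto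
  qed simp
  define D where "D k = (\<integral>x. (f k x - g x)\<^sup>2 \<partial>M)" for k
  have "(\<integral>\<^sup>+x. ennreal ((f k x - g x)\<^sup>2) \<partial>M) = ennreal (D k)" for k
    unfolding D_def by (rule nn_integral_eq_integral[OF id]) simp
  then have "(\<lambda>k. ennreal (D k)) \<longlonglongrightarrow> ennreal 0" using dist by simp
  then have D: "D \<longlonglongrightarrow> 0" by (subst (asm) tendsto_ennreal_iff) (auto simp: D_def)
  define a where "a = (\<integral>x. (g x)\<^sup>2 \<partial>M)"
  have a0: "0 \<le> a" by (simp add: a_def)
  have m0: "0 \<le> m" by (rule LIMSEQ_le_const[OF lim]) simp
  have *: "a \<le> (1 + \<eta>) * m \<and> m \<le> (1 + \<eta>) * a" if \<eta>: "0 < \<eta>" for \<eta>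
  proof
    have "a \<le> (1 + \<eta>) * (\<integral>x. (f k x)\<^sup>2 \<partial>M) + (1 + 1 / \<eta>) * D k" for k
    proof -
      have "a \<le> (\<integral>x. (1 + \<eta>) * (f k x)\<^sup>2 + (1 + 1 / \<eta>) * (f k x - g x)\<^sup>2 \<partial>M)"
        unfolding a_def
      proof (rule integral_mono[OF ig])
        show "integrable M (\<lambda>x. (1 + \<eta>) * (f k x)\<^sup>2 + (1 + 1 / \<eta>) * (f k x - g x)\<^sup>2)" using int id by auto
        show "(g x)\<^sup>2 \<le> (1 + \<eta>) * (f k x)\<^sup>2 + (1 + 1 / \<eta>) * (f k x - g x)\<^sup>2" for x
          using square_add_weighted_le[OF \<eta>, of "f k x" "- (f k x - g x)"] by (simp add: power2_commute)
      qed
      also have "\<dots> = (1 + \<eta>) * (\<integral>x. (f k x)\<^sup>2 \<partial>M) + (1 + 1 / \<eta>) * D k" using int id by (simp add: D_def)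
      finally show ?thesis .
    qed
    moreover have "(\<lambda>k. (1 + \<eta>) * (\<integral>x. (f k x)\<^sup>2 \<partial>M) + (1 + 1 / \<eta>) * D k) \<longlonglongrightarrow> (1 + \<eta>) * m + (1 + 1 / \<eta>) * 0"
      by (intro tendsto_intros lim D)
    ultimately show "a \<le> (1 + \<eta>) * m" using LIMSEQ_le_const by fastforce
    have "(\<integral>x. (f k x)\<^sup>2 \<partial>M) \<le> (1 + \<eta>) * a + (1 + 1 / \<eta>) * D k" for k
    proof -
      have "(\<integral>x. (f k x)\<^sup>2 \<partial>M) \<le> (\<integral>x. (1 + \<eta>) * (g x)\<^sup>2 + (1 + 1 / \<eta>) * (f k x - g x)\<^sup>2 \<partial>M)"
      proof (rule integral_mono[OF int])
        show "integrable M (\<lambda>x. (1 + \<eta>) * (g x)\<^sup>2 + (1 + 1 / \<eta>) * (f k x - g x)\<^sup>2)" using ig id by auto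
        show "(f k x)\<^sup>2 \<le> (1 + \<eta>) * (g x)\<^sup>2 + (1 + 1 / \<eta>) * (f k x - g x)\<^sup>2" for x
          using square_add_weighted_le[OF \<eta>, of "g x" "f k x - g x"] by simp
      qed
      also have "\<dots> = (1 + \<eta>) * a + (1 + 1 / \<eta>) * D k" using ig id by (simp add: D_def a_def)
      finally show ?thesis .
    qed
    moreover have "(\<lambda>k. (1 + \<eta>) * a + (1 + 1 / \<eta>) * D k) \<longlonglongrightarrow> (1 + \<eta>) * a + (1 + 1 / \<eta>) * 0"
      by (intro tendsto_intros D)
    ultimately have "m \<le> (1 + \<eta>) * a + (1 + 1 / \<eta>) * 0"
      using lim by (intro LIMSEQ_le[OF lim]) auto
    then show "m \<le> (1 + \<eta>) * a" by simp
  qed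
  have eps: "x \<le> y" if "\<And>\<eta>. 0 < \<eta> \<Longrightarrow> x \<le> (1 + \<eta>) * y" "0 \<le> y" for x y :: real
  proof (rule field_le_epsilon)
    fix e :: real assume e: "0 < e"
    have "x \<le> (1 + e / (y + 1)) * y" using that e by (intro that(1)) auto
    also have "\<dots> = y + e * (y / (y + 1))" by (simp add: algebra_simps)
    also have "\<dots> \<le> y + e * 1" using that e by (intro add_left_mono mult_left_mono) auto
    finally show "x \<le> y + e" by simp
  qed
  have "a = m" by (rule antisym) (use eps * a0 m0 in blast)+
  then show "(\<integral>x. (g x)\<^sup>2 \<partial>M) = m" by (simp add: a_def)
qed

lemma cosh_ge_quartic:
  fixes x :: real
  shows "1 + x\<^sup>2 / 2 + x ^ 4 / 24 \<le> cosh x"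
proof -
  define f where "f n = (if even n then x ^ n /\<^sub>R fact n else 0)" for n
  have s: "f sums cosh x" unfolding f_def by (rule cosh_converges)
  have "sum f {..<5} \<le> suminf f"
    using s by (intro sum_le_suminf) (auto simp: f_def sums_iff zero_le_even_power)
  also have "suminf f = cosh x" using s by (simp add: sums_iff)
  also have "sum f {..<5} = 1 + x\<^sup>2 / 2 + x ^ 4 / 24"
  proof -
    have "{..<5} = {0, 1, 2, 3, 4 :: nat}" by auto
    then show ?thesis by (simp add: f_def fact_numeral)
  qed
  finally show ?thesis .
qed

section \<open>Moments of the area as limits of the discretised ones\<close>

context brownian_pair
begin

lemma levy_area_measurable: "levy_area M T W1 W2 S \<Longrightarrow> S \<in> borel_measurable M"
  by (simp add: levy_area_def)

lemma discrete_area_tendsto: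
  assumes T: "0 < T" and S: "levy_area M T W1 W2 S"
  shows "(\<lambda>N. \<integral>\<^sup>+\<omega>. ennreal ((discrete_area T N (Suc N) \<omega> - S \<omega>)\<^sup>2) \<partial>M) \<longlonglongrightarrow> 0"
proof (rule tendsto_sandwich[OF _ _ tendsto_const])
  have "(\<lambda>N. ennreal (T\<^sup>2 / Suc N)) \<longlonglongrightarrow> ennreal 0"
    by (intro tendsto_ennrealI) real_asymp
  then show "(\<lambda>N. 4 * ennreal (T\<^sup>2 / Suc N)) \<longlonglongrightarrow> 0"
    using ennreal_tendsto_cmult[of 4 "\<lambda>N. ennreal (T\<^sup>2 / Suc N)" 0] by simp
  show "\<forall>\<^sub>F N in sequentially. (\<integral>\<^sup>+\<omega>. ennreal ((discrete_area T N (Suc N) \<omega> - S \<omega>)\<^sup>2) \<partial>M) \<le> 4 * ennreal (T\<^sup>2 / Suc N)"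
    using discrete_area_L2_dist[OF T S] by simp
qed simp

lemma discrete_area_square:
  assumes T: "0 < T"
  shows "discrete_area T N k \<in> borel_measurable M" "integrable M (\<lambda>\<omega>. (discrete_area T N k \<omega>)\<^sup>2)"
  using discrete_area_L2[OF T] measurable_F_M[OF discrete_area_adapted[OF T]] by (auto simp: square_integrable_def)

lemma levy_area_second_moment:
  assumes T: "0 < T" and S: "levy_area M T W1 W2 S"
  shows "integrable M (\<lambda>\<omega>. (S \<omega>)\<^sup>2)" "expectation (\<lambda>\<omega>. (S \<omega>)\<^sup>2) = T\<^sup>2 / 4"
proof -
  have "expectation (\<lambda>\<omega>. (discrete_area T N (Suc N) \<omega>)\<^sup>2) = T\<^sup>2 * (real (Suc N) * (real (Suc N) - 1)) / (4 * (real (Suc N))\<^sup>2)" for N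
    using discrete_area_L2[OF T, of N "Suc N"] by blast
  moreover have "(\<lambda>N. T\<^sup>2 * (real (Suc N) * (real (Suc N) - 1)) / (4 * (real (Suc N))\<^sup>2)) \<longlonglongrightarrow> T\<^sup>2 / 4"
    by real_asymp
  ultimately have lim: "(\<lambda>N. expectation (\<lambda>\<omega>. (discrete_area T N (Suc N) \<omega>)\<^sup>2)) \<longlonglongrightarrow> T\<^sup>2 / 4" by simp
  show "integrable M (\<lambda>\<omega>. (S \<omega>)\<^sup>2)" "expectation (\<lambda>\<omega>. (S \<omega>)\<^sup>2) = T\<^sup>2 / 4"
    by (rule second_moment_of_L2_limit[OF discrete_area_square(1)[OF T] levy_area_measurable[OF S]
      discrete_area_square(2)[OF T] discrete_area_tendsto[OF T S] lim])+
qed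

text \<open>Convergence in mean square provides an almost surely convergent subsequence, along which
  Fatou's lemma carries over the bound that is uniform in the grid.\<close>

lemma levy_area_mgf:
  assumes T: "0 < T" and S: "levy_area M T W1 W2 S" and c: "\<bar>c\<bar> * T < pi"
  shows "(\<integral>\<^sup>+\<omega>. ennreal (exp (c * S \<omega>)) \<partial>M) \<le> ennreal (1 / cos (c * T / 2))"
proof -
  note [measurable] = levy_area_measurable[OF S] discrete_area_square(1)[OF T]
  define u where "u N \<omega> = (discrete_area T N (Suc N) \<omega> - S \<omega>)\<^sup>2" for N \<omega>
  have um [measurable]: "u N \<in> borel_measurable M" for N unfolding u_def by measurable
  have fin: "(\<integral>\<^sup>+\<omega>. ennreal (u N \<omega>) \<partial>M) < \<infinity>" for N
    using discrete_area_L2_dist[OF T S, of N] unfolding u_def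
    by (rule order.strict_trans1) (simp add: ennreal_mult_less_top)
  have ui: "integrable M (u N)" for N
    using fin[of N] by (simp add: integrable_iff_bounded u_def)
  have "(\<integral>\<^sup>+\<omega>. ennreal (u N \<omega>) \<partial>M) = ennreal (\<integral>\<omega>. u N \<omega> \<partial>M)" for N
    by (rule nn_integral_eq_integral[OF ui]) (simp add: u_def)
  then have "(\<lambda>N. ennreal (\<integral>\<omega>. norm (u N \<omega>) \<partial>M)) \<longlonglongrightarrow> ennreal 0"
    using discrete_area_tendsto[OF T S] by (simp add: u_def)
  then have "(\<lambda>N. \<integral>\<omega>. norm (u N \<omega>) \<partial>M) \<longlonglongrightarrow> 0" by (subst (asm) tendsto_ennreal_iff) auto
  from tendsto_L1_AE_subseq[OF ui this] obtain r where
    r: "strict_mono r" "AE \<omega> in M. (\<lambda>n. u (r n) \<omega>) \<longlonglongrightarrow> 0" by auto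
  let ?D = "\<lambda>n \<omega>. discrete_area T (r n) (Suc (r n)) \<omega>"
  have "AE \<omega> in M. (\<lambda>n. ?D n \<omega>) \<longlonglongrightarrow> S \<omega>"
    using r(2)
  proof eventually_elim
    case (elim \<omega>)
    have "(\<lambda>n. sqrt (u (r n) \<omega>)) \<longlonglongrightarrow> sqrt 0" by (intro tendsto_real_sqrt elim)
    then have "(\<lambda>n. \<bar>?D n \<omega> - S \<omega>\<bar>) \<longlonglongrightarrow> 0" by (simp add: u_def)
    then have "(\<lambda>n. ?D n \<omega> - S \<omega>) \<longlonglongrightarrow> 0" by (simp only: tendsto_rabs_zero_iff)
    then show ?case by (simp only: LIM_zero_iff)
  qed
  then have "AE \<omega> in M. ennreal (exp (c * S \<omega>)) = liminf (\<lambda>n. ennreal (exp (c * ?D n \<omega>)))"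
  proof eventually_elim
    case (elim \<omega>)
    have "(\<lambda>n. ennreal (exp (c * ?D n \<omega>))) \<longlonglongrightarrow> ennreal (exp (c * S \<omega>))"
      by (intro tendsto_ennrealI tendsto_intros elim)
    from lim_imp_Liminf[OF sequentially_bot this] show ?case by simp
  qed
  then have "(\<integral>\<^sup>+\<omega>. ennreal (exp (c * S \<omega>)) \<partial>M) = (\<integral>\<^sup>+\<omega>. liminf (\<lambda>n. ennreal (exp (c * ?D n \<omega>))) \<partial>M)"
    by (rule nn_integral_cong_AE)
  also have "\<dots> \<le> liminf (\<lambda>n. \<integral>\<^sup>+\<omega>. ennreal (exp (c * ?D n \<omega>)) \<partial>M)"
    by (rule nn_integral_liminf) measurable
  also have "\<dots> \<le> liminf (\<lambda>n::nat. ennreal (1 / cos (c * T / 2)))"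
    by (intro Liminf_mono always_eventually allI discrete_area_mgf[OF T c])
  also have "\<dots> = ennreal (1 / cos (c * T / 2))" by (simp add: Liminf_const)
  finally show ?thesis .
qed

lemma levy_area_cosh:
  assumes T: "0 < T" and S: "levy_area M T W1 W2 S" and c: "\<bar>c\<bar> * T < pi"
  shows "integrable M (\<lambda>\<omega>. cosh (c * S \<omega>))" "expectation (\<lambda>\<omega>. cosh (c * S \<omega>)) \<le> 1 / cos (c * T / 2)"
proof -
  note [measurable] = levy_area_measurable[OF S]
  have cT: "\<bar>c * T / 2\<bar> < pi / 2" using c T by (simp add: abs_mult)
  have c0: "0 < cos (c * T / 2)" using cT by (intro cos_gt_zero_pi) linarith+
  have *: "integrable M (\<lambda>\<omega>. exp (d * S \<omega>)) \<and> expectation (\<lambda>\<omega>. exp (d * S \<omega>)) \<le> 1 / cos (c * T / 2)"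
    if d: "\<bar>d\<bar> = \<bar>c\<bar>" for d
  proof
    have "cos (d * T / 2) = cos (c * T / 2)" using d by (auto simp: abs_eq_iff)
    then have le: "(\<integral>\<^sup>+\<omega>. ennreal (exp (d * S \<omega>)) \<partial>M) \<le> ennreal (1 / cos (c * T / 2))"
      using levy_area_mgf[OF T S, of d] d c by simp
    then have "(\<integral>\<^sup>+\<omega>. ennreal (exp (d * S \<omega>)) \<partial>M) < \<infinity>" by (rule order.strict_trans1) simp
    then show int: "integrable M (\<lambda>\<omega>. exp (d * S \<omega>))" by (simp add: integrable_iff_bounded)
    have "(\<integral>\<^sup>+\<omega>. ennreal (exp (d * S \<omega>)) \<partial>M) = ennreal (expectation (\<lambda>\<omega>. exp (d * S \<omega>)))"
      by (rule nn_integral_eq_integral[OF int]) simp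
    with le show "expectation (\<lambda>\<omega>. exp (d * S \<omega>)) \<le> 1 / cos (c * T / 2)"
      using c0 by (simp add: ennreal_le_iff)
  qed
  have ch: "cosh (c * S \<omega>) = 1/2 * exp (c * S \<omega>) + 1/2 * exp (- c * S \<omega>)" for \<omega>
    by (simp add: cosh_def)
  show "integrable M (\<lambda>\<omega>. cosh (c * S \<omega>))" unfolding ch using *[of c] *[of "-c"] by auto
  show "expectation (\<lambda>\<omega>. cosh (c * S \<omega>)) \<le> 1 / cos (c * T / 2)"
    unfolding ch using *[of c] *[of "-c"] by simp
qed

text \<open>The fourth power is bounded by the cosh remainder after the quadratic term, divided by
  \<open>c ^ 4\<close>. Because the second moment is known exactly, the quadratic term cancels that
  of 1 / cos, whose expansion 1 + y^2 / 2 + 5 y^4 / 24 + ... with y = c T / 2 gives the constant 5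
  as \<open>c\<close> tends to 0.\<close>

lemma levy_area_fourth_moment:
  assumes T: "0 < T" and S: "levy_area M T W1 W2 S"
  shows "integrable M (\<lambda>\<omega>. (S \<omega>) ^ 4)" "expectation (\<lambda>\<omega>. (S \<omega>) ^ 4) \<le> 5 * (T / 2) ^ 4"
proof -
  note [measurable] = levy_area_measurable[OF S]
  have *: "integrable M (\<lambda>\<omega>. (S \<omega>) ^ 4) \<and>
    expectation (\<lambda>\<omega>. (S \<omega>) ^ 4) \<le> 24 / c ^ 4 * (1 / cos (c * (T / 2)) - 1 - c\<^sup>2 * (T / 2)\<^sup>2 / 2)"
    if c: "0 < c" "c * T < pi" for c
  proof
    have c': "\<bar>c\<bar> * T < pi" using c by simp
    have pt: "(S \<omega>) ^ 4 \<le> 24 / c ^ 4 * (cosh (c * S \<omega>) - 1 - c\<^sup>2 * (S \<omega>)\<^sup>2 / 2)" for \<omega>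
    proof -
      have "(c * S \<omega>) ^ 4 / 24 \<le> cosh (c * S \<omega>) - 1 - (c * S \<omega>)\<^sup>2 / 2"
        using cosh_ge_quartic[of "c * S \<omega>"] by simp
      then have "24 / c ^ 4 * ((c * S \<omega>) ^ 4 / 24) \<le> 24 / c ^ 4 * (cosh (c * S \<omega>) - 1 - (c * S \<omega>)\<^sup>2 / 2)"
        using c by (intro mult_left_mono) auto
      then show ?thesis using c by (simp add: power_mult_distrib)
    qed
    have ib: "integrable M (\<lambda>\<omega>. 24 / c ^ 4 * (cosh (c * S \<omega>) - 1 - c\<^sup>2 * (S \<omega>)\<^sup>2 / 2))"
      using levy_area_cosh[OF T S c'] levy_area_second_moment[OF T S] by auto
    show i4: "integrable M (\<lambda>\<omega>. (S \<omega>) ^ 4)"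
    proof (rule Bochner_Integration.integrable_bound[OF ib])
      show "AE \<omega> in M. norm ((S \<omega>) ^ 4) \<le> norm (24 / c ^ 4 * (cosh (c * S \<omega>) - 1 - c\<^sup>2 * (S \<omega>)\<^sup>2 / 2))"
      proof (rule AE_I2)
        fix \<omega>
        have "0 \<le> (S \<omega>) ^ 4" by simp
        then show "norm ((S \<omega>) ^ 4) \<le> norm (24 / c ^ 4 * (cosh (c * S \<omega>) - 1 - c\<^sup>2 * (S \<omega>)\<^sup>2 / 2))"
          using pt[of \<omega>] unfolding real_norm_def by linarith
      qed
    qed simp
    have "expectation (\<lambda>\<omega>. (S \<omega>) ^ 4) \<le> expectation (\<lambda>\<omega>. 24 / c ^ 4 * (cosh (c * S \<omega>) - 1 - c\<^sup>2 * (S \<omega>)\<^sup>2 / 2))"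
      by (rule integral_mono[OF i4 ib pt])
    also have "\<dots> = 24 / c ^ 4 * (expectation (\<lambda>\<omega>. cosh (c * S \<omega>)) - 1 - c\<^sup>2 * (T\<^sup>2 / 4) / 2)"
      using levy_area_cosh[OF T S c'] levy_area_second_moment[OF T S] by (simp add: prob_space)
    also have "\<dots> \<le> 24 / c ^ 4 * (1 / cos (c * T / 2) - 1 - c\<^sup>2 * (T\<^sup>2 / 4) / 2)"
      using levy_area_cosh(2)[OF T S c'] c by (intro mult_left_mono) auto
    finally show "expectation (\<lambda>\<omega>. (S \<omega>) ^ 4) \<le> 24 / c ^ 4 * (1 / cos (c * (T / 2)) - 1 - c\<^sup>2 * (T / 2)\<^sup>2 / 2)"
      by (simp add: power_divide)
  qed
  \<comment> \<open>One admissible rate is enough for integrability, and \<open>1 / T\<close> is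
    admissible since 1 < pi.\<close>
  have c1: "0 < 1 / T \<and> 1 / T * T < pi" using T pi_ge_two by simp
  show "integrable M (\<lambda>\<omega>. (S \<omega>) ^ 4)" using *[of "1 / T"] c1 by blast
  define s where "s = T / 2"
  have s: "0 < s" using T by (simp add: s_def)
  have "((\<lambda>y. (1 / cos y - 1 - y\<^sup>2 / 2) / y ^ 4) \<longlongrightarrow> 5 / 24) (at_right (0 :: real))"
    by real_asymp
  from tendsto_mult[OF tendsto_const[of "24 * s ^ 4"] this]
  have lim: "((\<lambda>y. 24 * s ^ 4 * ((1 / cos y - 1 - y\<^sup>2 / 2) / y ^ 4)) \<longlongrightarrow> 5 * s ^ 4) (at_right 0)" by simp
  have "eventually (\<lambda>y::real. 0 < y \<and> y < pi / 2) (at_right 0)"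
    by (auto simp: eventually_at_right_field intro!: exI[of _ "pi / 2"])
  then have ev: "eventually (\<lambda>y. expectation (\<lambda>\<omega>. (S \<omega>) ^ 4) \<le> 24 * s ^ 4 * ((1 / cos y - 1 - y\<^sup>2 / 2) / y ^ 4)) (at_right 0)"
  proof eventually_elim
    case (elim y)
    have "24 / (y / s) ^ 4 * (1 / cos (y / s * s) - 1 - (y / s)\<^sup>2 * s\<^sup>2 / 2) = 24 * s ^ 4 * ((1 / cos y - 1 - y\<^sup>2 / 2) / y ^ 4)"
      using s by (simp add: power_divide)
    moreover have "0 < y / s" "y / s * T < pi" using elim s by (auto simp: s_def)
    ultimately show ?case using *[of "y / s"] unfolding s_def[symmetric] by simp
  qed
  show "expectation (\<lambda>\<omega>. (S \<omega>) ^ 4) \<le> 5 * (T / 2) ^ 4"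
    unfolding s_def[symmetric] by (rule tendsto_lowerbound[OF lim ev]) simp
qed

end

section \<open>Dimension-free bounds for the Euclidean norm\<close>

lemma sin_ge_cubic:
  fixes x :: real
  assumes "0 \<le> x"
  shows "x - x ^ 3 / 6 - x ^ 5 / 120 \<le> sin x"
proof -
  have 5: "{..<5} = {0, 1, 2, 3, 4 :: nat}" by auto
  have "\<bar>sin x - (x - x ^ 3 / 6)\<bar> \<le> x ^ 5 / 120"
    using Maclaurin_sin_bound[of x 5] assms
    by (simp add: 5 sin_coeff_def fact_numeral field_simps)
  then show ?thesis by linarith
qed

lemma pi_ge_3: "3 \<le> pi"
  using sin_x_le_x[of "pi / 6"] by (simp add: sin_30)

text \<open>If pi exceeded 16/5, then 8/15, a sixth of 16/5, would lie below pi / 6, although its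
  sine already exceeds 1/2.\<close>

lemma pi_le_16_5: "pi \<le> 16 / 5"
proof (rule ccontr)
  assume "\<not> ?thesis"
  then have "sin (8 / 15) \<le> sin (pi / 6)"
    by (intro sin_monotone_2pi_le) auto
  moreover have "1 / 2 < sin (8 / 15 :: real)"
    using sin_ge_cubic[of "8 / 15"] by (simp add: power_divide)
  ultimately show False by (simp add: sin_30)
qed

text \<open>The lower series bound for sin y / y decreases in \<open>y\<close>, so its value at the
  right end \<open>d\<close> serves as a slope on the whole interval.\<close>

lemma sin_ge_fraction:
  fixes y d :: real
  assumes "0 \<le> y" "y \<le> d" "k \<le> 1 - d\<^sup>2 / 6 - d ^ 4 / 120"
  shows "k * y \<le> sin y"
proof -
  have "y\<^sup>2 \<le> d\<^sup>2" "y ^ 4 \<le> d ^ 4" using assms by (auto intro: power_mono)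
  then have "k \<le> 1 - y\<^sup>2 / 6 - y ^ 4 / 120" using assms(3) by linarith
  then have "k * y \<le> (1 - y\<^sup>2 / 6 - y ^ 4 / 120) * y" using assms(1) by (rule mult_right_mono)
  also have "\<dots> = y - y ^ 3 / 6 - y ^ 5 / 120" by (simp add: algebra_simps numeral_eq_Suc)
  also have "\<dots> \<le> sin y" using assms by (intro sin_ge_cubic)
  finally show ?thesis .
qed

text \<open>By pi \<le> 16/5 the angle is at most 4/5, where the slope 8/9 is available; pi \<ge> 3
  then turns 8/9 * 3/4 into 2/3.\<close>

lemma sin_quarter_ge:
  fixes b :: real
  assumes "0 \<le> b" "b \<le> 1"
  shows "2 / 3 * b \<le> sin (b * pi / 4)"
proof -
  have "b * pi \<le> 1 * (16 / 5)" using assms pi_le_16_5 by (intro mult_mono) auto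
  then have "8 / 9 * (b * pi / 4) \<le> sin (b * pi / 4)"
    using assms by (intro sin_ge_fraction[of _ "4 / 5"]) (auto simp: power_divide)
  moreover have "b * 3 \<le> b * pi" using assms pi_ge_3 by (intro mult_left_mono)
  ultimately show ?thesis by linarith
qed

lemma sin_half_ge:
  fixes b :: real
  assumes "0 \<le> b" "b \<le> 1"
  shows "3 / 4 * b \<le> sin (b * pi / 2)"
proof -
  have "b * pi \<le> 1 * (16 / 5)" using assms pi_le_16_5 by (intro mult_mono) auto
  then have "1 / 2 * (b * pi / 2) \<le> sin (b * pi / 2)"
    using assms by (intro sin_ge_fraction[of _ "8 / 5"]) (auto simp: power_divide)
  moreover have "b * 3 \<le> b * pi" using assms pi_ge_3 by (intro mult_left_mono)
  ultimately show ?thesis by linarith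
qed

lemma cos_ge_quadratic: "1 - x\<^sup>2 / 2 \<le> cos x" for x :: real
proof -
  have "(sin (x / 2))\<^sup>2 \<le> (x / 2)\<^sup>2"
    using abs_sin_x_le_abs_x[of "x / 2"] by (simp only: abs_le_square_iff)
  moreover have "cos x = 1 - 2 * (sin (x / 2))\<^sup>2" using cos_double_sin[of "x / 2"] by simp
  ultimately show ?thesis by (simp add: power_divide)
qed

lemma exp_1_ge: "8 / 3 \<le> exp (1 :: real)"
proof -
  have "{..<4} = {0, 1, 2, 3 :: nat}" by auto
  moreover have "sum (\<lambda>n. inverse (fact n) * (1 :: real) ^ n) {..<4} \<le> exp 1"
    using exp_converges[of "1 :: real"] by (simp add: sums_iff) (intro order_trans[OF sum_le_suminf], auto)
  ultimately show ?thesis by (simp add: fact_numeral)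
qed

text \<open>\<open>y \<le> exp (y - 1)\<close> combined with \<open>8 / 3 \<le> exp 1\<close>. It
  trades a power of \<open>t\<close> for a small exponential rate with an explicit constant.\<close>

lemma le_exp_scaled:
  fixes t r :: real
  assumes "0 < r"
  shows "t \<le> 3 / 8 * r * exp (t / r)"
proof -
  have "t / r \<le> exp (t / r - 1)" using exp_ge_add_one_self[of "t / r - 1"] by simp
  also have "\<dots> = exp (t / r) / exp 1" by (simp add: exp_diff)
  also have "\<dots> \<le> exp (t / r) / (8 / 3)" using exp_1_ge by (intro divide_left_mono) auto
  finally show ?thesis using assms by (simp add: field_simps)
qed

lemma square_le_exp:
  fixes t r :: real
  assumes "0 < r" "0 \<le> t"
  shows "t\<^sup>2 \<le> 9 / 64 * r\<^sup>2 * exp (2 * t / r)"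
proof -
  have "t\<^sup>2 \<le> (3 / 8 * r * exp (t / r))\<^sup>2" using le_exp_scaled[OF assms(1)] assms by (intro power_mono)
  then show ?thesis by (simp add: power_mult_distrib power_divide exp_double[symmetric])
qed

lemma exp_remainder_le:
  fixes u :: real
  assumes "0 \<le> u"
  shows "exp u - 1 - u \<le> u\<^sup>2 / 2 * exp u"
proof (cases "u = 0")
  case False
  then have "\<exists>t. 0 < t \<and> t < u \<and> exp u = (\<Sum>m<2. exp 0 / fact m * u ^ m) + exp t / fact 2 * u ^ 2"
    using assms by (intro Maclaurin[where diff="\<lambda>_. exp"]) (auto intro!: DERIV_exp)
  then obtain t where t: "t < u" "exp u = 1 + u + exp t / 2 * u\<^sup>2" by (auto simp: numeral_2_eq_2)
  have "exp t * (u\<^sup>2 / 2) \<le> exp u * (u\<^sup>2 / 2)" using t(1) by (intro mult_right_mono) auto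
  then show ?thesis using t(2) by (simp add: mult.commute)
qed simp

text \<open>The infimal convolution of x^2 / (2 c) and |x|. The slope never exceeds 1, so
  \<open>exp (a * huber c x)\<close> stays integrable for every rate \<open>a < 1\<close> at which
  the coordinate has exponential moments.\<close>

definition huber :: "real \<Rightarrow> real \<Rightarrow> real" where
  "huber c x = (if \<bar>x\<bar> \<le> c then x\<^sup>2 / (2 * c) else \<bar>x\<bar> - c / 2)"

lemma huber_le_square: 
  assumes "0 < c"
  shows "huber c x \<le> x\<^sup>2 / (2 * c)"
proof -
  have "0 \<le> (\<bar>x\<bar> - c)\<^sup>2 / (2 * c)" using assms by simp
  also have "\<dots> = x\<^sup>2 / (2 * c) - (\<bar>x\<bar> - c / 2)"
    using assms by (simp add: power2_diff field_simps) (simp add: power2_eq_square)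
  finally show ?thesis by (simp add: huber_def)
qed

lemma huber_le_abs: 
  assumes "0 < c"
  shows "huber c x \<le> \<bar>x\<bar>"
proof (cases "\<bar>x\<bar> \<le> c")
  case True
  have "\<bar>x\<bar> * \<bar>x\<bar> \<le> \<bar>x\<bar> * (2 * c)" using True assms by (intro mult_left_mono) auto
  then show ?thesis using True assms by (simp add: huber_def field_simps power2_eq_square)
qed (use assms in \<open>simp add: huber_def\<close>)

lemma huber_measurable [measurable]: "huber c \<in> borel_measurable borel"
  unfolding huber_def by measurable

text \<open>Every coordinate is clipped to [-c, c]. The excess is bounded by its sum norm and the
  clipped vector by r \<le> c / 2 + r^2 / (2 c); coordinatewise the two costs add up to exactly the
  Huber function.\<close>

lemma L2_set_le_huber:
  fixes f :: "'i \<Rightarrow> real"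
  assumes c: "0 < c"
  shows "L2_set f A \<le> c / 2 + (\<Sum>i\<in>A. huber c (f i))"
proof (cases "finite A")
  case True
  define y where "y i = max (- c) (min c (f i))" for i
  have split: "huber c (f i) = (y i)\<^sup>2 / (2 * c) + \<bar>f i - y i\<bar>" for i
    using c by (auto simp: huber_def y_def max_def min_def abs_if power2_eq_square field_simps)
  have "L2_set f A \<le> L2_set y A + L2_set (\<lambda>i. f i - y i) A"
    using L2_set_triangle_ineq[of y "\<lambda>i. f i - y i" A] by simp
  also have "L2_set (\<lambda>i. f i - y i) A \<le> (\<Sum>i\<in>A. \<bar>f i - y i\<bar>)" by (rule L2_set_le_sum_abs)
  also have "L2_set y A \<le> c / 2 + (L2_set y A)\<^sup>2 / (2 * c)"
  proof -
    have "0 \<le> (L2_set y A - c)\<^sup>2 / (2 * c)" using c by simp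
    then show ?thesis using c by (simp add: power2_diff field_simps power2_eq_square)
  qed
  also have "(L2_set y A)\<^sup>2 = (\<Sum>i\<in>A. (y i)\<^sup>2)" by (simp add: L2_set_def sum_nonneg)
  finally show ?thesis by (simp add: split sum.distrib sum_divide_distrib)
qed (use c in simp)

text \<open>
  Below the threshold \<open>c\<close> the exponent is at most \<open>a t / 2\<close>, which leaves half of the
  rate to spare; above it the factor \<open>exp (- a c / 2)\<close>, with \<open>c\<close> of order \<open>sqrt n\<close>, absorbs the
  number \<open>n\<close> of coordinates.  This is why the bound does not depend on the dimension.
\<close>

lemma huber_exp_remainder:
  fixes a b c n x :: real
  assumes a: "0 < a" "a < 1" and b: "b = 1 - a" and n: "0 < n" and c: "0 < c" "27 / 4 * n \<le> c\<^sup>2"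
  shows "n * (exp (a * huber c x) - 1 - a * huber c x) \<le>
    (if b < 1 / 2 then 3 * a\<^sup>2 else 3 * a\<^sup>2 / b\<^sup>2) * cosh ((1 + a) / 2 * x)"
proof -
  define t where "t = \<bar>x\<bar>"
  define \<theta> where "\<theta> = (1 + a) / 2"
  define C where "C = (if b < 1 / 2 then 3 * a\<^sup>2 else 3 * a\<^sup>2 / b\<^sup>2)"
  have b0: "0 < b" "b < 1" using a b by auto
  have C0: "0 \<le> C" by (simp add: C_def)
  have aC: "3 * a\<^sup>2 \<le> C"
  proof -
    have "3 * a\<^sup>2 / 1 \<le> 3 * a\<^sup>2 / b\<^sup>2" using b0 by (intro divide_left_mono) (auto intro: power_le_one)
    then show ?thesis by (simp add: C_def)
  qed
  have cosh: "exp (\<theta> * t) / 2 \<le> cosh (\<theta> * x)"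
  proof -
    have "cosh (\<theta> * x) = cosh (\<theta> * t)" by (auto simp: t_def abs_if)
    then show ?thesis by (simp only:) (simp add: cosh_def)
  qed
  have goal: "n * (exp (a * huber c x) - 1 - a * huber c x) \<le> C / 2 * exp (\<theta> * t)"
  proof (cases "t \<le> c")
    case True
    define u where "u = a * t\<^sup>2 / (2 * c)"
    have u: "a * huber c x = u" using True by (simp add: huber_def u_def t_def)
    have u0: "0 \<le> u" using a c by (simp add: u_def)
    have "t * t \<le> c * t" using True by (intro mult_right_mono) (auto simp: t_def)
    then have ut: "u \<le> a * t / 2" using a c by (simp add: u_def field_simps power2_eq_square)
    have "n * (exp u - 1 - u) \<le> n * (u\<^sup>2 / 2 * exp u)"
      using exp_remainder_le[OF u0] n by (intro mult_left_mono) auto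
    also have "\<dots> \<le> n * (u\<^sup>2 / 2 * exp (a * t / 2))" using n ut by (intro mult_left_mono) auto
    also have "\<dots> = n / c\<^sup>2 * (a\<^sup>2 * t ^ 4 / 8 * exp (a * t / 2))"
      using c by (simp add: u_def field_simps power2_eq_square numeral_eq_Suc)
    also have "\<dots> \<le> 4 / 27 * (a\<^sup>2 * t ^ 4 / 8 * exp (a * t / 2))"
      using c n by (intro mult_right_mono) (auto simp: field_simps t_def)
    also have "\<dots> = a\<^sup>2 / 54 * exp (a * t / 2) * (t\<^sup>2)\<^sup>2" by (simp add: power2_eq_square numeral_eq_Suc)
    \<comment> \<open>Scale 8 makes t^4 cost the rate 1/2, which is precisely the gap between
      \<open>a / 2\<close> and \<theta>. The constants combine as 81 / 54 = 3 / 2.\<close>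
    also have "\<dots> \<le> a\<^sup>2 / 54 * exp (a * t / 2) * (9 / 64 * 8\<^sup>2 * exp (2 * t / 8))\<^sup>2"
      using square_le_exp[of 8 t] by (intro mult_left_mono power_mono) (auto simp: t_def)
    also have "\<dots> = 3 * a\<^sup>2 / 2 * (exp (a * t / 2) * exp (t / 2))"
      by (simp add: power_mult_distrib exp_double[symmetric])
    also have "exp (a * t / 2) * exp (t / 2) = exp (\<theta> * t)"
      by (simp add: exp_add[symmetric] \<theta>_def field_simps)
    also have "3 * a\<^sup>2 / 2 * exp (\<theta> * t) \<le> C / 2 * exp (\<theta> * t)" using aC by (intro mult_right_mono) auto
    finally show ?thesis unfolding u .
  next
    case False
    define h where "h = t - c / 2"
    have h: "huber c x = h" using False by (simp add: huber_def h_def t_def)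
    have h0: "0 \<le> h" and ah: "0 \<le> a * h" and hc: "c / 2 \<le> h" using False c a by (auto simp: h_def)
    \<comment> \<open>The gap between \<theta> and \<open>a\<close> is \<open>b / 2\<close>. It is
      shared out: the decay in \<open>h\<close> absorbs the factor h^2, the decay in
      \<open>c\<close> absorbs \<open>n\<close>.\<close>
    have ex: "exp (a * h) = exp (\<theta> * t) * exp (- (b * h / 2) - (b * c / 4 + a * c / 2))"
      unfolding exp_add[symmetric] by (simp add: h_def \<theta>_def b field_simps)
    have nc: "n \<le> 4 / 27 * c\<^sup>2" using c by simp
    \<comment> \<open>For b < 1/2 the whole exponential is kept: a^2 is at least 1/4, so a constant
      bound can be absorbed into a^2 and nothing blows up as \<open>b\<close> tends to 0. For b
      \<ge> 1/2 the rate \<open>a\<close> may be small, so a factor a^2 has to be extracted from the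
      remainder; the resulting 1 / b^2 is then bounded.\<close>
    show ?thesis
    proof (cases "b < 1 / 2")
      case True
      have a2: "1 / 4 \<le> a\<^sup>2" using True b power_mono[of "1/2" a 2] by (simp add: power_divide)
      have "n * (exp (a * h) - 1 - a * h) \<le> n * exp (a * h)"
        using n ah by (intro mult_left_mono) auto
      also have "\<dots> = exp (\<theta> * t) * (n * exp (- (b * h / 2) - (b * c / 4 + a * c / 2)))" unfolding ex by simp
      also have "\<dots> \<le> exp (\<theta> * t) * (n * exp (- (c / 2)))"
      proof -
        have "b * (c / 2) \<le> b * h" using hc b0 by (intro mult_left_mono) auto
        then have "- (b * h / 2) - (b * c / 4 + a * c / 2) \<le> - (c / 2)" by (simp add: b field_simps)
        then show ?thesis using n by (intro mult_left_mono) auto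
      qed
      also have "\<dots> \<le> exp (\<theta> * t) * (1 / 3)"
      proof (rule mult_left_mono)
        have "n * exp (- (c / 2)) \<le> 4 / 27 * c\<^sup>2 * exp (- (c / 2))" using nc by (intro mult_right_mono) auto
        also have "\<dots> \<le> 4 / 27 * (9 / 64 * 4\<^sup>2 * exp (2 * c / 4)) * exp (- (c / 2))"
          using square_le_exp[of 4 c] c by (intro mult_right_mono mult_left_mono) auto
        also have "\<dots> = 1 / 3" by (simp add: exp_minus field_simps)
        finally show "n * exp (- (c / 2)) \<le> 1 / 3" .
      qed simp
      also have "\<dots> \<le> C / 2 * exp (\<theta> * t)" using a2 True by (simp add: C_def)
      finally show ?thesis unfolding h .
    next
      case b2: False
      have "n * (exp (a * h) - 1 - a * h) \<le> n * ((a * h)\<^sup>2 / 2 * exp (a * h))"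
        using n exp_remainder_le[of "a * h"] a h0 by (intro mult_left_mono) auto
      also have "\<dots> = a\<^sup>2 / 2 * exp (\<theta> * t) * ((h\<^sup>2 * exp (- (b * h / 2))) * (n * exp (- (b * c / 4 + a * c / 2))))"
        unfolding ex exp_diff exp_minus by (simp add: power_mult_distrib field_simps)
      also have "\<dots> \<le> a\<^sup>2 / 2 * exp (\<theta> * t) * (9 / (4 * b\<^sup>2) * (4 / 3))"
      proof (intro mult_left_mono mult_mono)
        have "h\<^sup>2 * exp (- (b * h / 2)) \<le> 9 / 64 * (4 / b)\<^sup>2 * exp (2 * h / (4 / b)) * exp (- (b * h / 2))"
          using square_le_exp[of "4 / b" h] b0 h0 by (intro mult_right_mono) auto
        also have "\<dots> = 9 / (4 * b\<^sup>2)" using b0 by (simp add: exp_minus power_divide field_simps)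
        finally show "h\<^sup>2 * exp (- (b * h / 2)) \<le> 9 / (4 * b\<^sup>2)" .
        \<comment> \<open>Here b + 2 a = 1 + a \<ge> 1.\<close>
        have "- (b * c / 4 + a * c / 2) \<le> - (c / 4)" using a c by (simp add: b field_simps)
        then have "n * exp (- (b * c / 4 + a * c / 2)) \<le> 4 / 27 * c\<^sup>2 * exp (- (c / 4))"
          using nc n by (intro mult_mono) auto
        also have "\<dots> \<le> 4 / 27 * (9 / 64 * 8\<^sup>2 * exp (2 * c / 8)) * exp (- (c / 4))"
          using square_le_exp[of 8 c] c by (intro mult_right_mono mult_left_mono) auto
        also have "\<dots> = 4 / 3" by (simp add: exp_minus field_simps)
        finally show "n * exp (- (b * c / 4 + a * c / 2)) \<le> 4 / 3" .
      qed (use n in auto)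
      also have "\<dots> = C / 2 * exp (\<theta> * t)" using b2 by (simp add: C_def)
      finally show ?thesis unfolding h .
    qed
  qed
  also have "C / 2 * exp (\<theta> * t) = C * (exp (\<theta> * t) / 2)" by simp
  also have "\<dots> \<le> C * cosh (\<theta> * x)" using C0 cosh by (intro mult_left_mono)
  finally show ?thesis by (simp add: C_def \<theta>_def)
qed

section \<open>Lower bound for the constant in the exponent\<close>

lemma minus_ln_one_minus_ge:
  fixes a :: real
  assumes "0 \<le> a" "a < 1"
  shows "a\<^sup>2 / 2 \<le> - ln (1 - a) - a"
proof -
  define f where "f x = - ln (1 - x) - x - x\<^sup>2 / 2" for x :: real
  have "f 0 \<le> f a"
  proof (rule DERIV_nonneg_imp_nondecreasing[OF assms(1)])
    fix x assume x: "0 \<le> x" "x \<le> a"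
    have "(f has_real_derivative 1 / (1 - x) - 1 - x) (at x)"
      unfolding f_def using x assms by (auto intro!: derivative_eq_intros simp: field_simps)
    moreover have "0 \<le> 1 / (1 - x) - 1 - x" using x assms by (simp add: field_simps)
    ultimately show "\<exists>y. (f has_real_derivative y) (at x) \<and> 0 \<le> y" by blast
  qed
  then show ?thesis by (simp add: f_def)
qed

text \<open>The logarithmic part has second-order term (1 - b)^2 / 2, multiplied by 32. For the
  other part, pi m \<le> (16/5) (T/2) = 8 T / 5, and 16 / (8/5)^2 = 25/4.\<close>

lemma levy_area_K_ge:
  assumes b: "0 < b" "b < 1" and m: "0 < m" "m \<le> T / 2"
  shows "(1 - b)\<^sup>2 * (16 + 25 / (4 * b\<^sup>2)) \<le> levy_area_K T m b"
proof -
  have "32 * ((1 - b)\<^sup>2 / 2) \<le> 32 * (- ln b - (1 - b))"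
    using minus_ln_one_minus_ge[of "1 - b"] b by (intro mult_left_mono) auto
  then have 1: "16 * (1 - b)\<^sup>2 \<le> - 32 * ln b - 32 * (1 - b)" by simp
  have "pi\<^sup>2 * m\<^sup>2 \<le> (16 / 5)\<^sup>2 * (T / 2)\<^sup>2"
    using m pi_le_16_5 pi_ge_zero by (intro mult_mono power_mono) auto
  then have "25 / 4 \<le> 16 * T\<^sup>2 / (pi\<^sup>2 * m\<^sup>2)" using m by (simp add: field_simps power2_eq_square)
  then have "25 / 4 * ((1 - b)\<^sup>2 / b\<^sup>2) \<le> 16 * T\<^sup>2 / (pi\<^sup>2 * m\<^sup>2) * ((1 - b)\<^sup>2 / b\<^sup>2)"
    by (intro mult_right_mono) auto
  with 1 show ?thesis by (simp add: levy_area_K_def algebra_simps)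
qed

text \<open>Since exp u + exp (-u) = 2 cosh u and exp (-u) \<ge> 1 - u, the remainder after the
  linear term is controlled by cosh, whose expectation is under control.\<close>

lemma exp_remainder_le_cosh:
  fixes u :: real
  shows "exp u \<le> 1 + u + 2 * (cosh u - 1)"
  using exp_ge_add_one_self[of "-u"] by (simp add: cosh_def field_simps)

lemma exp_abs_le_cosh: "exp (a * \<bar>x\<bar>) \<le> 2 * cosh (a * x)" for a x :: real
  by (auto simp: cosh_def abs_if)

text \<open>The areas scaled to \<open>T = pi\<close>, reduced to the moment information used for
  the norm. The numbers are those of the hyperbolic secant law with density 1 / (pi cosh x): Laplace
  transform 1 / cos (c pi / 2), variance (pi / 2)^2, fourth moment 5 (pi / 2)^4.\<close>

locale sech_vector = prob_space M for M :: "'a measure" +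
  fixes X :: "'n::finite \<Rightarrow> 'a \<Rightarrow> real"
  assumes indep: "indep_vars (\<lambda>_. borel) X UNIV"
    and second_moment: "integrable M (\<lambda>\<omega>. (X i \<omega>)\<^sup>2)" "expectation (\<lambda>\<omega>. (X i \<omega>)\<^sup>2) = (pi / 2)\<^sup>2"
    and fourth_moment: "integrable M (\<lambda>\<omega>. (X i \<omega>) ^ 4)" "expectation (\<lambda>\<omega>. (X i \<omega>) ^ 4) \<le> 5 * (pi / 2) ^ 4"
    and cosh_moment: "\<bar>c\<bar> < 1 \<Longrightarrow> integrable M (\<lambda>\<omega>. cosh (c * X i \<omega>))"
      "\<bar>c\<bar> < 1 \<Longrightarrow> expectation (\<lambda>\<omega>. cosh (c * X i \<omega>)) \<le> 1 / cos (c * pi / 2)"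
begin

definition R :: "'a \<Rightarrow> real" where
  "R \<omega> = L2_set (\<lambda>i. X i \<omega>) UNIV"

lemma X_measurable [measurable]: "X i \<in> borel_measurable M"
  using indep by (auto simp: indep_vars_def)

lemma R_measurable [measurable]: "R \<in> borel_measurable M"
  unfolding R_def[abs_def] L2_set_def by measurable

lemma R_nonneg: "0 \<le> R \<omega>"
  by (simp add: R_def)

lemma R_square: "(R \<omega>)\<^sup>2 = (\<Sum>i\<in>UNIV. (X i \<omega>)\<^sup>2)"
  by (simp add: R_def L2_set_def sum_nonneg)

lemma R_second_moment:
  "integrable M (\<lambda>\<omega>. (R \<omega>)\<^sup>2)" "expectation (\<lambda>\<omega>. (R \<omega>)\<^sup>2) = real CARD('n) * (pi / 2)\<^sup>2"
  unfolding R_square using second_moment by simp_all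

lemma R_integrable: "integrable M R"
  by (rule square_integrable_imp_integrable[OF R_measurable R_second_moment(1)])

text \<open>Off the diagonal independence gives the square of the variance; on the diagonal the
  fourth moment is at most five times that. The form "1 plus 4 on the diagonal" makes the double sum
  n^2 + 4 n.\<close>

lemma pair_moment:
  "integrable M (\<lambda>\<omega>. (X i \<omega>)\<^sup>2 * (X j \<omega>)\<^sup>2)"
  "expectation (\<lambda>\<omega>. (X i \<omega>)\<^sup>2 * (X j \<omega>)\<^sup>2) \<le> (pi / 2) ^ 4 + (if i = j then 4 * (pi / 2) ^ 4 else 0)"
proof -
  have "integrable M (\<lambda>\<omega>. (X i \<omega>)\<^sup>2 * (X j \<omega>)\<^sup>2) \<and>
    expectation (\<lambda>\<omega>. (X i \<omega>)\<^sup>2 * (X j \<omega>)\<^sup>2) \<le> (pi / 2) ^ 4 + (if i = j then 4 * (pi / 2) ^ 4 else 0)"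
  proof (cases "i = j")
    case True
    then show ?thesis using fourth_moment[of j] by (simp add: power_add[symmetric])
  next
    case False
    have "indep_vars (\<lambda>_. borel) (\<lambda>i \<omega>. (X i \<omega>)\<^sup>2) UNIV"
      by (rule indep_vars_compose2[OF indep]) measurable
    then have iv: "indep_vars (\<lambda>_. borel) (\<lambda>i \<omega>. (X i \<omega>)\<^sup>2) {i, j}" by (rule indep_vars_subset) simp
    have "(\<Prod>k\<in>{i, j}. (X k \<omega>)\<^sup>2) = (X i \<omega>)\<^sup>2 * (X j \<omega>)\<^sup>2" for \<omega> using False by simp
    moreover have "(\<Prod>k\<in>{i, j}. expectation (\<lambda>\<omega>. (X k \<omega>)\<^sup>2)) = (pi / 2) ^ 4"
      using False second_moment(2) by (simp add: power_add[symmetric])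
    ultimately show ?thesis
      using indep_vars_lebesgue_integral[OF _ iv second_moment(1)] indep_vars_integrable[OF _ iv second_moment(1)] False
      by simp
  qed
  then show "integrable M (\<lambda>\<omega>. (X i \<omega>)\<^sup>2 * (X j \<omega>)\<^sup>2)"
    "expectation (\<lambda>\<omega>. (X i \<omega>)\<^sup>2 * (X j \<omega>)\<^sup>2) \<le> (pi / 2) ^ 4 + (if i = j then 4 * (pi / 2) ^ 4 else 0)" by auto
qed

lemma R_fourth_moment:
  "integrable M (\<lambda>\<omega>. (R \<omega>) ^ 4)"
  "expectation (\<lambda>\<omega>. (R \<omega>) ^ 4) \<le> ((real CARD('n))\<^sup>2 + 4 * real CARD('n)) * (pi / 2) ^ 4"
proof -
  have R4: "(R \<omega>) ^ 4 = (\<Sum>i\<in>UNIV. \<Sum>j\<in>UNIV. (X i \<omega>)\<^sup>2 * (X j \<omega>)\<^sup>2)" for \<omega>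
  proof -
    have "(R \<omega>) ^ 4 = ((R \<omega>)\<^sup>2)\<^sup>2" by simp
    then show ?thesis unfolding R_square by (simp add: power2_eq_square sum_product)
  qed
  show "integrable M (\<lambda>\<omega>. (R \<omega>) ^ 4)" unfolding R4 using pair_moment(1) by (intro Bochner_Integration.integrable_sum)
  have "expectation (\<lambda>\<omega>. (R \<omega>) ^ 4) = (\<Sum>i\<in>UNIV. \<Sum>j\<in>UNIV. expectation (\<lambda>\<omega>. (X i \<omega>)\<^sup>2 * (X j \<omega>)\<^sup>2))"
    unfolding R4 by (simp add: Bochner_Integration.integral_sum Bochner_Integration.integrable_sum pair_moment(1))
  also have "\<dots> \<le> (\<Sum>i\<in>(UNIV :: 'n set). \<Sum>j\<in>UNIV. (pi / 2) ^ 4 + (if i = j then 4 * (pi / 2) ^ 4 else 0))"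
    by (intro sum_mono pair_moment(2))
  also have "\<dots> = ((real CARD('n))\<^sup>2 + 4 * real CARD('n)) * (pi / 2) ^ 4"
    by (simp add: sum.distrib power2_eq_square algebra_simps)
  finally show "expectation (\<lambda>\<omega>. (R \<omega>) ^ 4) \<le> ((real CARD('n))\<^sup>2 + 4 * real CARD('n)) * (pi / 2) ^ 4" .
qed

section \<open>Exponential moments and tail of the norm\<close>

lemma exp_abs_integrable:
  assumes "0 < a" "a < 1"
  shows "integrable M (\<lambda>\<omega>. exp (a * \<bar>X i \<omega>\<bar>))"
proof (rule Bochner_Integration.integrable_bound)
  show "integrable M (\<lambda>\<omega>. 2 * cosh (a * X i \<omega>))" using cosh_moment(1)[of a i] assms by simp
  show "AE \<omega> in M. norm (exp (a * \<bar>X i \<omega>\<bar>)) \<le> norm (2 * cosh (a * X i \<omega>))"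
    using exp_abs_le_cosh by (intro AE_I2) (simp add: abs_mult)
qed measurable

text \<open>The Huber route is closed here because its lower bound on \<open>E R\<close> requires
  two coordinates. With R = |X| the linear term of the exponential is directly
  \<open>a * expectation R\<close>, and the rest is twice the excess of 1 / cos over 1, which is of
  order a^2 / b.\<close>

lemma exp_norm_one_dim:
  assumes a: "0 < a" "a < 1" and b: "b = 1 - a" and one: "CARD('n) = 1"
  shows "integrable M (\<lambda>\<omega>. exp (a * R \<omega>))"
    "expectation (\<lambda>\<omega>. exp (a * R \<omega>)) \<le> exp (2 * a * expectation R + a\<^sup>2 * (16 + 25 / (4 * b\<^sup>2)))"
proof -
  obtain i :: 'n where i: "UNIV = {i}" using one by (auto simp: card_1_singleton_iff)
  have R: "R \<omega> = \<bar>X i \<omega>\<bar>" for \<omega> by (simp add: R_def i L2_set_def)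
  show int: "integrable M (\<lambda>\<omega>. exp (a * R \<omega>))" unfolding R by (rule exp_abs_integrable[OF a])
  have cosa: "cos (a * pi / 2) = sin (b * pi / 2)"
    using sin_cos_eq[of "b * pi / 2"] by (simp add: b field_simps)
  have b0: "0 < b" "b \<le> 1" using a b by auto
  have cb: "3 / 4 * b \<le> cos (a * pi / 2)" unfolding cosa using b0 by (intro sin_half_ge) auto
  have c0: "0 < cos (a * pi / 2)" using cb b0 by linarith
  have "1 / cos (a * pi / 2) - 1 = (1 - cos (a * pi / 2)) / cos (a * pi / 2)" using c0 by (simp add: field_simps)
  also have "\<dots> \<le> ((a * pi / 2)\<^sup>2 / 2) / (3 / 4 * b)"
    using cos_ge_quadratic[of "a * pi / 2"] cb b0 by (intro frac_le) auto
  also have "\<dots> = a\<^sup>2 * pi\<^sup>2 / (6 * b)" by (simp add: power_divide power_mult_distrib)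
  also have "\<dots> \<le> a\<^sup>2 * (16 / 5)\<^sup>2 / (6 * b)"
    using b0 pi_le_16_5 by (intro divide_right_mono mult_left_mono power_mono) auto
  finally have sec: "1 / cos (a * pi / 2) - 1 \<le> a\<^sup>2 * (128 / (75 * b))" by (simp add: field_simps)
  \<comment> \<open>The square gives 20 b \<le> 16 b^2 + 25/4, with ample room.\<close>
  have "256 / 75 * b \<le> 16 * b\<^sup>2 + 25 / 4"
  proof -
    have "0 \<le> (4 * b - 5 / 2)\<^sup>2" by simp
    also have "\<dots> = 16 * b\<^sup>2 - 20 * b + 25 / 4" by (simp add: power2_eq_square algebra_simps)
    finally show ?thesis using b0 by linarith
  qed
  then have Kb: "2 * (128 / (75 * b)) \<le> 16 + 25 / (4 * b\<^sup>2)"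
    using b0 by (simp add: field_simps power2_eq_square)
  have "expectation (\<lambda>\<omega>. exp (a * R \<omega>)) \<le> expectation (\<lambda>\<omega>. 1 + a * R \<omega> + 2 * (cosh (a * X i \<omega>) - 1))"
  proof (rule integral_mono[OF int])
    show "integrable M (\<lambda>\<omega>. 1 + a * R \<omega> + 2 * (cosh (a * X i \<omega>) - 1))"
      using R_integrable cosh_moment(1)[of a i] a by auto
    show "exp (a * R \<omega>) \<le> 1 + a * R \<omega> + 2 * (cosh (a * X i \<omega>) - 1)" for \<omega>
    proof -
      have eq: "cosh (a * X i \<omega>) = cosh (a * R \<omega>)" by (auto simp: R abs_if)
      show ?thesis using exp_remainder_le_cosh[of "a * R \<omega>"] by (simp only: eq)
    qed
  qed
  also have "\<dots> = 1 + a * expectation R + 2 * (expectation (\<lambda>\<omega>. cosh (a * X i \<omega>)) - 1)"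
    using R_integrable cosh_moment(1)[of a i] a by (simp add: prob_space)
  also have "\<dots> \<le> 1 + a * expectation R + 2 * (1 / cos (a * pi / 2) - 1)"
    using cosh_moment(2)[of a i] a by simp
  also have "\<dots> \<le> exp (a * expectation R + 2 * (1 / cos (a * pi / 2) - 1))"
    using exp_ge_add_one_self[of "a * expectation R + 2 * (1 / cos (a * pi / 2) - 1)"] by simp
  also have "\<dots> \<le> exp (2 * a * expectation R + a\<^sup>2 * (16 + 25 / (4 * b\<^sup>2)))"
  proof -
    have "0 \<le> a * expectation R" using a R_nonneg by simp
    moreover have "a\<^sup>2 * (2 * (128 / (75 * b))) \<le> a\<^sup>2 * (16 + 25 / (4 * b\<^sup>2))" using Kb by (intro mult_left_mono) auto
    ultimately show ?thesis using sec by simp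
  qed
  finally show "expectation (\<lambda>\<omega>. exp (a * R \<omega>)) \<le> exp (2 * a * expectation R + a\<^sup>2 * (16 + 25 / (4 * b\<^sup>2)))" .
qed

text \<open>A polynomial in R^2 and R^4 is placed below \<open>R\<close>, with equality at 0 and
  contact of second order at \<open>c\<close>: the difference is R (R - c)^2 (R + 2 c) / (2 c^3).
  Taking expectations with E R^2 = c^2 / 3 and E R^4 \<le> c^4 / 3 gives c / 3.\<close>

lemma expectation_R_ge:
  assumes two: "2 \<le> CARD('n)" and c: "0 < c" "c\<^sup>2 = 3 * real CARD('n) * (pi / 2)\<^sup>2"
  shows "c / 3 \<le> expectation R"
proof -
  define n where "n = real CARD('n)"
  have n: "2 \<le> n" using two by (simp add: n_def)
  have pt: "(3 * c\<^sup>2 * (R \<omega>)\<^sup>2 - (R \<omega>) ^ 4) / (2 * c ^ 3) \<le> R \<omega>" for \<omega>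
  proof -
    have "0 \<le> R \<omega> * (R \<omega> - c)\<^sup>2 * (R \<omega> + 2 * c)" using R_nonneg[of \<omega>] c by simp
    then show ?thesis using c by (simp add: field_simps power2_eq_square numeral_eq_Suc)
  qed
  have "expectation (\<lambda>\<omega>. (3 * c\<^sup>2 * (R \<omega>)\<^sup>2 - (R \<omega>) ^ 4) / (2 * c ^ 3)) \<le> expectation R"
    using R_second_moment(1) R_fourth_moment(1) R_integrable pt by (intro integral_mono) auto
  moreover have "expectation (\<lambda>\<omega>. (3 * c\<^sup>2 * (R \<omega>)\<^sup>2 - (R \<omega>) ^ 4) / (2 * c ^ 3)) =
    (3 * c\<^sup>2 * (n * (pi / 2)\<^sup>2) - expectation (\<lambda>\<omega>. (R \<omega>) ^ 4)) / (2 * c ^ 3)"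
    using R_second_moment R_fourth_moment(1) by (simp add: n_def)
  moreover have "(3 * c\<^sup>2 * (n * (pi / 2)\<^sup>2) - c ^ 4 / 3) / (2 * c ^ 3) \<le>
    (3 * c\<^sup>2 * (n * (pi / 2)\<^sup>2) - expectation (\<lambda>\<omega>. (R \<omega>) ^ 4)) / (2 * c ^ 3)"
  proof (intro divide_right_mono diff_left_mono)
    \<comment> \<open>This is where two coordinates are required: n^2 + 4 n \<le> 3 n^2.\<close>
    have "n * 2 \<le> n * n" using n by (intro mult_left_mono) auto
    then have "(n\<^sup>2 + 4 * n) * (pi / 2) ^ 4 \<le> 3 * n\<^sup>2 * (pi / 2) ^ 4"
      by (intro mult_right_mono) (auto simp: power2_eq_square)
    also have "\<dots> = (c\<^sup>2)\<^sup>2 / 3" unfolding c(2) n_def by (simp add: power_mult_distrib power_divide)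
    finally show "expectation (\<lambda>\<omega>. (R \<omega>) ^ 4) \<le> c ^ 4 / 3" using R_fourth_moment(2) by (simp add: n_def)
  qed (use c in simp)
  moreover have "(3 * c\<^sup>2 * (n * (pi / 2)\<^sup>2) - c ^ 4 / 3) / (2 * c ^ 3) = c / 3"
  proof -
    have "n * (pi / 2)\<^sup>2 = c\<^sup>2 / 3" unfolding c(2) n_def by simp
    then show ?thesis using c(1) by (simp add: field_simps power2_eq_square numeral_eq_Suc)
  qed
  ultimately show ?thesis by linarith
qed

text \<open>Independence factorises the exponential of the Huber sum. Each factor is 1 plus a
  first-order term plus a remainder of size \<open>C / n\<close>, so the product over all
  coordinates pays for the remainder only once.\<close>

lemma exp_norm_multi_dim:
  assumes a: "0 < a" "a < 1" and b: "b = 1 - a" and two: "2 \<le> CARD('n)"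
  shows "integrable M (\<lambda>\<omega>. exp (a * R \<omega>))"
    "expectation (\<lambda>\<omega>. exp (a * R \<omega>)) \<le> exp (2 * a * expectation R + a\<^sup>2 * (16 + 25 / (4 * b\<^sup>2)))"
proof -
  define n where "n = real CARD('n)"
  define c where "c = sqrt (3 * n) * (pi / 2)"
  define C where "C = (if b < 1 / 2 then 3 * a\<^sup>2 else 3 * a\<^sup>2 / b\<^sup>2)"
  define \<theta> where "\<theta> = (1 + a) / 2"
  have n: "2 \<le> n" using two by (simp add: n_def)
  have b0: "0 < b" "b \<le> 1" using a b by auto
  have c0: "0 < c" using n by (simp add: c_def)
  have c2: "c\<^sup>2 = 3 * n * (pi / 2)\<^sup>2" unfolding c_def power_mult_distrib using n by simp
  \<comment> \<open>27/4 is 3 * (3/2)^2, obtained from pi \<ge> 3.\<close>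
  have c27: "27 / 4 * n \<le> c\<^sup>2"
  proof -
    have "(3 / 2)\<^sup>2 \<le> (pi / 2)\<^sup>2" using pi_ge_3 by (intro power_mono) auto
    then have "3 * n * (3 / 2)\<^sup>2 \<le> 3 * n * (pi / 2)\<^sup>2" using n by (intro mult_left_mono) auto
    then show ?thesis unfolding c2 by (simp add: power_divide)
  qed
  have C0: "0 \<le> C" by (simp add: C_def)
  have \<theta>: "\<bar>\<theta>\<bar> < 1" using a by (simp add: \<theta>_def)
  \<comment> \<open>The angle complementary to \<theta> pi / 2 is b pi / 4, so the cosh moment at
    rate \<theta> costs only a factor of order 1 / b.\<close>
  have cos\<theta>: "2 / 3 * b \<le> cos (\<theta> * pi / 2)"
  proof -
    have "cos (\<theta> * pi / 2) = sin (b * pi / 4)"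
      using sin_cos_eq[of "b * pi / 4"] by (simp add: b \<theta>_def field_simps)
    then show ?thesis using sin_quarter_ge[of b] b0 by simp
  qed
  let ?h = "\<lambda>i \<omega>. exp (a * huber c (X i \<omega>))"
  have hint: "integrable M (?h i)" for i
  proof (rule Bochner_Integration.integrable_bound[OF exp_abs_integrable[OF a, of i]])
    show "AE \<omega> in M. norm (?h i \<omega>) \<le> norm (exp (a * \<bar>X i \<omega>\<bar>))"
      using huber_le_abs[OF c0] a by (intro AE_I2) simp
  qed measurable
  define L where "L = a * (pi / 2)\<^sup>2 / (2 * c) + C / n * (3 / (2 * b))"
  have hexp: "expectation (?h i) \<le> exp L" for i
  proof -
    have "expectation (?h i) \<le> expectation (\<lambda>\<omega>. 1 + a / (2 * c) * (X i \<omega>)\<^sup>2 + C / n * cosh (\<theta> * X i \<omega>))"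
    proof (rule integral_mono[OF hint])
      show "integrable M (\<lambda>\<omega>. 1 + a / (2 * c) * (X i \<omega>)\<^sup>2 + C / n * cosh (\<theta> * X i \<omega>))"
        using second_moment(1) cosh_moment(1)[OF \<theta>] by auto
      show "?h i \<omega> \<le> 1 + a / (2 * c) * (X i \<omega>)\<^sup>2 + C / n * cosh (\<theta> * X i \<omega>)" for \<omega>
      proof -
        let ?x = "X i \<omega>"
        have "n * (exp (a * huber c ?x) - 1 - a * huber c ?x) \<le> C * cosh (\<theta> * ?x)"
          unfolding C_def \<theta>_def by (rule huber_exp_remainder[OF a b _ c0 c27]) (use n in simp)
        then have "exp (a * huber c ?x) - 1 - a * huber c ?x \<le> C / n * cosh (\<theta> * ?x)"
          using n by (simp add: field_simps)
        moreover have "a * huber c ?x \<le> a * (?x\<^sup>2 / (2 * c))"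
          using huber_le_square[OF c0] a by (intro mult_left_mono) auto
        ultimately show ?thesis by simp
      qed
    qed
    also have "\<dots> = 1 + a / (2 * c) * (pi / 2)\<^sup>2 + C / n * expectation (\<lambda>\<omega>. cosh (\<theta> * X i \<omega>))"
      using second_moment cosh_moment(1)[OF \<theta>] by (simp add: prob_space)
    also have "\<dots> \<le> 1 + a / (2 * c) * (pi / 2)\<^sup>2 + C / n * (3 / (2 * b))"
    proof (intro add_left_mono mult_left_mono)
      have "expectation (\<lambda>\<omega>. cosh (\<theta> * X i \<omega>)) \<le> 1 / cos (\<theta> * pi / 2)" by (rule cosh_moment(2)[OF \<theta>])
      also have "\<dots> \<le> 1 / (2 / 3 * b)" using cos\<theta> b0 by (intro divide_left_mono) auto
      finally show "expectation (\<lambda>\<omega>. cosh (\<theta> * X i \<omega>)) \<le> 3 / (2 * b)" by simp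
    qed (use C0 n in simp)
    also have "\<dots> = 1 + L" by (simp add: L_def)
    also have "\<dots> \<le> exp L" by (rule exp_ge_add_one_self)
    finally show ?thesis .
  qed
  have iv: "indep_vars (\<lambda>_. borel) ?h UNIV"
    by (rule indep_vars_compose2[OF indep]) measurable
  have bound: "exp (a * R \<omega>) \<le> exp (a * c / 2) * (\<Prod>i\<in>UNIV. ?h i \<omega>)" for \<omega>
  proof -
    have "a * R \<omega> \<le> a * (c / 2 + (\<Sum>i\<in>UNIV. huber c (X i \<omega>)))"
      unfolding R_def using L2_set_le_huber[OF c0] a by (intro mult_left_mono) auto
    then have "exp (a * R \<omega>) \<le> exp (a * c / 2 + (\<Sum>i\<in>UNIV. a * huber c (X i \<omega>)))"
      by (simp add: distrib_left sum_distrib_left)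
    then show ?thesis by (simp add: exp_add exp_sum)
  qed
  have pint: "integrable M (\<lambda>\<omega>. exp (a * c / 2) * (\<Prod>i\<in>UNIV. ?h i \<omega>))"
    using indep_vars_integrable[OF _ iv hint] by simp
  show int: "integrable M (\<lambda>\<omega>. exp (a * R \<omega>))"
  proof (rule Bochner_Integration.integrable_bound[OF pint])
    show "AE \<omega> in M. norm (exp (a * R \<omega>)) \<le> norm (exp (a * c / 2) * (\<Prod>i\<in>UNIV. ?h i \<omega>))"
      using order_trans[OF bound abs_ge_self] by (intro AE_I2) simp
  qed measurable
  have "expectation (\<lambda>\<omega>. exp (a * R \<omega>)) \<le> expectation (\<lambda>\<omega>. exp (a * c / 2) * (\<Prod>i\<in>UNIV. ?h i \<omega>))"
    by (rule integral_mono[OF int pint bound])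
  also have "\<dots> = exp (a * c / 2) * (\<Prod>i\<in>UNIV. expectation (?h i))"
    using indep_vars_lebesgue_integral[OF _ iv hint] by simp
  also have "\<dots> \<le> exp (a * c / 2) * (\<Prod>i\<in>(UNIV :: 'n set). exp L)"
    using hexp by (intro mult_left_mono prod_mono) (auto intro: integral_nonneg)
  also have "\<dots> = exp (a * c / 2 + n * L)"
    by (simp add: exp_add exp_of_nat_mult[symmetric] n_def)
  also have "\<dots> \<le> exp (2 * a * expectation R + a\<^sup>2 * (16 + 25 / (4 * b\<^sup>2)))"
  proof -
    have "n * L = a * (n * (pi / 2)\<^sup>2) / (2 * c) + C * (3 / (2 * b))"
      using n by (simp add: L_def distrib_left)
    also have "n * (pi / 2)\<^sup>2 = c\<^sup>2 / 3" unfolding c2 by simp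
    finally have "a * c / 2 + n * L = 2 * a * (c / 3) + C * (3 / (2 * b))"
      using c0 by (simp add: field_simps power2_eq_square)
    moreover have "2 * a * (c / 3) \<le> 2 * a * expectation R"
      using expectation_R_ge[OF two c0] c2 a by (intro mult_left_mono) (auto simp: n_def)
    \<comment> \<open>The left side is 9 a^2 / (2 b) or 9 a^2 / (2 b^3). The first grows more slowly
      than 25 / (4 b^2) as \<open>b\<close> tends to 0; the second would not fit there, but occurs
      only for b \<ge> 1/2.\<close>
    moreover have "C * (3 / (2 * b)) \<le> a\<^sup>2 * (16 + 25 / (4 * b\<^sup>2))"
    proof (cases "b < 1 / 2")
      case True
      have "0 \<le> (4 * b - 5 / 2)\<^sup>2" by simp
      then have "9 / 2 * b \<le> 16 * b\<^sup>2 + 25 / 4" using b0 by (simp add: power2_eq_square algebra_simps)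
      then have "9 / (2 * b) \<le> 16 + 25 / (4 * b\<^sup>2)" using b0 by (simp add: field_simps power2_eq_square)
      then have "a\<^sup>2 * (9 / (2 * b)) \<le> a\<^sup>2 * (16 + 25 / (4 * b\<^sup>2))" by (intro mult_left_mono) auto
      then show ?thesis using True by (simp add: C_def)
    next
      case False
      have "(1 / 2) ^ 3 \<le> b ^ 3" using False by (intro power_mono) auto
      then have "9 / 2 \<le> 16 * b ^ 3 + 25 / 4 * b" using False by (simp add: power_divide)
      then have "9 / (2 * b ^ 3) \<le> 16 + 25 / (4 * b\<^sup>2)" using b0 by (simp add: field_simps power2_eq_square power3_eq_cube)
      then have "a\<^sup>2 * (9 / (2 * b ^ 3)) \<le> a\<^sup>2 * (16 + 25 / (4 * b\<^sup>2))" by (intro mult_left_mono) auto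
      then show ?thesis using False by (simp add: C_def power2_eq_square power3_eq_cube)
    qed
    ultimately show ?thesis by simp
  qed
  finally show "expectation (\<lambda>\<omega>. exp (a * R \<omega>)) \<le> exp (2 * a * expectation R + a\<^sup>2 * (16 + 25 / (4 * b\<^sup>2)))" .
qed

lemma exp_norm:
  assumes a: "0 < a" "a < 1" and b: "b = 1 - a"
  shows "integrable M (\<lambda>\<omega>. exp (a * R \<omega>))"
    "expectation (\<lambda>\<omega>. exp (a * R \<omega>)) \<le> exp (2 * a * expectation R + a\<^sup>2 * (16 + 25 / (4 * b\<^sup>2)))"
proof -
  have "CARD('n) \<noteq> 0" by simp
  then consider "CARD('n) = 1" | "2 \<le> CARD('n)" by linarith
  then show "integrable M (\<lambda>\<omega>. exp (a * R \<omega>))"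
    "expectation (\<lambda>\<omega>. exp (a * R \<omega>)) \<le> exp (2 * a * expectation R + a\<^sup>2 * (16 + 25 / (4 * b\<^sup>2)))"
    using exp_norm_one_dim[OF a b] exp_norm_multi_dim[OF a b] by (cases; blast)+
qed

text \<open>Markov's inequality for \<open>exp (a * R)\<close>; centring at twice the expectation
  cancels the term \<open>2 * a * expectation R\<close> of the exponent exactly.\<close>

lemma norm_tail:
  assumes a: "0 < a" "a < 1" and b: "b = 1 - a"
  shows "prob {\<omega>\<in>space M. x \<le> R \<omega> - 2 * expectation R} \<le> exp (- (a * x) + a\<^sup>2 * (16 + 25 / (4 * b\<^sup>2)))"
proof -
  let ?A = "{\<omega>\<in>space M. x \<le> R \<omega> - 2 * expectation R}"
  have A: "?A \<in> events" by measurable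
  let ?c = "exp (- (a * x) - 2 * a * expectation R)"
  have "prob ?A = expectation (indicator ?A)" using A by simp
  also have "\<dots> \<le> expectation (\<lambda>\<omega>. ?c * exp (a * R \<omega>))"
  proof (rule integral_mono)
    show "integrable M (indicator ?A :: 'a \<Rightarrow> real)" using A by (simp add: less_top[symmetric])
    show "integrable M (\<lambda>\<omega>. ?c * exp (a * R \<omega>))" using exp_norm(1)[OF a b] by simp
    show "indicator ?A \<omega> \<le> ?c * exp (a * R \<omega>)" for \<omega>
    proof (cases "\<omega> \<in> ?A")
      case True
      then have "a * x \<le> a * (R \<omega> - 2 * expectation R)" using a by (intro mult_left_mono) auto
      then have "0 \<le> - (a * x) - 2 * a * expectation R + a * R \<omega>" by (simp add: algebra_simps)
      then have "1 \<le> exp (- (a * x) - 2 * a * expectation R + a * R \<omega>)" by simp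
      then show ?thesis using True by (simp add: exp_add)
    qed simp
  qed
  also have "\<dots> \<le> ?c * exp (2 * a * expectation R + a\<^sup>2 * (16 + 25 / (4 * b\<^sup>2)))"
    using exp_norm[OF a b] by simp
  also have "\<dots> = exp (- (a * x) + a\<^sup>2 * (16 + 25 / (4 * b\<^sup>2)))" by (simp add: exp_add[symmetric])
  finally show ?thesis .
qed

end

section \<open>Transfer to the areas on [0, T]\<close>

lemma levy_area_norm_tail:
  fixes M :: "'a measure" and S :: "'a \<Rightarrow> real ^ 'n::finite"
    and B1 B2 :: "'n \<Rightarrow> real \<Rightarrow> 'a \<Rightarrow> real" and i1 :: 'n
  assumes "prob_space M" and T: "T > 0"
    and B: "\<And>i. brownian_motion_2d M (B1 i) (B2 i)"
    and S: "\<And>i. levy_area M T (B1 i) (B2 i) (\<lambda>\<omega>. S \<omega> $ i)"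
    and ind: "prob_space.indep_vars M (\<lambda>_. borel) (\<lambda>i \<omega>. S \<omega> $ i) UNIV"
    and b: "0 < b" "b < 1"
  shows "measure M {\<omega> \<in> space M. norm (S \<omega>) - 2 * (\<integral>\<omega>. norm (S \<omega>) \<partial>M) \<ge> x}
    \<le> exp (- ((1 - b) * pi / T) * x + levy_area_K T (\<integral>\<omega>. \<bar>S \<omega> $ i1\<bar> \<partial>M) b)"
proof -
  interpret prob_space M by fact
  have bp: "brownian_pair M (B1 i) (B2 i)" for i
    by unfold_locales (rule B)
  note second = brownian_pair.levy_area_second_moment[OF bp T S]
  note fourth = brownian_pair.levy_area_fourth_moment[OF bp T S]
  note ch = brownian_pair.levy_area_cosh[OF bp T S]
  note [measurable] = brownian_pair.levy_area_measurable[OF bp S]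
  \<comment> \<open>This scaling moves the critical rate pi / T of the exponential moments to 1, and
    the tail level \<open>x\<close> becomes \<open>k * x\<close>.\<close>
  define k where "k = pi / T"
  have k: "0 < k" using T by (simp add: k_def)
  interpret X: sech_vector M "\<lambda>i \<omega>. k * (S \<omega> $ i)"
  proof
    show "indep_vars (\<lambda>_. borel) (\<lambda>i \<omega>. k * (S \<omega> $ i)) UNIV"
      by (rule indep_vars_compose2[OF ind]) measurable
    fix i
    show "integrable M (\<lambda>\<omega>. (k * (S \<omega> $ i))\<^sup>2)" "integrable M (\<lambda>\<omega>. (k * (S \<omega> $ i)) ^ 4)"
      using second(1)[of i] fourth(1)[of i] by (simp_all add: power_mult_distrib)
    have kT: "k * (T / 2) = pi / 2" using T by (simp add: k_def)
    show "expectation (\<lambda>\<omega>. (k * (S \<omega> $ i))\<^sup>2) = (pi / 2)\<^sup>2"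
      using second(2)[of i] unfolding kT[symmetric] by (simp add: power_mult_distrib power_divide)
    have "k ^ 4 * expectation (\<lambda>\<omega>. (S \<omega> $ i) ^ 4) \<le> k ^ 4 * (5 * (T / 2) ^ 4)"
      using fourth(2)[of i] k by (intro mult_left_mono) auto
    then show "expectation (\<lambda>\<omega>. (k * (S \<omega> $ i)) ^ 4) \<le> 5 * (pi / 2) ^ 4"
      unfolding kT[symmetric] power_mult_distrib by (simp add: mult.left_commute)
    fix c :: real assume "\<bar>c\<bar> < 1"
    then have c: "\<bar>c * k\<bar> * T < pi" using T by (simp add: k_def abs_mult)
    have ckT: "c * k * T / 2 = c * pi / 2" using T by (simp add: k_def)
    show "integrable M (\<lambda>\<omega>. cosh (c * (k * (S \<omega> $ i))))"
      "expectation (\<lambda>\<omega>. cosh (c * (k * (S \<omega> $ i)))) \<le> 1 / cos (c * pi / 2)"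
      using ch[OF c, of i] unfolding ckT by (simp_all add: mult.assoc)
  qed
  have R: "X.R \<omega> = k * norm (S \<omega>)" for \<omega>
    unfolding X.R_def norm_vec_def using k
    by (simp add: L2_set_def power_mult_distrib sum_distrib_left[symmetric] real_sqrt_mult)
  have "measure M {\<omega> \<in> space M. norm (S \<omega>) - 2 * (\<integral>\<omega>. norm (S \<omega>) \<partial>M) \<ge> x} =
    prob {\<omega>\<in>space M. k * x \<le> X.R \<omega> - 2 * expectation X.R}"
  proof -
    have "k * x \<le> X.R \<omega> - 2 * expectation X.R \<longleftrightarrow> x \<le> norm (S \<omega>) - 2 * (\<integral>\<omega>. norm (S \<omega>) \<partial>M)" for \<omega>
    proof -
      have "X.R \<omega> - 2 * expectation X.R = k * (norm (S \<omega>) - 2 * (\<integral>\<omega>. norm (S \<omega>) \<partial>M))"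
        unfolding R[abs_def] by (simp add: algebra_simps)
      then show ?thesis using k by (simp only: mult_le_cancel_left_pos)
    qed
    then show ?thesis by simp
  qed
  also have "\<dots> \<le> exp (- ((1 - b) * (k * x)) + (1 - b)\<^sup>2 * (16 + 25 / (4 * b\<^sup>2)))"
    using b by (intro X.norm_tail) auto
  also have "\<dots> \<le> exp (- ((1 - b) * pi / T) * x + levy_area_K T (\<integral>\<omega>. \<bar>S \<omega> $ i1\<bar> \<partial>M) b)"
  proof -
    define m where "m = (\<integral>\<omega>. \<bar>S \<omega> $ i1\<bar> \<partial>M)"
    have Si: "integrable M (\<lambda>\<omega>. S \<omega> $ i1)"
      by (rule square_integrable_imp_integrable[OF _ second(1)[of i1]]) measurable
    \<comment> \<open>Division by zero yields 0, so with \<open>m = 0\<close> the last term of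
      \<open>levy_area_K\<close> would vanish. A zero mean of the absolute value would make the
      coordinate vanish almost surely, against its variance T^2 / 4.\<close>
    have "0 < m"
    proof (rule ccontr)
      assume "\<not> 0 < m"
      moreover have "0 \<le> m" by (simp add: m_def)
      ultimately have "m = 0" by simp
      then have "AE \<omega> in M. \<bar>S \<omega> $ i1\<bar> = 0"
        unfolding m_def using Si by (subst (asm) integral_nonneg_eq_0_iff_AE) auto
      then have "expectation (\<lambda>\<omega>. (S \<omega> $ i1)\<^sup>2) = expectation (\<lambda>\<omega>. 0)"
        by (intro integral_cong_AE) auto
      then show False using second(2)[of i1] T by simp
    qed
    moreover have "m \<le> T / 2"
    proof -
      have "m \<le> expectation (\<lambda>\<omega>. (S \<omega> $ i1)\<^sup>2 / T + T / 4)"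
        unfolding m_def
      proof (rule integral_mono)
        show "integrable M (\<lambda>\<omega>. \<bar>S \<omega> $ i1\<bar>)" using Si by simp
        show "integrable M (\<lambda>\<omega>. (S \<omega> $ i1)\<^sup>2 / T + T / 4)" using second(1)[of i1] by simp
        fix \<omega>
        \<comment> \<open>A tangent bound at T / 2, the standard deviation, so that its expectation
          is exactly T / 2.\<close>
        have "0 \<le> (\<bar>S \<omega> $ i1\<bar> - T / 2)\<^sup>2 / T" using T by simp
        also have "\<dots> = (S \<omega> $ i1)\<^sup>2 / T + T / 4 - \<bar>S \<omega> $ i1\<bar>"
          using T by (simp add: power2_diff add_divide_distrib diff_divide_distrib power_divide) (simp add: power2_eq_square)
        finally show "\<bar>S \<omega> $ i1\<bar> \<le> (S \<omega> $ i1)\<^sup>2 / T + T / 4" by simp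
      qed
      also have "\<dots> = expectation (\<lambda>\<omega>. (S \<omega> $ i1)\<^sup>2) / T + T / 4" using second(1)[of i1] by (simp add: prob_space)
      also have "\<dots> = T / 2" unfolding second(2) using T by (simp add: power2_eq_square)
      finally show ?thesis .
    qed
    ultimately show ?thesis
      using levy_area_K_ge[OF b, of m T] by (simp add: m_def k_def)
  qed
  finally show ?thesis .
qed

theorem proposition4p11:
  fixes M :: "'a measure" and T b :: real
    and B1 B2 :: "'n::finite \<Rightarrow> real \<Rightarrow> 'a \<Rightarrow> real"
    and S :: "'a \<Rightarrow> real ^ 'n" and i1 :: 'n
  defines "K \<equiv> levy_area_K T (\<integral>\<omega>. \<bar>S \<omega> $ i1\<bar> \<partial>M)"
  assumes "prob_space M" and "T > 0"
    and "\<And>i. brownian_motion_2d M (B1 i) (B2 i)"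
    and "\<And>i. levy_area M T (B1 i) (B2 i) (\<lambda>\<omega>. S \<omega> $ i)"
    and "prob_space.indep_vars M (\<lambda>_. borel) (\<lambda>i \<omega>. S \<omega> $ i) UNIV"
    and "\<And>i j. distr M borel (\<lambda>\<omega>. S \<omega> $ i) = distr M borel (\<lambda>\<omega>. S \<omega> $ j)"
    and "0 < b" and "b < 1"
  shows "(\<forall>x>0. measure M {\<omega> \<in> space M. norm (S \<omega>) - 2 * (\<integral>\<omega>. norm (S \<omega>) \<partial>M) \<ge> x}
            \<le> exp (- ((1 - b) * pi / T) * x + K b)) \<and>
         (\<forall>x \<ge> 2 * T / (pi * b) * K (b / 2).
            measure M {\<omega> \<in> space M. norm (S \<omega>) - 2 * (\<integral>\<omega>. norm (S \<omega>) \<partial>M) \<ge> x}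
            \<le> exp (- ((1 - b) * pi / T) * x))"
proof -
  note tail = levy_area_norm_tail[of M T B1 B2 S _ _ i1, OF assms(2-6), folded K_def]
  \<comment> \<open>The estimate is applied at \<open>b / 2\<close>. This leaves a surplus rate of
    (b / 2) pi / T, and the threshold for \<open>x\<close> is the point from which the surplus pays
    for \<open>K (b / 2)\<close>.\<close>
  have "measure M {\<omega> \<in> space M. norm (S \<omega>) - 2 * (\<integral>\<omega>. norm (S \<omega>) \<partial>M) \<ge> x}
            \<le> exp (- ((1 - b) * pi / T) * x)" if x: "x \<ge> 2 * T / (pi * b) * K (b / 2)" for x
  proof -
    have "b / 2 * pi / T * (2 * T / (pi * b) * K (b / 2)) \<le> b / 2 * pi / T * x"
      using x assms by (intro mult_left_mono) auto
    then have "K (b / 2) \<le> b / 2 * pi / T * x" using assms by simp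
    then have "- ((1 - b / 2) * pi / T) * x + K (b / 2) \<le> - ((1 - b) * pi / T) * x"
      using \<open>T > 0\<close> by (simp add: field_simps)
    then have "exp (- ((1 - b / 2) * pi / T) * x + K (b / 2)) \<le> exp (- ((1 - b) * pi / T) * x)"
      by (simp only: exp_le_cancel_iff)
    moreover have "measure M {\<omega> \<in> space M. norm (S \<omega>) - 2 * (\<integral>\<omega>. norm (S \<omega>) \<partial>M) \<ge> x}
      \<le> exp (- ((1 - b / 2) * pi / T) * x + K (b / 2))"
      using assms by (intro tail) auto
    ultimately show ?thesis by linarith
  qed
  moreover have "measure M {\<omega> \<in> space M. norm (S \<omega>) - 2 * (\<integral>\<omega>. norm (S \<omega>) \<partial>M) \<ge> x}
            \<le> exp (- ((1 - b) * pi / T) * x + K b)" for x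
    using assms by (intro tail) auto
  ultimately show ?thesis by blast
qed

end
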